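(* A system of representatives of the isomorphism classes of the irreducible objects of the category of almost admissible $q$-difference modules over $\mathbf{K}$ (resp. of the category $\widehat{\mathcal{B}}_q$ of $q$-difference modules over $\widehat{\mathbf{K}}$) is given by the union of the following sets: - the rank $1$ $q$-difference modules $\mathcal{M}_{\mu,\lambda}$, with $\mu\in\mathbb{Z}$ and $\lambda\in\mathbf{C}^\ast/q^{\mathbb{Z}}$ (i.e. the irreducible objects of the category of admissible $q$-difference modules over $\mathbf{K}$, up to isomorphism); - the $q$-difference modules $\mathcal{N}_{\mu/n,\lambda}=Res_n(\mathcal{M}_{\mu,\lambda,n})$, where $n\in\mathbb{Z}_{>0}$, $\mu\in\mathbb{Z}$, $(n,\mu)=1$, and $\lambda\in\mathbf{C}^\ast/(q^{1/n})^{\mathbb{Z}}$.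
   Context: Let $(\mathbf{C},|\cdot|)$ be either $\mathbb{C}$ with the usual norm or an algebraically closed field with an ultrametric norm. Fix $q\in\mathbf{C}$ with $|q|=1$, not a root of unity, and elements $q^{1/n}\in\mathbf{C}$ with $(q^{1/n})^n=q$. Put $(\lambda;q)_0=1$, $(\lambda;q)_n=(1-\lambda)(1-q\lambda)\cdots(1-q^{n-1}\lambda)$ for $n\ge1$. "Convergent" means with positive radius of convergence. Standing assumption: $\sum_{n\ge0}\frac{x^n}{(q;q)_n}$ is convergent. For a finite set $\Lambda\subset\mathbf{C}^\ast\smallsetminus q^{\mathbb{Z}_{\le0}}$ put $\phi_{(q;\Lambda)}(x)=\sum_{n\ge0}\frac{x^n}{\prod_{\lambda\in\Lambda}(\lambda;q)_n}$. Operators. $\mathbf{C}\{x\}$ is the ring of germs of analytic functions at $0$ and $\mathbf{C}\{x\}[\sigma_q]$ is the skew polynomial ring with $\sigma_q f(x)=f(qx)\sigma_q$. For $\mathcal{L}=\sum_{i=0}^{\nu}a_i(x)\sigma_q^i$ with $a_\nu\ne0$, the Newton polygon is the convex hull in $\mathbb{R}^2$ of $\{(i,k)\in\mathbb{Z}\times\mathbb{R}:0\le i\le\nu,\ a_i\ne0,\ k\ge\mathrm{ord}_xa_i\}$ (common powers of $x$ in the coefficients being cleared so that it meets the horizontal axis); its finite slopes are the slopes of $\mathcal{L}$. Exponents. If $0$ is a slope, its characteristic polynomial is $\sum_i a_i(0)T^i$. For a slope $\mu\in\mathbb{Z}$ the characteristic polynomial is that of the zero slope of the operator $x^C\sum_i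 a_i(x)(x^{-\mu}\sigma_q)^i$, with $C$ a convenient integer (clearing powers of $x$). For $\mu\in\mathbb{Q}$, put $t=x^{1/n}$ with $n\mu\in\mathbb{Z}$, replace $\mathcal{L}$ by $\sum a_i(t^n)\sigma_{q^{1/n}}^i$ and use its slope $n\mu$. The exponents of $\mu$ are the non-zero roots $\lambda_1,\dots,\lambda_r$ of the characteristic polynomial, with multiplicities. Admissibility. A slope $\mu\in\mathbb{Z}$ is admissible if $\phi_{(q;\underline\Lambda)}(x)$ is convergent for $\underline\Lambda=\{\lambda_i\lambda_j^{-1}: 1\le i,j\le r,\ \lambda_i\lambda_j^{-1}\notin q^{\mathbb{Z}_{\le0}}\}$. A slope $\mu\in\mathbb{Q}$ is almost admissible if it becomes admissible in $\mathbf{C}\{x^{1/n}\}[\sigma_{q^{1/n}}]$ (with $x,q$ replaced by $x^{1/n},q^{1/n}$) for a convenient $n\ge1$. $\mathcal{L}$ is admissible (resp. almost admissible) if all its slopes are. Modules. $\mathbf{K}=\mathrm{Frac}(\mathbf{C}\{x\})$, $\widehat{\mathbf{K}}=\mathbf{C}((x))$, $\mathbf{K}_n=\mathbf{K}(x^{1/n})$, $\widehat{\mathbf{K}}_n=\widehat{\mathbf{K}}(x^{1/n})$, with $\sigma_q$ extended by $\sigma_q x^{1/n}=q^{1/n}x^{1/n}$. A $q$-difference module over such a field $F$ is a finite-dimensional $F$-vector space $M$ with a bijective $\mathbf{C}$-linear map $\Sigma_q$ with $\Sigma_q(fm)=\sigma_q(f)\Sigma_q(m)$; morphisms are $F$-linear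 maps commuting with the $\Sigma_q$'s. A module over $\mathbf{K}$ is (almost) admissible if it is isomorphic to $\mathbf{K}[\sigma_q,\sigma_q^{-1}]/\mathbf{K}[\sigma_q,\sigma_q^{-1}]\mathcal{L}$ for some (almost) admissible $\mathcal{L}\in\mathbf{C}\{x\}[\sigma_q]$; the (almost) admissible modules form a full subcategory of the category of $q$-difference modules over $\mathbf{K}$. Irreducible means having no proper non-zero $q$-difference submodule. $\mathcal{M}_{\mu,\lambda}$ ($\mu\in\mathbb{Z}$, $\lambda\in\mathbf{C}^\ast$) is the rank one module over $\mathbf{K}$ (resp. $\widehat{\mathbf{K}}$) with a basis $e$ such that $\Sigma_qe=\frac{\lambda}{x^\mu}e$; up to isomorphism it depends only on $\mu$ and on the class of $\lambda$ modulo $q^{\mathbb{Z}}$. $\mathcal{M}_{\mu,\lambda,n}$ is the rank one module over $\mathbf{K}_n$ (resp. $\widehat{\mathbf{K}}_n$) with a basis $e$ such that $\Sigma_qe=\frac{\lambda}{x^{\mu/n}}e$ (associated to $x^{\mu/n}y(qx)=\lambda y(x)$). $Res_n$ is restriction of scalars from $\mathbf{K}_n$ to $\mathbf{K}$ (resp. $\widehat{\mathbf{K}}_n$ to $\widehat{\mathbf{K}}$), which multiplies the rank by $n$.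
   Formalization: In the second set, λ is taken modulo the group generated by q^{1/n} and all n-th roots of unity instead of (q^{1/n})^Z, since f(t)↦f(zt) with z^n=1 makes N_{μ/n,λ} and N_{μ/n,λz^{-μ}} isomorphic (e.g. N_{1/2,λ} ≅ N_{1/2,-λ}). *)

theory Defs
  imports
    "HOL-Analysis.Analysis"
    "HOL-Computational_Algebra.Computational_Algebra"
    "HOL-Algebra.AbelCoset"
    "HOL-Algebra.Module"
begin

section \<open>The base field\<close>

definition absolute_value :: "('c::field \<Rightarrow> real) \<Rightarrow> bool" where
  "absolute_value N \<longleftrightarrow>
     (\<forall>x. 0 \<le> N x) \<and> (\<forall>x. N x = 0 \<longleftrightarrow> x = 0) \<and>
     (\<forall>x y. N (x * y) = N x * N y) \<and> (\<forall>x y. N (x + y) \<le> N x + N y)"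

definition ultrametric_norm :: "('c::field \<Rightarrow> real) \<Rightarrow> bool" where
  "ultrametric_norm N \<longleftrightarrow> absolute_value N \<and> (\<forall>x y. N (x + y) \<le> max (N x) (N y))"

text \<open>The complex numbers enter up to an isometric isomorphism of fields, so that both cases live on
  one type.\<close>

definition usual_complex_norm :: "('c::field \<Rightarrow> real) \<Rightarrow> bool" where
  "usual_complex_norm N \<longleftrightarrow>
     (\<exists>h :: 'c \<Rightarrow> complex. bij h \<and> (\<forall>x y. h (x + y) = h x + h y) \<and>
        (\<forall>x y. h (x * y) = h x * h y) \<and> (\<forall>x. N x = cmod (h x)))"

definition base_field_norm :: "('c::alg_closed_field \<Rightarrow> real) \<Rightarrow> bool" where
  "base_field_norm N \<longleftrightarrow> usual_complex_norm N \<or> ultrametric_norm N"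


section \<open>Convergent series\<close>

text \<open>Radius of convergence by the root formula, as in \<open>conv_radius\<close> but for an arbitrary
  norm on the coefficients.\<close>

definition radius :: "('c::field \<Rightarrow> real) \<Rightarrow> 'c fps \<Rightarrow> ereal" where
  "radius N a = inverse (limsup (\<lambda>n. ereal (root n (N (fps_nth a n)))))"

definition convergent_fps :: "('c::field \<Rightarrow> real) \<Rightarrow> 'c fps \<Rightarrow> bool" where
  "convergent_fps N a \<longleftrightarrow> radius N a > 0"

definition qpoch :: "'c::field \<Rightarrow> 'c \<Rightarrow> nat \<Rightarrow> 'c" where
  "qpoch l q n = (\<Prod>k<n. 1 - q ^ k * l)"

definition q_phi :: "'c::field \<Rightarrow> 'c set \<Rightarrow> 'c fps" where
  "q_phi q \<Lambda> = Abs_fps (\<lambda>n. 1 / (\<Prod>l\<in>\<Lambda>. qpoch l q n))"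

text \<open>Germs of analytic functions at 0 are power series of positive radius; \<open>K_field\<close> is the fraction
  field of their ring inside the field of all Laurent series.  The field of all formal Laurent
  series is \<open>UNIV\<close>.\<close>

definition K_field :: "('c::field \<Rightarrow> real) \<Rightarrow> 'c fls set" where
  "K_field N = {fps_to_fls a / fps_to_fls b | a b.
                  convergent_fps N a \<and> convergent_fps N b \<and> b \<noteq> 0}"

text \<open>\<open>sigma q f\<close> is \<open>f(q x)\<close>.\<close>

lift_definition sigma :: "'c::field \<Rightarrow> 'c fls \<Rightarrow> 'c fls" is
  "\<lambda>q f k. q powi k * f k"
  by (erule MOST_mono) simp

text \<open>The field \<open>F(x^(1/n))\<close>, written in the variable \<open>t = x^(1/n)\<close>: an element \<open>f(x)\<close> of \<open>F\<close> is
  identified with \<open>f(t^n)\<close>, which is \<open>fls_compose_power f n\<close>.  On this field the operator is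
  \<open>sigma r\<close>, where \<open>r\<close> is the chosen \<open>n\<close>-th root of \<open>q\<close>.\<close>

definition root_ext :: "nat \<Rightarrow> 'c::field fls set \<Rightarrow> 'c fls set" where
  "root_ext n F = {\<Sum>i<n. fls_compose_power (f i) n * fls_X ^ i | f. \<forall>i. f i \<in> F}"

definition fls_subring :: "'c::field fls set \<Rightarrow> 'c fls ring" where
  "fls_subring F = \<lparr>carrier = F, monoid.mult = (*), one = 1, ring.zero = 0, add = (+)\<rparr>"


section \<open>Difference modules\<close>

text \<open>Below, the base field is a subfield \<open>F\<close> of the Laurent series stable under \<open>sigma q\<close>.
  The fields \<open>mult\<close> and \<open>one\<close> inherited by every \<open>module\<close> record are not used.\<close>

record ('a, 'm) qdm = "('a, 'm) module" +
  Sig :: "'m \<Rightarrow> 'm"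

text \<open>Linearity of \<open>Sig\<close> over the constants is the case of constant \<open>f\<close> in the last clause.\<close>

definition qdiff_module :: "'c::field fls set \<Rightarrow> 'c \<Rightarrow> ('c fls, 'm) qdm \<Rightarrow> bool" where
  "qdiff_module F q M \<longleftrightarrow>
     module (fls_subring F) M \<and>
     (\<exists>B. finite B \<and> B \<subseteq> carrier M \<and>
        (\<forall>m\<in>carrier M. \<exists>c\<in>B \<rightarrow> F. m = (\<Oplus>\<^bsub>M\<^esub>b\<in>B. c b \<odot>\<^bsub>M\<^esub> b))) \<and>
     bij_betw (Sig M) (carrier M) (carrier M) \<and>
     (\<forall>m\<in>carrier M. \<forall>m'\<in>carrier M. Sig M (m \<oplus>\<^bsub>M\<^esub> m') = Sig M m \<oplus>\<^bsub>M\<^esub> Sig M m') \<and>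
     (\<forall>f\<in>F. \<forall>m\<in>carrier M. Sig M (f \<odot>\<^bsub>M\<^esub> m) = sigma q f \<odot>\<^bsub>M\<^esub> Sig M m)"

definition qdm_hom ::
    "'c::field fls set \<Rightarrow> ('c fls, 'm) qdm \<Rightarrow> ('c fls, 'k) qdm \<Rightarrow> ('m \<Rightarrow> 'k) set" where
  "qdm_hom F M M' =
     {h \<in> carrier M \<rightarrow> carrier M'.
        (\<forall>m\<in>carrier M. \<forall>n\<in>carrier M. h (m \<oplus>\<^bsub>M\<^esub> n) = h m \<oplus>\<^bsub>M'\<^esub> h n) \<and>
        (\<forall>f\<in>F. \<forall>m\<in>carrier M. h (f \<odot>\<^bsub>M\<^esub> m) = f \<odot>\<^bsub>M'\<^esub> h m) \<and>
        (\<forall>m\<in>carrier M. h (Sig M m) = Sig M' (h m))}"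

definition qdm_iso ::
    "'c::field fls set \<Rightarrow> ('c fls, 'm) qdm \<Rightarrow> ('c fls, 'k) qdm \<Rightarrow> bool" where
  "qdm_iso F M M' \<longleftrightarrow> (\<exists>h\<in>qdm_hom F M M'. bij_betw h (carrier M) (carrier M'))"

definition qdiff_submodule :: "'c::field fls set \<Rightarrow> 'm set \<Rightarrow> ('c fls, 'm) qdm \<Rightarrow> bool" where
  "qdiff_submodule F H M \<longleftrightarrow> submodule H (fls_subring F) M \<and> Sig M ` H = H"

text \<open>The zero module is not irreducible.\<close>

definition qdm_irreducible :: "'c::field fls set \<Rightarrow> ('c fls, 'm) qdm \<Rightarrow> bool" where
  "qdm_irreducible F M \<longleftrightarrow>
     carrier M \<noteq> {\<zero>\<^bsub>M\<^esub>} \<and>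
     (\<forall>H. qdiff_submodule F H M \<longrightarrow> H = {\<zero>\<^bsub>M\<^esub>} \<or> H = carrier M)"

text \<open>Basis \<open>e = 1\<close> and \<open>Sig e = l x^(-\<mu>) e\<close>.\<close>

definition rank_one :: "'c::field fls set \<Rightarrow> 'c \<Rightarrow> int \<Rightarrow> 'c \<Rightarrow> ('c fls, 'c fls) qdm" where
  "rank_one F q \<mu> l =
     \<lparr>carrier = F, monoid.mult = undefined, one = undefined, ring.zero = 0, add = (+), smult = (*),
      Sig = (\<lambda>f. sigma q f * (fls_const l * fls_X_intpow (- \<mu>)))\<rparr>"

definition restrict_scalars :: "nat \<Rightarrow> ('c::field fls, 'm) qdm \<Rightarrow> ('c fls, 'm) qdm" where
  "restrict_scalars n M = M\<lparr>smult := (\<lambda>f m. fls_compose_power f n \<odot>\<^bsub>M\<^esub> m)\<rparr>"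

text \<open>\<open>M_module F q \<mu> l\<close>, \<open>M_root_module F n r \<mu> l\<close> and \<open>N_module F n r \<mu> l\<close> are the modules
  \<open>M_(\<mu>,l)\<close>, \<open>M_(\<mu>,l,n)\<close> and \<open>N_(\<mu>/n,l)\<close>, where \<open>r = q^(1/n)\<close>; note \<open>x^(\<mu>/n) = t^\<mu>\<close>.\<close>

definition M_module :: "'c::field fls set \<Rightarrow> 'c \<Rightarrow> int \<Rightarrow> 'c \<Rightarrow> ('c fls, 'c fls) qdm" where
  "M_module F q \<mu> l = rank_one F q \<mu> l"

definition M_root_module ::
    "'c::field fls set \<Rightarrow> nat \<Rightarrow> 'c \<Rightarrow> int \<Rightarrow> 'c \<Rightarrow> ('c fls, 'c fls) qdm" where
  "M_root_module F n r \<mu> l = rank_one (root_ext n F) r \<mu> l"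

definition N_module ::
    "'c::field fls set \<Rightarrow> nat \<Rightarrow> 'c \<Rightarrow> int \<Rightarrow> 'c \<Rightarrow> ('c fls, 'c fls) qdm" where
  "N_module F n r \<mu> l = restrict_scalars n (M_root_module F n r \<mu> l)"


section \<open>Operators, Newton polygons, admissibility\<close>

text \<open>An operator \<open>\<Sum> a_i \<sigma>^i\<close> is recorded as the polynomial of its coefficients; the skew product is
  not that of the type \<open>poly\<close>.  Laurent series coefficients are allowed, since these occur
  when \<open>\<sigma>\<close> is replaced by \<open>x^(-\<mu>) \<sigma>\<close>.\<close>

definition analytic_operator :: "('c::field \<Rightarrow> real) \<Rightarrow> 'c fls poly \<Rightarrow> bool" where
  "analytic_operator N L \<longleftrightarrow>
     L \<noteq> 0 \<and> (\<forall>i. \<exists>a. convergent_fps N a \<and> coeff L i = fps_to_fls a)"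

definition x_order :: "'c::field fls poly \<Rightarrow> int" where
  "x_order L = Min {fls_subdegree (coeff L i) | i. coeff L i \<noteq> 0}"

definition clear_x :: "'c::field fls poly \<Rightarrow> 'c fls poly" where
  "clear_x L = Polynomial.smult (fls_X_intpow (- x_order L)) L"

definition newton_polygon :: "'c::field fls poly \<Rightarrow> (real \<times> real) set" where
  "newton_polygon L =
     convex hull {(real i, k) | i k. coeff (clear_x L) i \<noteq> 0 \<and>
                                    real_of_int (fls_subdegree (coeff (clear_x L) i)) \<le> k}"

definition slopes :: "'c::field fls poly \<Rightarrow> real set" where
  "slopes L = {(y' - y) / (x' - x) | x y x' y' E.
                 E edge_of newton_polygon L \<and> (x, y) \<in> E \<and> (x', y') \<in> E \<and> x \<noteq> x'}"

text \<open>\<open>\<Sum> a_i (x^(-\<mu>) \<sigma>)^i\<close>, using \<open>(g \<sigma>)^i = g \<sigma>(g) ... \<sigma>^(i-1)(g) \<sigma>^i\<close>.\<close>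

definition twist :: "'c::field \<Rightarrow> int \<Rightarrow> 'c fls poly \<Rightarrow> 'c fls poly" where
  "twist q \<mu> L =
     (\<Sum>i\<le>degree L. monom (coeff L i * (\<Prod>j<i. sigma (q ^ j) (fls_X_intpow (- \<mu>)))) i)"

definition char_polynomial :: "'c::field \<Rightarrow> int \<Rightarrow> 'c fls poly \<Rightarrow> 'c poly" where
  "char_polynomial q \<mu> L = map_poly (\<lambda>a. fls_nth a 0) (clear_x (twist q \<mu> L))"

text \<open>Multiplicities are dropped: admissibility only uses the set of quotients of exponents.\<close>

definition exponents :: "'c::field \<Rightarrow> int \<Rightarrow> 'c fls poly \<Rightarrow> 'c set" where
  "exponents q \<mu> L = {l. l \<noteq> 0 \<and> poly (char_polynomial q \<mu> L) l = 0}"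

definition exponent_quotients :: "'c::field \<Rightarrow> int \<Rightarrow> 'c fls poly \<Rightarrow> 'c set" where
  "exponent_quotients q \<mu> L =
     {l / l' | l l'. l \<in> exponents q \<mu> L \<and> l' \<in> exponents q \<mu> L} - {q powi k | k. k \<le> 0}"

text \<open>This is to be used when the integer \<open>\<mu>\<close> is a slope of \<open>L\<close>.\<close>

definition admissible_slope ::
    "('c::field \<Rightarrow> real) \<Rightarrow> 'c \<Rightarrow> int \<Rightarrow> 'c fls poly \<Rightarrow> bool" where
  "admissible_slope N q \<mu> L \<longleftrightarrow> convergent_fps N (q_phi q (exponent_quotients q \<mu> L))"

definition admissible_operator :: "('c::field \<Rightarrow> real) \<Rightarrow> 'c \<Rightarrow> 'c fls poly \<Rightarrow> bool" where
  "admissible_operator N q L \<longleftrightarrow>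
     (\<forall>s\<in>slopes L. \<exists>\<mu>::int. s = of_int \<mu> \<and> admissible_slope N q \<mu> L)"

text \<open>The operator obtained by substituting \<open>t^n\<close> for \<open>x\<close>, to be read with \<open>qr n = q^(1/n)\<close>
  in place of \<open>q\<close>.\<close>

definition ramify :: "nat \<Rightarrow> 'c::field fls poly \<Rightarrow> 'c fls poly" where
  "ramify n L = map_poly (\<lambda>a. fls_compose_power a n) L"

definition almost_admissible_operator ::
    "('c::field \<Rightarrow> real) \<Rightarrow> (nat \<Rightarrow> 'c) \<Rightarrow> 'c fls poly \<Rightarrow> bool" where
  "almost_admissible_operator N qr L \<longleftrightarrow>
     (\<forall>s\<in>slopes L. \<exists>n\<ge>1. \<exists>\<mu>::int. real n * s = of_int \<mu> \<and>
        admissible_slope N (qr n) \<mu> (ramify n L))"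


section \<open>The module of an operator\<close>

text \<open>The ring \<open>F[\<sigma>, \<sigma>^(-1)]\<close>: a finitely supported function \<open>P\<close> stands for \<open>\<Sum> P(i) \<sigma>^i\<close>.\<close>

definition skew_laurent :: "'c::field fls set \<Rightarrow> 'c \<Rightarrow> (int \<Rightarrow> 'c fls) ring" where
  "skew_laurent F q =
     \<lparr>carrier = {P. finite {i. P i \<noteq> 0} \<and> range P \<subseteq> F},
      monoid.mult = (\<lambda>P Q k. \<Sum>i | P i \<noteq> 0. P i * sigma (q powi i) (Q (k - i))),
      one = (\<lambda>k. if k = 0 then 1 else 0),
      ring.zero = (\<lambda>k. 0),
      add = (\<lambda>P Q k. P k + Q k)\<rparr>"

definition skew_monom :: "'c::field fls \<Rightarrow> int \<Rightarrow> int \<Rightarrow> 'c fls" where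
  "skew_monom f i = (\<lambda>k. if k = i then f else 0)"

definition skew_of_poly :: "'c::field fls poly \<Rightarrow> int \<Rightarrow> 'c fls" where
  "skew_of_poly L = (\<lambda>k. if 0 \<le> k then coeff L (nat k) else 0)"

definition left_ideal_gen ::
    "'c::field fls set \<Rightarrow> 'c \<Rightarrow> 'c fls poly \<Rightarrow> (int \<Rightarrow> 'c fls) set" where
  "left_ideal_gen F q L =
     {P \<otimes>\<^bsub>skew_laurent F q\<^esub> skew_of_poly L | P. P \<in> carrier (skew_laurent F q)}"

text \<open>The quotient by the left ideal \<open>I\<close> generated by \<open>L\<close>.  The products of a coset with \<open>f\<close>
  and with \<open>\<sigma>\<close> are saturated by adding \<open>I\<close>, because \<open>f A\<close> alone is no coset for \<open>f = 0\<close>.\<close>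

definition operator_module ::
    "'c::field fls set \<Rightarrow> 'c \<Rightarrow> 'c fls poly \<Rightarrow> ('c fls, (int \<Rightarrow> 'c fls) set) qdm" where
  "operator_module F q L =
     (let D = skew_laurent F q; I = left_ideal_gen F q L in
      \<lparr>carrier = a_rcosets\<^bsub>D\<^esub> I, monoid.mult = undefined, one = undefined,
       ring.zero = I, add = set_add D,
       smult = (\<lambda>f A. I <+>\<^bsub>D\<^esub> (\<lambda>P. skew_monom f 0 \<otimes>\<^bsub>D\<^esub> P) ` A),
       Sig = (\<lambda>A. I <+>\<^bsub>D\<^esub> (\<lambda>P. skew_monom 1 1 \<otimes>\<^bsub>D\<^esub> P) ` A)\<rparr>)"

definition admissible_module ::
    "('c::field \<Rightarrow> real) \<Rightarrow> 'c \<Rightarrow> ('c fls, 'm) qdm \<Rightarrow> bool" where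
  "admissible_module N q M \<longleftrightarrow>
     qdiff_module (K_field N) q M \<and>
     (\<exists>L. analytic_operator N L \<and> admissible_operator N q L \<and>
          qdm_iso (K_field N) M (operator_module (K_field N) q L))"

definition almost_admissible_module ::
    "('c::field \<Rightarrow> real) \<Rightarrow> 'c \<Rightarrow> (nat \<Rightarrow> 'c) \<Rightarrow> ('c fls, 'm) qdm \<Rightarrow> bool" where
  "almost_admissible_module N q qr M \<longleftrightarrow>
     qdiff_module (K_field N) q M \<and>
     (\<exists>L. analytic_operator N L \<and> almost_admissible_operator N qr L \<and>
          qdm_iso (K_field N) M (operator_module (K_field N) q L))"


section \<open>Systems of representatives\<close>

text \<open>\<open>S\<close> is a system of representatives of the isomorphism classes of irreducible objects of the
  full subcategory of modules over \<open>F\<close> cut out by a property.  The property is passed twice,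
  as \<open>C\<close> for modules on an arbitrary carrier type and as \<open>C'\<close> on the type of the representatives.\<close>

definition irreducible_representatives ::
    "'c::field fls set \<Rightarrow> (('c fls, 'm) qdm \<Rightarrow> bool) \<Rightarrow> (('c fls, 'k) qdm \<Rightarrow> bool) \<Rightarrow>
     ('c fls, 'k) qdm set \<Rightarrow> bool" where
  "irreducible_representatives F C C' S \<longleftrightarrow>
     (\<forall>R\<in>S. C' R \<and> qdm_irreducible F R) \<and>
     (\<forall>R\<in>S. \<forall>R'\<in>S. qdm_iso F R R' \<longrightarrow> R = R') \<and>
     (\<forall>M. C M \<and> qdm_irreducible F M \<longrightarrow> (\<exists>R\<in>S. qdm_iso F M R))"

text \<open>\<open>root_group n r\<close> is the subgroup of \<open>C^*\<close> generated by \<open>r = q^(1/n)\<close> and the \<open>n\<close>-th roots of unity,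
  that is, by all \<open>n\<close>-th roots of \<open>q\<close>; for \<open>n = 1\<close> it is \<open>q^Z\<close>.  The roots of unity
  cannot be left out: if \<open>z^n = 1\<close>, the automorphism \<open>f(t) \<mapsto> f(z t)\<close> of \<open>F(t)\<close>, \<open>t = x^(1/n)\<close>, is
  linear over \<open>F\<close> and commutes with \<open>sigma r\<close>, so it is an isomorphism from \<open>N_(\<mu>/n,l)\<close> onto
  \<open>N_(\<mu>/n, l z^(-\<mu>))\<close>, and \<open>z^(-\<mu>)\<close> runs through all \<open>n\<close>-th roots of unity as \<open>z\<close> does; but no root of
  unity other than 1 lies in \<open>r^Z\<close>.\<close>

definition root_group :: "nat \<Rightarrow> 'c::field \<Rightarrow> 'c set" where
  "root_group n r = {z * r powi k | z k. z ^ n = 1}"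

definition transversal :: "'c::field set \<Rightarrow> 'c set \<Rightarrow> bool" where
  "transversal G T \<longleftrightarrow> 0 \<notin> T \<and> (\<forall>l. l \<noteq> 0 \<longrightarrow> (\<exists>!t. t \<in> T \<and> l / t \<in> G))"

definition M_modules ::
    "'c::field fls set \<Rightarrow> 'c \<Rightarrow> 'c set \<Rightarrow> ('c fls, 'c fls) qdm set" where
  "M_modules F q T = {M_module F q \<mu> l | \<mu> l. l \<in> T}"

definition N_modules ::
    "'c::field fls set \<Rightarrow> (nat \<Rightarrow> 'c) \<Rightarrow> (nat \<Rightarrow> 'c set) \<Rightarrow> ('c fls, 'c fls) qdm set" where
  "N_modules F qr T =
     {N_module F n (qr n) \<mu> l | n \<mu> l. n > 0 \<and> coprime (int n) \<mu> \<and> l \<in> T n}"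

end

theory Submission
  imports Defs "HOL-Number_Theory.Cong"
begin

text \<open>
  A convergent Laurent series is one whose coefficients \<open>a_k\<close>, \<open>k \<ge> 0\<close>, grow at most geometrically, so
  that \<open>K(x^(1/n))\<close> is again the field of convergent series, in the variable \<open>t = x^(1/n)\<close>; and for the
  trivial absolute value every series converges, which makes the formal statement an instance of the
  convergent one.

  If \<open>(n,\<mu>) = 1\<close>, then \<open>\<Sigma>^n\<close> acts on \<open>N_(\<mu>/n,l)\<close> as \<open>f(t) \<mapsto> \<Lambda> x^(-\<mu>) f(q t)\<close>.  It separates the powers of \<open>t\<close>
  modulo \<open>n\<close>, while \<open>\<Sigma>\<close> permutes them transitively: the module is irreducible.  The order
  and the leading coefficient of an eigenvector of \<open>\<Sigma>^n\<close> determine \<open>\<mu>/n\<close> and \<open>l^n\<close> modulo \<open>q^Z\<close>.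

  Conversely let \<open>L\<close> be an operator with at least two terms and take a slope \<open>\<mu>/n\<close> of \<open>L\<close>.  The
  recursion for a solution \<open>y(t)\<close>, \<open>y(0) = 1\<close>, twisted by \<open>\<Sigma> e = l t^(-\<mu>) e\<close>, has the small divisors
  \<open>P(l r^k)\<close>, where \<open>P\<close> is the characteristic polynomial and \<open>r = q^(1/n)\<close>; since \<open>|q| = 1\<close> there is no
  further obstruction to convergence, and admissibility bounds the divisors when no \<open>l r^k\<close> with
  \<open>k > 0\<close> is an exponent.  So \<open>y e\<close> defines a nonzero morphism from the module of \<open>L\<close> to
  \<open>Res_n M_(\<mu>,l,n)\<close>, from which one projects to the module of the reduced fraction; by Schur's lemma
  an irreducible module is isomorphic to it.  An irreducible formal module is cyclic, so it comes
  from an operator as well.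
\<close>

unbundle fps_syntax

section \<open>Geometric bounds\<close>

text \<open>The chosen roots of \<open>q\<close> need not be compatible:
  \<open>qr (d * n) ^ d\<close> and \<open>qr n\<close> may differ by a root of unity \<zeta>.
  Passing to a reduced fraction therefore needs, besides the projection, a twist of the coefficients
  by a function \<open>c\<close> with \<open>c (j - \<mu>)\<close> equal to
  \<open>\<zeta> powi j * c j\<close> up to a constant. It is the exponential of a quadratic
  function of \<open>j\<close>, and its values have norm one, so that convergence survives.

  Of an operator only one slope is used, that of the first edge of its polygon: it yields a nonzero
  morphism, and irreducibility does the rest. Admissibility bounds the inverse of a product over all
  quotients of exponents; since \<open>N q = 1\<close>, each factor grows at most geometrically, and
  so every single factor can be isolated.

  That the listed modules are themselves (almost) admissible is seen on the operator
  \<open>x^a \<sigma>^n - \<Lambda> x^b\<close> with \<open>a - b = \<mu>\<close>. Its exponents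
  differ by \<open>n\<close>-th roots of unity, a case that the standing assumption on
  \<open>(q;q)_k\<close> settles.\<close>

definition geom :: "(nat \<Rightarrow> real) \<Rightarrow> bool" where
  "geom a \<longleftrightarrow> (\<exists>B\<ge>1. \<forall>n. a n \<le> B ^ (n + 1))"

lemma geomI: "B \<ge> 1 \<Longrightarrow> (\<And>n. a n \<le> B ^ (n + 1)) \<Longrightarrow> geom a"
  unfolding geom_def by blast

lemma geomE:
  assumes "geom a"
  obtains B where "B \<ge> 1" "\<And>n. a n \<le> B ^ (n + 1)"
  using assms unfolding geom_def by blast

lemma geom_mono: "geom b \<Longrightarrow> (\<And>n. a n \<le> b n) \<Longrightarrow> geom a"
  unfolding geom_def by (meson order_trans)

text \<open>In \<open>geom\<close> the exponent is \<open>n + 1\<close>, so that one constant bounds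
  both the rate and the value at 0; an exponent \<open>k * (n + 1)\<close> then only replaces
  \<open>B\<close> by \<open>B ^ k\<close>.\<close>

lemma geom_stretch:
  assumes "B \<ge> 1" "\<And>n. a n \<le> B ^ (k * (n + 1))"
  shows "geom a"
  using assms by (intro geomI[of "B ^ k"]) (auto simp flip: power_mult power_add)

lemma geom_const: "geom (\<lambda>n. c)"
proof (rule geomI[of "max 1 c"])
  fix n show "c \<le> max 1 c ^ (n + 1)"
    using self_le_power[of "max 1 c" "n + 1"] by linarith
qed simp

lemma geom_power: "c \<ge> 0 \<Longrightarrow> geom (\<lambda>n. c ^ n)"
proof (rule geomI[of "max 1 c"])
  fix n assume "c \<ge> 0"
  then have "c ^ n \<le> max 1 c ^ n" by (intro power_mono) auto
  also have "\<dots> \<le> max 1 c ^ (n + 1)" by (intro power_increasing) auto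
  finally show "c ^ n \<le> max 1 c ^ (n + 1)" .
qed simp

lemma geom_add:
  assumes "geom a" "geom b"
  shows "geom (\<lambda>n. a n + b n)"
proof -
  obtain A where A: "A \<ge> 1" "\<And>n. a n \<le> A ^ (n + 1)" using assms(1) by (rule geomE) blast
  obtain B where B: "B \<ge> 1" "\<And>n. b n \<le> B ^ (n + 1)" using assms(2) by (rule geomE) blast
  show ?thesis
  proof (rule geomI[of "A + B"])
    fix n
    have "A ^ (n+1) + B ^ (n+1) \<le> (A + B) ^ n * A + (A + B) ^ n * B"
      using A(1) B(1) by (auto intro!: add_mono mult_right_mono power_mono simp: mult.commute)
    also have "\<dots> = (A + B) ^ (n+1)" by (simp add: algebra_simps)
    finally show "a n + b n \<le> (A + B) ^ (n+1)" using A(2)[of n] B(2)[of n] by linarith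
  qed (use A B in auto)
qed

lemma geom_mult:
  assumes "geom a" "geom b" "\<And>n. a n \<ge> 0" "\<And>n. b n \<ge> 0"
  shows "geom (\<lambda>n. a n * b n)"
proof -
  obtain A where A: "A \<ge> 1" "\<And>n. a n \<le> A ^ (n + 1)" using assms(1) by (rule geomE) blast
  obtain B where B: "B \<ge> 1" "\<And>n. b n \<le> B ^ (n + 1)" using assms(2) by (rule geomE) blast
  show ?thesis
  proof (rule geomI[of "A * B"])
    show "A * B \<ge> 1" using A B mult_mono[of 1 A 1 B] by auto
    show "a n * b n \<le> (A * B) ^ (n + 1)" for n
      using A B assms(3,4) unfolding power_mult_distrib by (intro mult_mono) auto
  qed
qed

lemma geom_sum:
  assumes "finite I" "\<And>i. i \<in> I \<Longrightarrow> geom (a i)"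
  shows "geom (\<lambda>n. \<Sum>i\<in>I. a i n)"
  using assms by (induction rule: finite_induct) (auto intro: geom_add geom_const)

lemma geom_prod:
  assumes "finite I" "\<And>i. i \<in> I \<Longrightarrow> geom (a i)" "\<And>i n. i \<in> I \<Longrightarrow> a i n \<ge> 0"
  shows "geom (\<lambda>n. \<Prod>i\<in>I. a i n)"
  using assms by (induction rule: finite_induct) (auto intro!: geom_mult geom_const prod_nonneg)

lemma geom_convolution:
  assumes "geom a" "geom b" "\<And>n. a n \<ge> 0" "\<And>n. b n \<ge> 0"
  shows "geom (\<lambda>n. \<Sum>i=0..n. a i * b (n - i))"
proof -
  obtain A where A: "A \<ge> 1" "\<And>n. a n \<le> A ^ (n + 1)" using assms(1) by (rule geomE) blast
  obtain B where B: "B \<ge> 1" "\<And>n. b n \<le> B ^ (n + 1)" using assms(2) by (rule geomE) blast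
  have AB: "A * B \<ge> 1" using A B mult_mono[of 1 A 1 B] by auto
  have "(\<Sum>i=0..n. a i * b (n - i)) \<le> 2 ^ (n+1) * ((A * B) ^ (n + 1))" for n
  proof -
    have "(\<Sum>i=0..n. a i * b (n - i)) \<le> (\<Sum>i=0..n. (A * B) ^ (n + 1))"
    proof (rule sum_mono)
      fix i assume i: "i \<in> {0..n}"
      have "a i * b (n - i) \<le> A ^ (i + 1) * B ^ (n - i + 1)"
        using A B assms(3,4) by (intro mult_mono) auto
      also have "\<dots> \<le> A ^ (n + 1) * B ^ (n + 1)"
        using A B i by (intro mult_mono power_increasing) auto
      finally show "a i * b (n - i) \<le> (A * B) ^ (n + 1)" by (simp only: power_mult_distrib)
    qed
    also have "\<dots> = real (n + 1) * (A * B) ^ (n + 1)" by simp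
    \<comment> \<open>The number \<open>n + 1\<close> of terms is absorbed by
      \<open>2 ^ (n+1)\<close>.\<close>
    also have "\<dots> \<le> 2 ^ (n+1) * ((A * B) ^ (n + 1))"
      using AB of_nat_mono[OF less_imp_le[OF less_exp[of "n+1"]], where 'a = real]
      by (intro mult_right_mono) auto
    finally show ?thesis .
  qed
  moreover have "geom (\<lambda>n. 2 ^ (n+1) * ((A * B) ^ (n + 1)))"
    using AB by (intro geomI[of "2 * (A * B)"]) (auto simp: power_mult_distrib)
  ultimately show ?thesis by (rule geom_mono[rotated])
qed

text \<open>The majorant behind both inverses of series and solutions of operators.\<close>

lemma geom_recursion:
  fixes w :: "nat \<Rightarrow> real"
  assumes w: "\<And>n. n > 0 \<Longrightarrow> w n \<le> (\<Sum>j<n. C * G ^ (n - j) * w j)"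
    and C: "C \<ge> 0" and G: "G > 0" and w0: "w 0 \<ge> 0"
  shows "geom w"
proof -
  \<comment> \<open>The base \<open>(1 + C) * G\<close> closes the induction: the sum of
    \<open>C * (1 + C) ^ j\<close> over \<open>j < n\<close> is
    \<open>(1 + C) ^ n - 1\<close>.\<close>
  have bd: "w n \<le> w 0 * ((1 + C) * G) ^ n" for n
  proof (induction n rule: less_induct)
    case (less n)
    show ?case
    proof (cases "n = 0")
      case False
      have "w n \<le> (\<Sum>j<n. C * G ^ (n - j) * w j)" using w False by simp
      also have "\<dots> \<le> (\<Sum>j<n. C * G ^ (n - j) * (w 0 * ((1 + C) * G) ^ j))"
        using less C G by (intro sum_mono mult_left_mono) auto
      also have "\<dots> = (\<Sum>j<n. w 0 * G ^ n * (C * (1 + C) ^ j))"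
      proof (rule sum.cong)
        fix j assume "j \<in> {..<n}"
        then have "G ^ n = G ^ (n - j) * G ^ j" by (simp flip: power_add)
        then show "C * G ^ (n - j) * (w 0 * ((1 + C) * G) ^ j) = w 0 * G ^ n * (C * (1 + C) ^ j)"
          by (simp add: power_mult_distrib)
      qed simp
      also have "\<dots> = w 0 * G ^ n * (C * (\<Sum>j<n. (1 + C) ^ j))"
        by (simp add: sum_distrib_left)
      also have "C * (\<Sum>j<n. (1 + C) ^ j) = (1 + C) ^ n - 1"
        using power_diff_1_eq[of "1 + C" n] by simp
      also have "w 0 * G ^ n * ((1 + C) ^ n - 1) \<le> w 0 * G ^ n * (1 + C) ^ n"
        using w0 G by (intro mult_left_mono) auto
      finally show ?thesis by (simp add: power_mult_distrib mult_ac)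
    qed simp
  qed
  have "geom (\<lambda>n. w 0 * ((1 + C) * G) ^ n)"
    using C G w0 by (intro geom_mult geom_const geom_power) auto
  then show ?thesis using bd by (rule geom_mono)
qed

section \<open>Absolute values and convergent series\<close>

locale absval =
  fixes N :: "'c::field \<Rightarrow> real"
  assumes absolute_value: "absolute_value N"
begin

abbreviation "K \<equiv> K_field N"

lemma N_nonneg [simp]: "N x \<ge> 0"
  and N_eq_0 [simp]: "N x = 0 \<longleftrightarrow> x = 0"
  and N_mult: "N (x * y) = N x * N y"
  and N_triangle: "N (x + y) \<le> N x + N y"
  using absolute_value unfolding absolute_value_def by auto

lemma N_pos [simp]: "N x > 0 \<longleftrightarrow> x \<noteq> 0"
  using N_nonneg[of x] N_eq_0[of x] by linarith

lemma N_0 [simp]: "N 0 = 0" by simp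

lemma N_1 [simp]: "N 1 = 1"
  using N_mult[of 1 1] N_eq_0[of 1] by simp

lemma N_minus [simp]: "N (- x) = N x"
proof -
  have "N (- 1) * N (- 1) = 1" using N_mult[of "-1" "-1"] by simp
  then have "N (- 1) = 1"
    using N_nonneg[of "- 1"] by (metis power2_eq_square power2_eq_1_iff abs_of_nonneg abs_minus_cancel abs_1 abs_of_nonneg)
  then show ?thesis using N_mult[of "-1" x] by simp
qed

lemma N_diff: "N (x - y) \<le> N x + N y"
  using N_triangle[of x "- y"] by simp

lemma N_power: "N (x ^ n) = N x ^ n"
  by (induction n) (auto simp: N_mult)

lemma N_inverse: "N (inverse x) = inverse (N x)"
proof (cases "x = 0")
  case False
  then have "N x * N (inverse x) = 1" using N_mult[of x "inverse x"] by simp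
  then show ?thesis using inverse_unique by metis
qed simp

lemma N_divide: "N (x / y) = N x / N y"
  by (simp add: divide_inverse N_mult N_inverse)

lemma N_power_int: "N (x powi k) = N x powi k"
  by (auto simp: power_int_def N_power N_inverse)

lemma N_prod: "N (prod f A) = (\<Prod>x\<in>A. N (f x))"
  by (induction A rule: infinite_finite_induct) (auto simp: N_mult)

lemma N_sum: "N (sum f A) \<le> (\<Sum>x\<in>A. N (f x))"
  by (induction A rule: infinite_finite_induct) (auto intro: order_trans[OF N_triangle])

lemma N_root_of_unit:
  assumes "x ^ n = y" "N y = 1" "n > 0"
  shows "N x = 1"
  using assms N_power[of x n] N_nonneg[of x] by (metis power_eq_1_iff abs_of_nonneg gr_implies_not0 real_norm_def)

text \<open>Replaces the limsup by an explicit bound, which products, recursions and changes of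
  index preserve.\<close>

lemma convergent_fps_iff: "convergent_fps N a \<longleftrightarrow> geom (\<lambda>n. N (fps_nth a n))"
proof
  define l where "l = limsup (\<lambda>n. ereal (root n (N (fps_nth a n))))"
  assume "convergent_fps N a"
  then have "inverse l > 0" by (simp add: convergent_fps_def radius_def l_def)
  then have "l < \<infinity>" by (cases l) auto
  then obtain c where c: "l < ereal c" using ereal_dense2 by blast
  have "eventually (\<lambda>n. ereal (root n (N (fps_nth a n))) < ereal c) sequentially"
    using c unfolding l_def by (rule Limsup_lessD)
  then obtain n0 where n0: "\<And>n. n \<ge> n0 \<Longrightarrow> root n (N (fps_nth a n)) < c"
    by (auto simp: eventually_sequentially)
  \<comment> \<open>The coefficients up to \<open>n0\<close> go into a constant. The first case has
    \<open>n > n0\<close>, hence \<open>n > 0\<close>: \<open>root 0\<close> is 0 by convention and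
    says nothing about the coefficient.\<close>
  have "N (fps_nth a n) \<le> c ^ n + (\<Sum>k\<le>n0. N (fps_nth a k))" if "c \<ge> 0" for n
  proof (cases "n > n0")
    case True
    then have "N (fps_nth a n) = root n (N (fps_nth a n)) ^ n" by (simp add: real_root_pow_pos2)
    also have "\<dots> \<le> c ^ n" using n0[of n] True by (intro power_mono) (auto intro: less_imp_le)
    finally show ?thesis using sum_nonneg[of "{..n0}" "\<lambda>k. N (fps_nth a k)"] by simp
  next
    case False
    then have "N (fps_nth a n) \<le> (\<Sum>k\<le>n0. N (fps_nth a k))"
      by (intro member_le_sum) auto
    then show ?thesis using that zero_le_power[of c n] by linarith
  qed
  moreover have "c \<ge> 0"
    using n0[of n0] real_root_ge_zero[OF N_nonneg, of n0 "fps_nth a n0"] by linarith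
  ultimately show "geom (\<lambda>n. N (fps_nth a n))"
    by (intro geom_mono[OF geom_add[OF geom_power[of c] geom_const]]) auto
next
  assume "geom (\<lambda>n. N (fps_nth a n))"
  then obtain B where B: "B \<ge> 1" "\<And>n. N (fps_nth a n) \<le> B ^ (n + 1)" by (rule geomE) blast
  have "root n (N (fps_nth a n)) \<le> B\<^sup>2" if "n > 0" for n
  proof -
    have "B ^ (n + 1) \<le> (B\<^sup>2) ^ n"
      using B(1) that unfolding power_mult[symmetric] by (intro power_increasing) auto
    then have "root n (N (fps_nth a n)) \<le> root n ((B\<^sup>2) ^ n)"
      using B(2)[of n] that by (simp add: real_root_le_iff order_trans)
    also have "\<dots> = B\<^sup>2" using that B(1) by (simp add: real_root_power_cancel)
    finally show ?thesis .
  qed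
  then have "eventually (\<lambda>n. ereal (root n (N (fps_nth a n))) \<le> ereal (B\<^sup>2)) sequentially"
    unfolding eventually_sequentially by (intro exI[of _ 1]) auto
  then have "limsup (\<lambda>n. ereal (root n (N (fps_nth a n)))) \<le> ereal (B\<^sup>2)"
    by (rule Limsup_bounded)
  then have "limsup (\<lambda>n. ereal (root n (N (fps_nth a n)))) \<noteq> \<infinity>"
    by auto
  \<comment> \<open>A negative limsup would not have a positive inverse; a limsup equal to 0 gives
    the radius \<infinity>.\<close>
  moreover have "limsup (\<lambda>n. ereal (root n (N (fps_nth a n)))) \<ge> 0"
    by (intro le_Limsup) (auto simp: real_root_ge_zero)
  ultimately show "convergent_fps N a"
    unfolding convergent_fps_def radius_def
    by (cases "limsup (\<lambda>n. ereal (root n (N (fps_nth a n))))") auto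
qed

lemma convergent_fps_mult:
  assumes "convergent_fps N a" "convergent_fps N b"
  shows "convergent_fps N (a * b)"
proof -
  have "geom (\<lambda>n. \<Sum>i=0..n. N (fps_nth a i) * N (fps_nth b (n - i)))"
    using assms by (intro geom_convolution) (auto simp: convergent_fps_iff)
  then show ?thesis unfolding convergent_fps_iff fps_mult_nth
    by (rule geom_mono) (auto intro!: order_trans[OF N_sum] simp: N_mult)
qed

lemma convergent_fps_inverse:
  assumes a: "convergent_fps N a" and a0: "fps_nth a 0 \<noteq> 0"
  shows "convergent_fps N (inverse a)"
proof -
  obtain B where B: "B \<ge> 1" "\<And>n. N (fps_nth a n) \<le> B ^ (n + 1)"
    using a unfolding convergent_fps_iff by (rule geomE) blast
  define w where "w n = N (fps_nth (inverse a) n)" for n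
  \<comment> \<open>The equation for coefficient \<open>n\<close> divides by
    \<open>fps_nth a 0\<close>; the factor \<open>B\<close> comes from the surplus 1 in
    \<open>B ^ (n - i + 1)\<close>.\<close>
  define C where "C = inverse (N (fps_nth a 0)) * B"
  have "geom w"
  proof (rule geom_recursion)
    fix n :: nat assume n: "n > 0"
    have eq: "fps_nth (inverse a) n
      = - (\<Sum>i=0..n-1. fps_nth (inverse a) i * fps_nth a (n - i)) * inverse (fps_nth a 0)"
    proof -
      have "0 = fps_nth (inverse a * a) n" using n a0 by (simp add: inverse_mult_eq_1)
      also have "\<dots> = (\<Sum>i=0..n. fps_nth (inverse a) i * fps_nth a (n - i))"
        by (simp add: fps_mult_nth)
      also have "\<dots> = (\<Sum>i=0..n-1. fps_nth (inverse a) i * fps_nth a (n - i)) + fps_nth (inverse a) n * fps_nth a 0"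
        using n by (cases n) auto
      finally have "fps_nth (inverse a) n * fps_nth a 0 = - (\<Sum>i=0..n-1. fps_nth (inverse a) i * fps_nth a (n - i))"
        by (simp add: eq_neg_iff_add_eq_0 add.commute)
      then show ?thesis using a0 by (simp add: field_simps)
    qed
    have "w n \<le> (\<Sum>i=0..n-1. w i * N (fps_nth a (n - i))) * inverse (N (fps_nth a 0))"
      unfolding w_def eq N_mult N_inverse N_minus
      by (intro mult_right_mono order_trans[OF N_sum]) (auto simp: N_mult)
    also have "\<dots> \<le> (\<Sum>i=0..n-1. w i * B ^ (n - i + 1)) * inverse (N (fps_nth a 0))"
      using B unfolding w_def by (intro mult_right_mono sum_mono mult_left_mono) auto
    also have "\<dots> = (\<Sum>j=0..n-1. C * B ^ (n - j) * w j)"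
      by (simp add: sum_distrib_right sum_distrib_left C_def mult_ac)
    also have "{0..n-1} = {..<n}" using n by auto
    finally show "w n \<le> (\<Sum>j<n. C * B ^ (n - j) * w j)" .
  qed (use B in \<open>auto simp: C_def w_def\<close>)
  then show ?thesis unfolding convergent_fps_iff w_def .
qed

end

section \<open>Laurent series\<close>

lemma sigma_nth [simp]: "sigma q f $$ k = q powi k * f $$ k"
  by (simp add: sigma.rep_eq)

lemma sigma_0 [simp]: "sigma q 0 = 0"
  and sigma_const [simp]: "sigma q (fls_const c) = fls_const c"
  and sigma_one_1 [simp]: "sigma q 1 = 1"
  and sigma_by_1 [simp]: "sigma 1 f = f"
  and sigma_add [simp]: "sigma q (f + g) = sigma q f + sigma q g"
  and sigma_minus [simp]: "sigma q (- f) = - sigma q f"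
  and sigma_diff [simp]: "sigma q (f - g) = sigma q f - sigma q g"
  by (auto intro!: fls_eqI simp: algebra_simps)

lemma sigma_sigma [simp]: "sigma a (sigma b f) = sigma (a * b) f"
  by (auto intro!: fls_eqI simp: power_int_mult_distrib)

lemma sigma_eq_0_iff [simp]: "q \<noteq> 0 \<Longrightarrow> sigma q f = 0 \<longleftrightarrow> f = 0"
  by (auto simp: fls_eq_iff)

lemma fls_subdegree_sigma [simp]: "q \<noteq> 0 \<Longrightarrow> fls_subdegree (sigma q f) = fls_subdegree f"
  by (cases "f = 0") (auto intro!: fls_subdegree_eqI)

lemma sigma_mult [simp]:
  assumes q: "q \<noteq> 0"
  shows "sigma q (f * g) = sigma q f * sigma q g"
proof (rule fls_eqI)
  fix n
  have "sigma q (f * g) $$ n = (\<Sum>i=fls_subdegree f..n - fls_subdegree g. q powi n * (f $$ i * g $$ (n - i)))"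
    by (simp add: fls_times_nth(2) sum_distrib_left)
  also have "\<dots> = (\<Sum>i=fls_subdegree f..n - fls_subdegree g. sigma q f $$ i * sigma q g $$ (n - i))"
  proof (rule sum.cong)
    fix i
    have "q powi n = q powi i * q powi (n - i)"
      using q by (simp flip: power_int_add)
    then show "q powi n * (f $$ i * g $$ (n - i)) = sigma q f $$ i * sigma q g $$ (n - i)"
      by simp
  qed simp
  also have "\<dots> = (sigma q f * sigma q g) $$ n"
    using q by (simp only: fls_times_nth(2) fls_subdegree_sigma[OF q])
  finally show "sigma q (f * g) $$ n = (sigma q f * sigma q g) $$ n" .
qed

text \<open>The simplification normal form of scalars and powers of the variable.\<close>

definition monomial :: "'a::field \<Rightarrow> int \<Rightarrow> 'a fls" where
  "monomial c i = fls_const c * fls_X_intpow i"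

lemma monomial_mult_nth [simp]: "(monomial c i * f) $$ k = c * f $$ (k - i)"
proof -
  have "monomial c i * f = fls_const c * fls_shift (- i) f"
    by (simp only: monomial_def mult.assoc fls_X_intpow_times_conv_shift(1))
  then show ?thesis by simp
qed

lemma mult_monomial_nth [simp]: "(f * monomial c i) $$ k = c * f $$ (k - i)"
  using monomial_mult_nth[of c i f k] by (simp add: mult.commute)

lemma monomial_nth [simp]: "monomial c i $$ k = (if k = i then c else 0)"
  using monomial_mult_nth[of c i 1 k] by simp

lemma monomial_mult [simp]: "monomial c i * monomial d j = monomial (c * d) (i + j)"
  by (rule fls_eqI) auto

lemma monomial_mult_assoc [simp]: "monomial c i * (monomial d j * f) = monomial (c * d) (i + j) * f"
  by (simp flip: mult.assoc)

lemma monomial_0 [simp]: "monomial 0 i = 0"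
  and monomial_1 [simp]: "monomial 1 0 = 1"
  by (auto simp: monomial_def)

lemma monomial_eq_0 [simp]: "monomial c i = 0 \<longleftrightarrow> c = 0"
  by (auto simp: fls_eq_iff)

lemma X_intpow_eq_monomial: "fls_X_intpow i = monomial 1 i"
  by (simp add: monomial_def)

lemma fls_X_power_eq_monomial: "fls_X ^ i = monomial 1 (int i)"
  by (rule fls_eqI) simp

lemma fls_subdegree_monomial [simp]: "c \<noteq> 0 \<Longrightarrow> fls_subdegree (monomial c i) = i"
  by (intro fls_subdegree_eqI) auto

lemma sigma_monomial [simp]: "sigma q (monomial c i) = monomial (c * q powi i) i"
  by (rule fls_eqI) auto

section \<open>Substitution of \<open>t^n\<close> for the variable, and decomposition modulo
  \<open>n\<close>\<close>

lemma compose_power_monomial [simp]: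
  "n > 0 \<Longrightarrow> fls_compose_power (monomial c i) n = monomial c (int n * i)"
  by (rule fls_eqI) (auto simp: fls_nth_compose_power)

lemma compose_power_sum: "fls_compose_power (sum f A) n = (\<Sum>x\<in>A. fls_compose_power (f x) n)"
  by (induction A rule: infinite_finite_induct) auto

lemma compose_power_by_1 [simp]: "fls_compose_power f (Suc 0) = f"
  by (rule fls_eqI) (simp add: fls_nth_compose_power)

lemma compose_power_eq_0_iff [simp]: "n > 0 \<Longrightarrow> fls_compose_power f n = 0 \<longleftrightarrow> f = 0"
proof
  assume n: "n > 0" and "fls_compose_power f n = 0"
  then have "fls_compose_power f n $$ (int n * k) = 0" for k by simp
  then show "f = 0" using n by (intro fls_eqI) (simp add: fls_nth_compose_power)
qed auto

lemma fls_subdegree_compose_power: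
  assumes "n > 0"
  shows "fls_subdegree (fls_compose_power f n) = int n * fls_subdegree f"
proof (cases "f = 0")
  case False
  with assms show ?thesis
    by (intro fls_subdegree_eqI) (auto simp: fls_nth_compose_power mult.commute elim!: dvdE)
qed simp

lemma sigma_compose_power [simp]:
  assumes "n > 0" "r ^ n = q"
  shows "sigma r (fls_compose_power f n) = fls_compose_power (sigma q f) n"
  using assms by (intro fls_eqI) (auto simp: fls_nth_compose_power power_int_mult elim!: dvdE)

text \<open>\<open>section_fls n i f\<close> is the series in \<open>x = t^n\<close> multiplying \<open>t^i\<close> in the decomposition of \<open>f(t)\<close>
  along residues modulo \<open>n\<close>.\<close>

lift_definition section_fls :: "nat \<Rightarrow> int \<Rightarrow> 'a::zero fls \<Rightarrow> 'a fls" is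
  "\<lambda>n i f k. if n > 0 then f (int n * k + i) else 0"
proof -
  fix n :: nat and i :: int and f :: "int \<Rightarrow> 'a"
  assume "\<forall>\<^sub>\<infinity>n. f (- int n) = 0"
  then obtain m where m: "\<And>k. k > m \<Longrightarrow> f (- int k) = 0" by (auto simp: MOST_nat)
  have "\<forall>k. nat i + m < k \<longrightarrow> (if n > 0 then f (int n * (- int k) + i) else 0) = 0"
  proof (intro allI impI)
    fix k assume k: "nat i + m < k"
    have "f (int n * (- int k) + i) = 0" if n: "n > 0"
    proof -
      have "1 * int k \<le> int n * int k" using n by (intro mult_right_mono) auto
      then have "int k \<le> int n * int k" by simp
      then have "int n * (- int k) + i = - int (nat (int n * int k - i))" "nat (int n * int k - i) > m"
        using k by linarith+
      then show ?thesis using m by metis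
    qed
    then show "(if n > 0 then f (int n * (- int k) + i) else 0) = 0" by simp
  qed
  then show "\<forall>\<^sub>\<infinity>k. (if n > 0 then f (int n * (- int k) + i) else 0) = 0"
    unfolding MOST_nat by blast
qed

lemma section_fls_nth: "n > 0 \<Longrightarrow> section_fls n i f $$ k = f $$ (int n * k + i)"
  by (simp add: section_fls.rep_eq)

text \<open>Among the \<open>i < n\<close> only the residue of \<open>k\<close> modulo
  \<open>n\<close> contributes to the coefficient of \<open>t^k\<close>, so the decomposition is
  direct.\<close>

lemma compose_power_nth_sum:
  fixes f :: "nat \<Rightarrow> 'a::field fls"
  assumes "n > 0"
  shows "(\<Sum>i<n. fls_compose_power (f i) n * fls_X ^ i) $$ k = f (nat (k mod int n)) $$ (k div int n)"
proof -
  have "(\<Sum>i<n. fls_compose_power (f i) n * fls_X ^ i) $$ k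
      = (\<Sum>i<n. if i = nat (k mod int n) then f (nat (k mod int n)) $$ (k div int n) else 0)"
    unfolding fls_nth_sum
  proof (rule sum.cong)
    fix i assume i: "i \<in> {..<n}"
    have *: "int n dvd k - int i \<longleftrightarrow> i = nat (k mod int n)"
    proof
      assume "int n dvd k - int i"
      then have "k mod int n = int i mod int n" by (simp add: mod_eq_dvd_iff)
      then show "i = nat (k mod int n)" using i by simp
    qed (use assms in \<open>auto simp: dvd_minus_mod\<close>)
    moreover have "(k - k mod int n) div int n = k div int n"
      by (metis minus_mod_eq_mult_div nonzero_mult_div_cancel_left of_nat_0_less_iff assms less_irrefl)
    ultimately show "(fls_compose_power (f i) n * fls_X ^ i) $$ k
        = (if i = nat (k mod int n) then f (nat (k mod int n)) $$ (k div int n) else 0)"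
      using assms by (auto simp: fls_X_power_eq_monomial fls_nth_compose_power)
  qed simp
  also have "\<dots> = f (nat (k mod int n)) $$ (k div int n)"
  proof -
    have "nat (k mod int n) < n" using assms by (simp add: nat_less_iff)
    then show ?thesis by (simp add: sum.delta)
  qed
  finally show ?thesis .
qed

lemma fls_sections:
  fixes f :: "'a::field fls"
  assumes n: "n > 0"
  shows "(\<Sum>i<n. fls_compose_power (section_fls n (int i) f) n * fls_X ^ i) = f"
  using n by (intro fls_eqI) (simp only: compose_power_nth_sum section_fls_nth, simp)

section \<open>The field of convergent Laurent series\<close>

context absval
begin

text \<open>Negative indices need no bound, as a Laurent series has only finitely many nonzero
  coefficients there.\<close>

definition germ :: "'c fls \<Rightarrow> bool" where
  "germ f \<longleftrightarrow> geom (\<lambda>k. N (f $$ int k))"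

lemma germ_fps_to_fls: "germ (fps_to_fls a) \<longleftrightarrow> convergent_fps N a"
  by (simp add: germ_def convergent_fps_iff)

lemma germ_shift:
  assumes "germ f"
  shows "germ (fls_shift m f)"
proof -
  define A where "A = nat \<bar>m\<bar>"
  obtain B where B: "B \<ge> 1" "\<And>k. N (f $$ int k) \<le> B ^ (k + 1)"
    using assms unfolding germ_def by (rule geomE) blast
  \<comment> \<open>A shift can move coefficients of negative index into the range to be bounded;
    \<open>S\<close> collects these finitely many.\<close>
  define S where "S = (\<Sum>j\<in>{-int A..0}. N (f $$ j))"
  have "N (fls_shift m f $$ int k) \<le> B ^ ((A + 1) * (k + 1)) + S" for k
  proof (cases "int k + m \<ge> 0")
    case True
    have "nat (int k + m) + 1 \<le> A + k + 1"
      unfolding A_def by (cases "m \<ge> 0") auto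
    also have "\<dots> \<le> (A + 1) * (k + 1)" by simp
    finally have "nat (int k + m) + 1 \<le> (A + 1) * (k + 1)" .
    then have "B ^ (nat (int k + m) + 1) \<le> B ^ ((A + 1) * (k + 1))"
      using B(1) by (rule power_increasing)
    moreover have "S \<ge> 0" unfolding S_def by (simp add: sum_nonneg)
    ultimately show ?thesis using B(2)[of "nat (int k + m)"] True by simp
  next
    case False
    then have "int k + m \<in> {-int A..0}" by (auto simp: A_def)
    then have "N (f $$ (int k + m)) \<le> S" unfolding S_def by (intro member_le_sum) auto
    moreover have "B ^ ((A + 1) * (k + 1)) \<ge> 0" using B(1) by simp
    ultimately show ?thesis by simp
  qed
  moreover have "geom (\<lambda>k. B ^ ((A + 1) * (k + 1)) + S)"
    by (intro geom_add geom_const geom_stretch[OF B(1), where k = "A + 1"]) auto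
  ultimately show ?thesis unfolding germ_def by (rule geom_mono[rotated])
qed

text \<open>A power of the variable times an invertible power series: in this form products and
  inverses reduce to those of power series.\<close>

lemma germ_cases:
  assumes "germ f" "f \<noteq> 0"
  obtains m a where "convergent_fps N a" "f = fls_shift m (fps_to_fls a)" "fps_nth a 0 \<noteq> 0"
proof
  let ?d = "fls_subdegree f"
  show "f = fls_shift (- ?d) (fps_to_fls (fls_regpart (fls_shift ?d f)))"
    by (rule fls_eqI) auto
  show "convergent_fps N (fls_regpart (fls_shift ?d f))"
    using germ_shift[OF assms(1), of ?d] by (simp add: convergent_fps_iff germ_def)
  show "fps_nth (fls_regpart (fls_shift ?d f)) 0 \<noteq> 0" using assms by simp
qed

lemma germ_0 [simp]: "germ 0"
  by (simp add: germ_def geom_const)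

lemma germ_mult:
  assumes "germ f" "germ g"
  shows "germ (f * g)"
proof (cases "f = 0 \<or> g = 0")
  case False
  then obtain m a k b where a: "convergent_fps N a" "f = fls_shift m (fps_to_fls a)"
    and b: "convergent_fps N b" "g = fls_shift k (fps_to_fls b)"
    using germ_cases assms by metis
  have "f * g = fls_shift (m + k) (fps_to_fls (a * b))"
    by (simp add: a b fls_times_both_shifted_simp fls_times_fps_to_fls)
  then show ?thesis using a b by (simp add: germ_shift germ_fps_to_fls convergent_fps_mult)
qed auto

lemma germ_inverse:
  assumes "germ f"
  shows "germ (inverse f)"
proof (cases "f = 0")
  case False
  then obtain m a where a: "convergent_fps N a" "f = fls_shift m (fps_to_fls a)" "fps_nth a 0 \<noteq> 0"
    using germ_cases assms by metis
  have "f * fls_shift (- m) (fps_to_fls (inverse a)) = 1"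
    using a by (simp add: fls_times_both_shifted_simp inverse_mult_eq_1' flip: fls_times_fps_to_fls)
  then have "inverse f = fls_shift (- m) (fps_to_fls (inverse a))"
    by (rule inverse_unique)
  then show ?thesis using a by (simp add: germ_shift germ_fps_to_fls convergent_fps_inverse)
qed auto

lemma germ_add: "germ f \<Longrightarrow> germ g \<Longrightarrow> germ (f + g)"
  unfolding germ_def
  by (rule geom_mono[OF geom_add[of "\<lambda>k. N (f $$ int k)" "\<lambda>k. N (g $$ int k)"]])
    (auto intro: N_triangle)

lemma germ_monomial [simp]: "germ (monomial c i)"
  unfolding germ_def by (rule geom_mono[OF geom_const[of "N c"]]) auto

lemma germ_sigma:
  assumes "germ f"
  shows "germ (sigma q f)"
proof -
  have "geom (\<lambda>k. N q ^ k * N (f $$ int k))"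
    using assms unfolding germ_def by (intro geom_mult geom_power) auto
  then show ?thesis by (simp add: germ_def N_mult N_power)
qed

text \<open>To write a convergent Laurent series as a quotient it suffices to clear its pole, so the
  denominator can be a power of the variable.\<close>

lemma K_field_iff: "f \<in> K \<longleftrightarrow> germ f"
proof
  assume "f \<in> K"
  then show "germ f" unfolding K_field_def
    by (auto simp: divide_inverse germ_fps_to_fls intro!: germ_mult germ_inverse)
next
  assume f: "germ f"
  define m where "m = nat (- fls_subdegree f)"
  define a where "a = fls_regpart (fls_shift (- int m) f)"
  have "fps_to_fls a = fls_shift (- int m) f"
    unfolding a_def
    by (cases "f = 0") (auto intro!: fls_eqI simp: m_def)
  also have "\<dots> = f * fps_to_fls (fps_X ^ m)"
    by (simp add: fps_to_fls_power fls_X_power_times_conv_shift)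
  finally have "f = fps_to_fls a / fps_to_fls (fps_X ^ m)"
    by simp
  moreover have "convergent_fps N a"
    using germ_shift[OF f, of "- int m"] by (simp add: a_def convergent_fps_iff germ_def)
  moreover have "convergent_fps N (fps_X ^ m)"
    unfolding germ_fps_to_fls[symmetric] fps_to_fls_power by (simp add: fls_X_power_eq_monomial)
  ultimately show "f \<in> K"
    unfolding K_field_def by (intro CollectI exI[of _ a] exI[of _ "fps_X ^ m"]) auto
qed

lemma K_field_closed [simp, intro]:
  "0 \<in> K" "1 \<in> K" "monomial c i \<in> K"
  "f \<in> K \<Longrightarrow> g \<in> K \<Longrightarrow> f + g \<in> K"
  "f \<in> K \<Longrightarrow> g \<in> K \<Longrightarrow> f * g \<in> K"
  "f \<in> K \<Longrightarrow> inverse f \<in> K"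
  "f \<in> K \<Longrightarrow> sigma q f \<in> K"
proof -
  show "0 \<in> K" by (simp add: K_field_iff)
  show "monomial c i \<in> K" for c i by (simp add: K_field_iff)
  from this[of 1 0] show "1 \<in> K" by simp
qed (simp_all add: K_field_iff germ_add germ_mult germ_inverse germ_sigma)

lemma K_field_uminus [simp, intro]: "f \<in> K \<Longrightarrow> - f \<in> K"
proof -
  have "monomial (- 1) 0 * f = - f" by (rule fls_eqI) simp
  then show "f \<in> K \<Longrightarrow> - f \<in> K"
    using K_field_closed(5)[of "monomial (- 1) 0" f] by simp
qed

lemma K_field_sum [intro]: "(\<And>i. i \<in> A \<Longrightarrow> f i \<in> K) \<Longrightarrow> sum f A \<in> K"
  by (induction A rule: infinite_finite_induct) auto

text \<open>Covers multipliers of norm one, \<open>f(t) \<mapsto> f(t^n)\<close> and sections.\<close>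

lemma K_field_reindex:
  assumes f: "f \<in> K" and le: "\<And>k. N (g $$ int k) \<le> N (f $$ (h k))"
    and h: "\<And>k. h k \<le> int (A * (k + 1))" "\<And>k. h k \<ge> 0"
  shows "g \<in> K"
proof -
  obtain B where B: "B \<ge> 1" "\<And>k. N (f $$ int k) \<le> B ^ (k + 1)"
    using f unfolding K_field_iff germ_def by (rule geomE) blast
  have "N (g $$ int k) \<le> B ^ ((A + 1) * (k + 1))" for k
  proof -
    have "nat (h k) \<le> A * (k + 1)" using h(1)[of k] by linarith
    then have "nat (h k) + 1 \<le> (A + 1) * (k + 1)" by simp
    then have "B ^ (nat (h k) + 1) \<le> B ^ ((A + 1) * (k + 1))"
      using B(1) by (rule power_increasing)
    then show ?thesis using le[of k] B(2)[of "nat (h k)"] h(2)[of k] by simp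
  qed
  then show ?thesis unfolding K_field_iff germ_def by (rule geom_stretch[OF B(1)])
qed

lemma K_field_compose_power [simp, intro]:
  assumes "f \<in> K"
  shows "fls_compose_power f n \<in> K"
proof (cases "n = 0")
  case False
  show ?thesis
  proof (rule K_field_reindex[OF assms])
    fix k
    show "N (fls_compose_power f n $$ int k) \<le> N (f $$ (int k div int n))"
      using False by (auto simp: fls_nth_compose_power)
    show "int k div int n \<le> int (1 * (k + 1))"
      using div_le_dividend[of k n] by (simp flip: zdiv_int del: div_le_dividend)
    show "0 \<le> int k div int n" by (simp flip: zdiv_int)
  qed
qed auto

lemma K_field_section:
  assumes "f \<in> K" "i \<ge> 0" "n > 0"
  shows "section_fls n i f \<in> K"
proof (rule K_field_reindex[OF assms(1)])
  fix k
  show "N (section_fls n i f $$ int k) \<le> N (f $$ (int n * int k + i))"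
    using assms by (simp add: section_fls_nth)
  have "int n * int k + i \<le> (int n + i) * (int k + 1)"
    using assms by (simp add: algebra_simps)
  also have "\<dots> = int ((n + nat i) * (k + 1))" using assms by (simp only: of_nat_mult of_nat_add) simp
  finally show "int n * int k + i \<le> int ((n + nat i) * (k + 1))" .
qed (use assms in auto)

text \<open>Hence every \<open>N_module K n r \<mu> l\<close> with \<open>n > 0\<close> has the same
  carrier \<open>K\<close>, read as series in \<open>t\<close>; \<open>n\<close> enters only through
  the scalar multiplication.\<close>

lemma root_ext_K_field:
  assumes n: "n > 0"
  shows "root_ext n K = K"
proof
  show "root_ext n K \<subseteq> K"
    unfolding root_ext_def fls_X_power_eq_monomial
    by (auto intro!: K_field_sum K_field_closed(5) K_field_closed(3) K_field_compose_power)
  show "K \<subseteq> root_ext n K"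
  proof
    fix f assume "f \<in> K"
    then show "f \<in> root_ext n K"
      unfolding root_ext_def using n
      by (intro CollectI exI[of _ "\<lambda>i. section_fls n (int i) f"])
        (auto simp: fls_sections intro!: K_field_section)
  qed
qed

end

section \<open>Difference modules\<close>

lemma qdiff_moduleD:
  assumes "qdiff_module F q M"
  shows "module (fls_subring F) M" "bij_betw (Sig M) (carrier M) (carrier M)"
    "\<And>m m'. m \<in> carrier M \<Longrightarrow> m' \<in> carrier M \<Longrightarrow> Sig M (m \<oplus>\<^bsub>M\<^esub> m') = Sig M m \<oplus>\<^bsub>M\<^esub> Sig M m'"
    "\<And>f m. f \<in> F \<Longrightarrow> m \<in> carrier M \<Longrightarrow> Sig M (f \<odot>\<^bsub>M\<^esub> m) = sigma q f \<odot>\<^bsub>M\<^esub> Sig M m"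
    "\<And>m. m \<in> carrier M \<Longrightarrow> Sig M m \<in> carrier M"
  using assms unfolding qdiff_module_def bij_betw_def by auto

lemma fls_subring_simps [simp]:
  "carrier (fls_subring F) = F" "\<zero>\<^bsub>fls_subring F\<^esub> = 0" "\<one>\<^bsub>fls_subring F\<^esub> = 1"
  "x \<oplus>\<^bsub>fls_subring F\<^esub> y = x + y" "x \<otimes>\<^bsub>fls_subring F\<^esub> y = x * y"
  by (auto simp: fls_subring_def)

lemma additive_zero:
  assumes "abelian_group M" "abelian_group M'" "h \<in> carrier M \<rightarrow> carrier M'"
    "\<forall>m\<in>carrier M. \<forall>n\<in>carrier M. h (m \<oplus>\<^bsub>M\<^esub> n) = h m \<oplus>\<^bsub>M'\<^esub> h n"
  shows "h \<zero>\<^bsub>M\<^esub> = \<zero>\<^bsub>M'\<^esub>"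
proof -
  interpret A: abelian_group M by fact
  interpret B: abelian_group M' by fact
  have "h \<zero>\<^bsub>M\<^esub> \<oplus>\<^bsub>M'\<^esub> h \<zero>\<^bsub>M\<^esub> = h (\<zero>\<^bsub>M\<^esub> \<oplus>\<^bsub>M\<^esub> \<zero>\<^bsub>M\<^esub>)"
    using assms(4) A.zero_closed by metis
  also have "\<dots> = h \<zero>\<^bsub>M\<^esub>" by simp
  finally show ?thesis
    using assms(3) B.add.r_cancel_one[of "h \<zero>\<^bsub>M\<^esub>" "h \<zero>\<^bsub>M\<^esub>"] by auto
qed

lemma additive_minus:
  assumes "abelian_group M" "abelian_group M'" "h \<in> carrier M \<rightarrow> carrier M'"
    "\<forall>m\<in>carrier M. \<forall>n\<in>carrier M. h (m \<oplus>\<^bsub>M\<^esub> n) = h m \<oplus>\<^bsub>M'\<^esub> h n" "m \<in> carrier M"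
  shows "h (\<ominus>\<^bsub>M\<^esub> m) = \<ominus>\<^bsub>M'\<^esub> h m"
proof -
  interpret A: abelian_group M by fact
  interpret B: abelian_group M' by fact
  have "h (\<ominus>\<^bsub>M\<^esub> m) \<oplus>\<^bsub>M'\<^esub> h m = h (\<ominus>\<^bsub>M\<^esub> m \<oplus>\<^bsub>M\<^esub> m)" using assms by simp
  also have "\<dots> = \<zero>\<^bsub>M'\<^esub>" using assms by (simp add: A.l_neg additive_zero)
  finally show ?thesis using assms(3,5) by (intro B.minus_equality[symmetric]) auto
qed

text \<open>Kernel and image of a morphism are difference submodules, and \<open>m\<close> excludes
  a full kernel and a zero image.\<close>

lemma schur:
  assumes M: "qdiff_module F q M" "qdm_irreducible F M"
    and M': "qdiff_module F q M'" "qdm_irreducible F M'"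
    and h: "h \<in> qdm_hom F M M'" and m: "m \<in> carrier M" "h m \<noteq> \<zero>\<^bsub>M'\<^esub>"
  shows "qdm_iso F M M'"
proof -
  interpret A: module "fls_subring F" M using qdiff_moduleD[OF M(1)] by blast
  interpret B: module "fls_subring F" M' using qdiff_moduleD[OF M'(1)] by blast
  note SM = qdiff_moduleD[OF M(1)] and SM' = qdiff_moduleD[OF M'(1)]
  have hc: "h \<in> carrier M \<rightarrow> carrier M'"
    and hadd: "\<forall>m\<in>carrier M. \<forall>n\<in>carrier M. h (m \<oplus>\<^bsub>M\<^esub> n) = h m \<oplus>\<^bsub>M'\<^esub> h n"
    and hsm: "\<And>f m. f \<in> F \<Longrightarrow> m \<in> carrier M \<Longrightarrow> h (f \<odot>\<^bsub>M\<^esub> m) = f \<odot>\<^bsub>M'\<^esub> h m"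
    and hS: "\<And>m. m \<in> carrier M \<Longrightarrow> h (Sig M m) = Sig M' (h m)"
    using h unfolding qdm_hom_def by auto
  note ag = A.abelian_group_axioms B.abelian_group_axioms
  have h0: "h \<zero>\<^bsub>M\<^esub> = \<zero>\<^bsub>M'\<^esub>" by (rule additive_zero[OF ag hc hadd])
  have hneg: "h (\<ominus>\<^bsub>M\<^esub> a) = \<ominus>\<^bsub>M'\<^esub> h a" if "a \<in> carrier M" for a
    by (rule additive_minus[OF ag hc hadd that])
  have S0': "Sig M' \<zero>\<^bsub>M'\<^esub> = \<zero>\<^bsub>M'\<^esub>"
    using SM' by (intro additive_zero[OF ag(2) ag(2)]) auto
  define Ker where "Ker = {x \<in> carrier M. h x = \<zero>\<^bsub>M'\<^esub>}"
  have "submodule Ker (fls_subring F) M"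
  proof (rule A.submoduleI)
    show "\<ominus>\<^bsub>M\<^esub> a \<in> Ker" if "a \<in> Ker" for a using that by (simp add: Ker_def hneg)
    show "a \<oplus>\<^bsub>M\<^esub> b \<in> Ker" if "a \<in> Ker" "b \<in> Ker" for a b
      using that hadd by (simp add: Ker_def)
    show "a \<odot>\<^bsub>M\<^esub> x \<in> Ker" if "a \<in> carrier (fls_subring F)" "x \<in> Ker" for a x
      using that hsm by (simp add: Ker_def)
  qed (simp_all add: Ker_def h0 subset_iff)
  moreover have "Sig M ` Ker = Ker"
  proof
    show "Sig M ` Ker \<subseteq> Ker"
      by (rule image_subsetI) (use SM(5) in \<open>simp add: Ker_def hS S0'\<close>)
    \<comment> \<open>Stability is an equality, not an inclusion: injectivity of
      \<open>Sig M'\<close> shows that the preimage of a kernel element lies in the kernel.\<close>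
    show "Ker \<subseteq> Sig M ` Ker"
    proof
      fix x assume x: "x \<in> Ker"
      then obtain y where y: "y \<in> carrier M" "x = Sig M y"
        using SM(2) unfolding Ker_def bij_betw_def by blast
      then have "Sig M' (h y) = Sig M' \<zero>\<^bsub>M'\<^esub>" using x by (simp add: Ker_def hS S0')
      then have "h y = \<zero>\<^bsub>M'\<^esub>"
        using SM'(2) y hc unfolding bij_betw_def inj_on_def by auto
      then show "x \<in> Sig M ` Ker" using y by (auto simp: Ker_def)
    qed
  qed
  ultimately have "Ker = {\<zero>\<^bsub>M\<^esub>} \<or> Ker = carrier M"
    using M(2) unfolding qdm_irreducible_def qdiff_submodule_def by blast
  then have Ker: "Ker = {\<zero>\<^bsub>M\<^esub>}" using m unfolding Ker_def by auto
  have inj: "inj_on h (carrier M)"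
  proof (rule inj_onI)
    fix x y assume xy: "x \<in> carrier M" "y \<in> carrier M" "h x = h y"
    then have "h (x \<ominus>\<^bsub>M\<^esub> y) = \<zero>\<^bsub>M'\<^esub>"
      using hc hadd by (auto simp: A.minus_eq hneg Pi_iff intro!: B.r_neg)
    then have "x \<ominus>\<^bsub>M\<^esub> y \<in> Ker" using xy by (auto simp: Ker_def)
    then have "x \<oplus>\<^bsub>M\<^esub> \<ominus>\<^bsub>M\<^esub> y = \<zero>\<^bsub>M\<^esub>" using Ker by (simp add: A.minus_eq)
    then have "\<ominus>\<^bsub>M\<^esub> (\<ominus>\<^bsub>M\<^esub> y) = x" using xy by (intro A.minus_equality) auto
    then show "x = y" using xy by simp
  qed
  define Im where "Im = h ` carrier M"
  have "submodule Im (fls_subring F) M'"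
  proof (rule B.submoduleI)
    show "Im \<subseteq> carrier M'" using hc by (auto simp: Im_def)
    show "\<zero>\<^bsub>M'\<^esub> \<in> Im" unfolding Im_def by (rule image_eqI[of _ _ "\<zero>\<^bsub>M\<^esub>"]) (auto simp: h0)
    show "\<ominus>\<^bsub>M'\<^esub> a \<in> Im" if a: "a \<in> Im" for a
    proof -
      obtain x where "a = h x" "x \<in> carrier M" using a unfolding Im_def by (rule imageE)
      then show ?thesis unfolding Im_def
        using hneg by (intro image_eqI[of _ _ "\<ominus>\<^bsub>M\<^esub> x"]) auto
    qed
    show "a \<oplus>\<^bsub>M'\<^esub> b \<in> Im" if a: "a \<in> Im" and b: "b \<in> Im" for a b
    proof -
      obtain x where "a = h x" "x \<in> carrier M" using a unfolding Im_def by (rule imageE)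
      moreover obtain y where "b = h y" "y \<in> carrier M" using b unfolding Im_def by (rule imageE)
      ultimately show ?thesis unfolding Im_def using hadd by (intro image_eqI[of _ _ "x \<oplus>\<^bsub>M\<^esub> y"]) auto
    qed
    show "a \<odot>\<^bsub>M'\<^esub> x \<in> Im" if a: "a \<in> carrier (fls_subring F)" and x: "x \<in> Im" for a x
    proof -
      obtain y where "x = h y" "y \<in> carrier M" using x unfolding Im_def by (rule imageE)
      then show ?thesis unfolding Im_def using a hsm by (intro image_eqI[of _ _ "a \<odot>\<^bsub>M\<^esub> y"]) auto
    qed
  qed
  moreover have "Sig M' ` Im = Im"
  proof -
    have "Sig M' ` Im = h ` (Sig M ` carrier M)"
      unfolding Im_def image_image using hS by (intro image_cong) auto
    then show ?thesis using SM(2) by (simp add: Im_def bij_betw_def)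
  qed
  ultimately have "Im = {\<zero>\<^bsub>M'\<^esub>} \<or> Im = carrier M'"
    using M'(2) unfolding qdm_irreducible_def qdiff_submodule_def by blast
  then have "Im = carrier M'" using m unfolding Im_def by auto
  then have "bij_betw h (carrier M) (carrier M')" using inj by (simp add: bij_betw_def Im_def)
  then show ?thesis using h unfolding qdm_iso_def by blast
qed

lemma qdm_hom_compose:
  assumes "h \<in> qdm_hom F M M'" "k \<in> qdm_hom F M' M''"
  shows "(\<lambda>x. k (h x)) \<in> qdm_hom F M M''"
  using assms unfolding qdm_hom_def by (auto simp: Pi_iff)

lemma qdm_iso_trans:
  assumes "qdm_iso F M M'" "qdm_iso F M' M''"
  shows "qdm_iso F M M''"
proof -
  obtain h k where h: "h \<in> qdm_hom F M M'" "bij_betw h (carrier M) (carrier M')"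
    and k: "k \<in> qdm_hom F M' M''" "bij_betw k (carrier M') (carrier M'')"
    using assms unfolding qdm_iso_def by blast
  have "bij_betw (\<lambda>x. k (h x)) (carrier M) (carrier M'')"
    using bij_betw_trans[OF h(2) k(2)] by (simp add: o_def)
  then show ?thesis using qdm_hom_compose[OF h(1) k(1)] unfolding qdm_iso_def by blast
qed

section \<open>The modules attached to monomials\<close>

text \<open>The binomial coefficient of \<open>i\<close> over 2, also for negative \<open>i\<close>:
  writing \<open>(x^(-\<mu>) \<sigma>)^i\<close> with \<sigma> on the right collects the power
  \<open>r powi (- \<mu> * tri i)\<close>.\<close>

definition tri :: "int \<Rightarrow> int" where
  "tri i = i * (i - 1) div 2"

lemma two_tri: "2 * tri i = i * (i - 1)"
  unfolding tri_def by (rule dvd_mult_div_cancel) auto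

lemma tri_0 [simp]: "tri 0 = 0" and tri_1 [simp]: "tri 1 = 0"
  by (auto simp: tri_def)

text \<open>The term \<open>i * j\<close> is the price for moving \<open>\<sigma>^i\<close> past
  \<open>x^(-\<mu> j)\<close>; it makes the operators \<open>Spow\<close> compose additively in the
  exponent.\<close>

lemma tri_add: "tri (i + j) = tri i + tri j + i * j"
proof -
  have "2 * tri (i + j) = 2 * (tri i + tri j + i * j)"
    unfolding distrib_left two_tri by (simp add: algebra_simps)
  then show ?thesis by simp
qed

text \<open>\<open>Spow r \<mu> l i\<close> is the \<open>i\<close>-th power of \<open>Sig\<close> on \<open>M_(\<mu>,l,n)\<close>.\<close>

definition Spow_coeff :: "'c::field \<Rightarrow> int \<Rightarrow> 'c \<Rightarrow> int \<Rightarrow> 'c" where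
  "Spow_coeff r \<mu> l i = l powi i * r powi (- \<mu> * tri i)"

definition Spow :: "'c::field \<Rightarrow> int \<Rightarrow> 'c \<Rightarrow> int \<Rightarrow> 'c fls \<Rightarrow> 'c fls" where
  "Spow r \<mu> l i f = monomial (Spow_coeff r \<mu> l i) (- \<mu> * i) * sigma (r powi i) f"

lemma Spow_coeff_nonzero [simp]: "r \<noteq> 0 \<Longrightarrow> l \<noteq> 0 \<Longrightarrow> Spow_coeff r \<mu> l i \<noteq> 0"
  by (simp add: Spow_coeff_def)

lemma Spow_0 [simp]: "Spow r \<mu> l 0 f = f"
  and Spow_1: "Spow r \<mu> l 1 f = monomial l (- \<mu>) * sigma r f"
  by (simp_all add: Spow_def Spow_coeff_def)

lemma Spow_add_arg [simp]: "Spow r \<mu> l i (f + g) = Spow r \<mu> l i f + Spow r \<mu> l i g"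
  and Spow_zero_arg [simp]: "Spow r \<mu> l i 0 = 0"
  by (simp_all add: Spow_def algebra_simps)

lemma Spow_sum: "Spow r \<mu> l i (sum f A) = (\<Sum>x\<in>A. Spow r \<mu> l i (f x))"
  by (induction A rule: infinite_finite_induct) auto

text \<open>The exponents range over all integers, so \<open>Spow r \<mu> l (- 1)\<close> inverts
  \<open>Sig\<close>.\<close>

lemma Spow_Spow [simp]:
  assumes "r \<noteq> 0" "l \<noteq> 0"
  shows "Spow r \<mu> l i (Spow r \<mu> l j f) = Spow r \<mu> l (i + j) f"
proof -
  have "Spow_coeff r \<mu> l i * (Spow_coeff r \<mu> l j * (r powi i) powi (- (\<mu> * j))) = Spow_coeff r \<mu> l (i + j)"
  proof -
    have "- \<mu> * tri (i + j) = - \<mu> * tri i + - \<mu> * tri j + i * (- (\<mu> * j))"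
      by (simp add: tri_add algebra_simps)
    then have "r powi (- \<mu> * tri (i + j)) = r powi (- \<mu> * tri i) * r powi (- \<mu> * tri j) * (r powi i) powi (- (\<mu> * j))"
      using assms by (simp only: power_int_add power_int_mult[symmetric] disj_not1 simp_thms)
    then show ?thesis using assms
      by (simp add: Spow_coeff_def power_int_add mult_ac)
  qed
  moreover have "- \<mu> * i + - \<mu> * j = - \<mu> * (i + j)" by (simp add: algebra_simps)
  ultimately show ?thesis using assms
    by (simp add: Spow_def power_int_add)
qed

lemma Spow_smult:
  assumes "r \<noteq> 0"
  shows "Spow r \<mu> l i (f * g) = sigma (r powi i) f * Spow r \<mu> l i g"
  using assms by (simp add: Spow_def mult_ac)

lemma Spow_monomial:
  assumes "r \<noteq> 0"
  shows "Spow r \<mu> l i (monomial c j) = monomial (Spow_coeff r \<mu> l i * (c * (r powi i) powi j)) (j - \<mu> * i)"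
  using assms by (simp add: Spow_def)

context absval
begin

lemma Spow_closed [simp, intro]: "f \<in> K \<Longrightarrow> Spow r \<mu> l i f \<in> K"
  unfolding Spow_def by auto

section \<open>The modules over the field of convergent series\<close>

lemma N_module_simps [simp]:
  assumes "n > 0"
  shows "carrier (N_module K n r \<mu> l) = K"
    "x \<oplus>\<^bsub>N_module K n r \<mu> l\<^esub> y = x + y"
    "\<zero>\<^bsub>N_module K n r \<mu> l\<^esub> = 0"
    "f \<odot>\<^bsub>N_module K n r \<mu> l\<^esub> x = fls_compose_power f n * x"
    "Sig (N_module K n r \<mu> l) x = Spow r \<mu> l 1 x"
  using assms
  by (simp_all add: N_module_def restrict_scalars_def M_root_module_def rank_one_def root_ext_K_field
      Spow_1 monomial_def mult_ac)

text \<open>For \<open>n = 1\<close> coprimality is automatic, so the statements on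
  \<open>N_module\<close> cover the rank one modules over \<open>K\<close>.\<close>

lemma M_module_eq: "M_module K q \<mu> l = N_module K 1 q \<mu> l"
  by (simp add: M_module_def N_module_def restrict_scalars_def M_root_module_def root_ext_K_field rank_one_def)

lemma cring_K_field: "cring (fls_subring K)"
proof (rule cringI)
  show "abelian_group (fls_subring K)"
    by (rule abelian_groupI) (auto intro: bexI[of _ "- _"])
  show "Group.comm_monoid (fls_subring K)"
    by (rule comm_monoidI) (auto simp: mult_ac)
qed (auto simp: algebra_simps)

lemma module_N_module:
  assumes "n > 0"
  shows "module (fls_subring K) (N_module K n r \<mu> l)"
proof (rule moduleI)
  show "abelian_group (N_module K n r \<mu> l)"
    by (rule abelian_groupI) (use assms in \<open>auto intro: bexI[of _ "- _"]\<close>)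
qed (use assms cring_K_field in \<open>auto simp: algebra_simps\<close>)

lemma finsum_N_module:
  assumes "n > 0" "finite A" "\<And>x. x \<in> A \<Longrightarrow> f x \<in> K"
  shows "finsum (N_module K n r \<mu> l) f A = sum f A"
proof -
  interpret A: module "fls_subring K" "N_module K n r \<mu> l"
    by (rule module_N_module[OF assms(1)])
  show ?thesis using assms(2,3)
    by (induction A rule: finite_induct) (use assms(1) in \<open>auto simp: A.finsum_insert Pi_iff\<close>)
qed

lemma qdiff_module_N_module:
  assumes n: "n > 0" and r: "r ^ n = q" "r \<noteq> 0" and l: "l \<noteq> 0"
  shows "qdiff_module K q (N_module K n r \<mu> l)"
  unfolding qdiff_module_def
proof (intro conjI ballI)
  let ?M = "N_module K n r \<mu> l"
  show "module (fls_subring K) ?M" using n by (rule module_N_module)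
  define B :: "'c fls set" where "B = (\<lambda>i. fls_X ^ i) ` {..<n}"
  have inj: "inj_on (\<lambda>i. fls_X ^ i :: 'c fls) {..<n}"
  proof (rule inj_onI)
    fix i j assume "fls_X ^ i = (fls_X ^ j :: 'c fls)"
    then have "(fls_X ^ i :: 'c fls) $$ int i = fls_X ^ j $$ int i" by simp
    then show "i = j" by (simp split: if_splits)
  qed
  have "\<exists>c\<in>B \<rightarrow> K. m = (\<Oplus>\<^bsub>?M\<^esub>b\<in>B. c b \<odot>\<^bsub>?M\<^esub> b)" if m: "m \<in> K" for m
  proof
    \<comment> \<open>The powers of \<open>t\<close> below \<open>n\<close> generate;
      \<open>fls_subdegree b\<close> recovers the exponent \<open>i\<close> from
      \<open>b = t^i\<close>.\<close>
    define c where "c b = section_fls n (fls_subdegree b) m" for b :: "'c fls"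
    show c: "c \<in> B \<rightarrow> K"
      using m n by (auto simp: B_def c_def intro!: K_field_section)
    have "(\<Oplus>\<^bsub>?M\<^esub>b\<in>B. c b \<odot>\<^bsub>?M\<^esub> b) = (\<Sum>b\<in>B. fls_compose_power (c b) n * b)"
      using n c by (subst finsum_N_module)
        (auto simp: B_def fls_X_power_eq_monomial intro!: K_field_closed(5) K_field_compose_power)
    also have "\<dots> = (\<Sum>i<n. fls_compose_power (section_fls n (int i) m) n * fls_X ^ i)"
      unfolding B_def by (subst sum.reindex[OF inj]) (simp add: c_def)
    also have "\<dots> = m" using n by (rule fls_sections)
    finally show "m = (\<Oplus>\<^bsub>?M\<^esub>b\<in>B. c b \<odot>\<^bsub>?M\<^esub> b)" ..
  qed
  moreover have "finite B" "B \<subseteq> K" by (auto simp: B_def fls_X_power_eq_monomial)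
  ultimately show "\<exists>B. finite B \<and> B \<subseteq> carrier ?M \<and>
      (\<forall>m\<in>carrier ?M. \<exists>c\<in>B \<rightarrow> K. m = (\<Oplus>\<^bsub>?M\<^esub>b\<in>B. c b \<odot>\<^bsub>?M\<^esub> b))"
    using n by (intro exI[of _ B]) auto
  show "bij_betw (Sig ?M) (carrier ?M) (carrier ?M)"
    by (rule bij_betw_byWitness[where f' = "Spow r \<mu> l (- 1)"]) (use n r l in auto)
  show "Sig ?M (m \<oplus>\<^bsub>?M\<^esub> m') = Sig ?M m \<oplus>\<^bsub>?M\<^esub> Sig ?M m'" for m m' using n by simp
  show "Sig ?M (f \<odot>\<^bsub>?M\<^esub> m) = sigma q f \<odot>\<^bsub>?M\<^esub> Sig ?M m" for f m
    using n r by (simp add: Spow_smult)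
qed

text \<open>Multiplication by a series in \<open>t^n\<close> does not mix the classes modulo
  \<open>n\<close>.\<close>

lemma section_compose_power_mult:
  fixes f u :: "'a::field fls"
  assumes n: "n > 0" and j: "j < n"
  shows "section_fls n (int j) (fls_compose_power u n * f) = u * section_fls n (int j) f"
proof (rule fls_eqI)
  fix k
  have "fls_compose_power u n * f
      = (\<Sum>i<n. fls_compose_power (u * section_fls n (int i) f) n * fls_X ^ i)"
    by (subst (1) fls_sections[OF n, of f, symmetric]) (simp add: sum_distrib_left mult.assoc)
  moreover have "nat ((int n * k + int j) mod int n) = j" "(int n * k + int j) div int n = k"
    using j n by auto
  ultimately show "section_fls n (int j) (fls_compose_power u n * f) $$ k = (u * section_fls n (int j) f) $$ k"
    using n by (simp only: section_fls_nth compose_power_nth_sum)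
qed

end

text \<open>\<Sigma>^i shifts the exponents of \<open>t\<close> by \<open>- \<mu> * i\<close> and
  the scalar \<open>x^m\<close> shifts them by \<open>n * m\<close>: every power of \<open>t\<close>
  is reached from any other one, with nonnegative powers of \<Sigma> only.\<close>

lemma coprime_combination:
  assumes n: "n > 0" and cop: "coprime (int n) \<mu>"
  obtains i :: nat and m where "int n * m - \<mu> * int i = k"
proof -
  obtain v where v: "[\<mu> * v = 1] (mod int n)"
    using cop cong_solve_coprime_int[of \<mu> "int n"] by (auto simp: coprime_commute)
  define i where "i = nat (v * (- k) mod int n)"
  have "[int i = v * (- k)] (mod int n)" using n by (simp add: i_def)
  then have "[\<mu> * int i = \<mu> * (v * (- k))] (mod int n)" by (rule cong_scalar_left)
  also have "[\<mu> * (v * (- k)) = 1 * (- k)] (mod int n)"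
    using cong_scalar_right[OF v, of "- k"] by (simp add: mult.assoc)
  finally have "int n dvd \<mu> * int i - 1 * (- k)" by (simp only: cong_iff_dvd_diff)
  then obtain m where "\<mu> * int i - 1 * (- k) = int n * m" by (elim dvdE)
  then have "int n * m - \<mu> * int i = k" by simp
  then show ?thesis by (rule that)
qed

lemma powi_eq_1D:
  fixes q :: "'a::field"
  assumes q: "\<And>k::nat. k \<ge> 1 \<Longrightarrow> q ^ k \<noteq> 1" and 1: "q powi k = 1"
  shows "k = 0"
proof (rule ccontr)
  assume "k \<noteq> 0"
  then have "nat \<bar>k\<bar> \<ge> 1" by simp
  moreover have "q ^ nat \<bar>k\<bar> = 1"
    using 1 by (cases "k \<ge> 0") (auto simp: power_int_def power_inverse)
  ultimately show False using q by blast
qed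

context absval
begin

text \<open>A nonzero element of a submodule whose support meets as few classes modulo \<open>n\<close> as
  possible is, after scaling, a power of \<open>t\<close>: otherwise \<open>q^(-j) f(q t) - f(t)\<close> would meet fewer.\<close>

lemma irreducible_N_module:
  assumes n: "n > 0" and r: "r ^ n = q" "r \<noteq> 0" and l: "l \<noteq> 0"
    and q: "\<And>k::nat. k \<ge> 1 \<Longrightarrow> q ^ k \<noteq> 1" and cop: "coprime (int n) \<mu>"
  shows "qdm_irreducible K (N_module K n r \<mu> l)"
  unfolding qdm_irreducible_def
proof (intro conjI allI impI)
  let ?M = "N_module K n r \<mu> l"
  show "carrier ?M \<noteq> {\<zero>\<^bsub>?M\<^esub>}"
  proof
    assume "carrier ?M = {\<zero>\<^bsub>?M\<^esub>}"
    then have "1 \<in> {0 :: 'c fls}" using n K_field_closed(2) by simp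
    then show False by simp
  qed
  fix H assume "qdiff_submodule K H ?M"
  then have H: "submodule H (fls_subring K) ?M" and SH: "Sig ?M ` H = H"
    unfolding qdiff_submodule_def by auto
  interpret A: module "fls_subring K" ?M by (rule module_N_module[OF n])
  have HK: "H \<subseteq> K" and H0: "0 \<in> H"
    and Hadd: "\<And>a b. a \<in> H \<Longrightarrow> b \<in> H \<Longrightarrow> a + b \<in> H"
    and Hsm: "\<And>f a. f \<in> K \<Longrightarrow> a \<in> H \<Longrightarrow> fls_compose_power f n * a \<in> H"
    using A.submoduleE[OF H] subgroup.one_closed[OF submodule.axioms(1)[OF H]] n by auto
  have q0: "q \<noteq> 0" using r by auto
  have HS: "Spow r \<mu> l (int i) a \<in> H" if "a \<in> H" for a i
  proof (induction i)
    case (Suc i)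
    have "Spow r \<mu> l (int (Suc i)) a = Sig ?M (Spow r \<mu> l (int i) a)"
      using n r l by simp
    then show ?case using SH Suc by blast
  qed (use that in simp)
  have Hmon: "monomial c (int n * k) * a \<in> H" if "a \<in> H" for a c k
    using Hsm[of "monomial c k" a] that n by simp
  have Hdiff: "a - b \<in> H" if "a \<in> H" "b \<in> H" for a b
    using Hadd[OF that(1) Hmon[OF that(2), of "- 1" 0]] by (simp add: monomial_def)
  have Hsig: "sigma q a \<in> H" if "a \<in> H" for a
  proof -
    \<comment> \<open>Since \<open>r ^ n = q\<close>, \<Sigma>^n is
      \<open>f(t) \<mapsto> f(q t)\<close> up to a scalar from the base field, so \<open>H\<close>
      is stable under the latter.\<close>
    let ?c = "Spow_coeff r \<mu> l (int n)"
    have "monomial (inverse ?c) (int n * \<mu>) * Spow r \<mu> l (int n) a = sigma q a"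
      using r l by (simp add: Spow_def)
    then show ?thesis using Hmon[OF HS[OF that, of n], of "inverse ?c" \<mu>] by simp
  qed
  show "H = {\<zero>\<^bsub>?M\<^esub>} \<or> H = carrier ?M"
  proof (cases "H = {0}")
    case False
    define R where "R f = {i \<in> {..<n}. section_fls n (int i) f \<noteq> 0}" for f :: "'c fls"
    obtain f where f: "f \<in> H" "f \<noteq> 0" and fmin: "\<And>g. g \<in> H \<Longrightarrow> g \<noteq> 0 \<Longrightarrow> card (R f) \<le> card (R g)"
      using ex_has_least_nat[of "\<lambda>g. g \<in> H \<and> g \<noteq> 0" _ "\<lambda>g. card (R g)"] False H0 by blast
    have "R f \<noteq> {}"
    proof
      assume "R f = {}"
      then have "f = 0" using fls_sections[OF n, of f] by (simp add: R_def)
      then show False using f by simp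
    qed
    then obtain j where j: "j < n" "section_fls n (int j) f \<noteq> 0" by (auto simp: R_def)
    \<comment> \<open>Scaling by \<open>u\<close> turns the section of class \<open>j\<close> into
      1, so that \<open>t^j\<close> is the only term of \<open>f'\<close> in this class.\<close>
    define u where "u = inverse (section_fls n (int j) f)"
    have uK: "u \<in> K" 
      unfolding u_def using f HK n by (intro K_field_closed(6) K_field_section) auto
    define f' where "f' = fls_compose_power u n * f"
    have f'H: "f' \<in> H" using Hsm uK f by (simp add: f'_def)
    have sec: "section_fls n (int i) f' = u * section_fls n (int i) f" if "i < n" for i
      using that n by (simp add: f'_def section_compose_power_mult)
    have Rf': "R f' \<subseteq> R f" using sec by (auto simp: R_def)
    have secj: "f' $$ (int n * k + int j) = (if k = 0 then 1 else 0)" for k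
    proof -
      have "f' $$ (int n * k + int j) = section_fls n (int j) f' $$ k" using n by (simp add: section_fls_nth)
      then show ?thesis using sec[OF j(1)] j(2) by (simp add: u_def)
    qed
    define g where "g = monomial (q powi (- int j)) (int n * 0) * sigma q f' - f'"
    have gH: "g \<in> H" unfolding g_def by (intro Hdiff Hmon Hsig f'H)
    \<comment> \<open>The factor vanishes only at \<open>k = int j\<close>, as \<open>q\<close> is
      not a root of unity: \<open>g\<close> loses the class \<open>j\<close> and gains no
      class.\<close>
    have g_nth: "g $$ k = (q powi (k - int j) - 1) * f' $$ k" for k
      using q0 by (simp add: g_def algebra_simps flip: power_int_add)
    have "R g \<subseteq> R f' - {j}"
      using n by (auto simp: R_def fls_eq_iff section_fls_nth g_nth secj split: if_splits)
    then have "card (R g) < card (R f)"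
      using Rf' j by (intro psubset_card_mono) (auto simp: R_def)
    then have "g = 0" using fmin[OF gH] by force
    have f'k: "f' $$ k = 0" if "k \<noteq> int j" for k
    proof -
      have "q powi (k - int j) \<noteq> 1" using powi_eq_1D[OF q, of "k - int j"] that by auto
      then show ?thesis using g_nth[of k] \<open>g = 0\<close> by simp
    qed
    have "f' = monomial 1 (int j)" using f'k secj[of 0] by (intro fls_eqI) auto
    then have tj: "monomial 1 (int j) \<in> H" using f'H by simp
    have ti: "monomial c k \<in> H" for c k
    proof -
      obtain i m where "int n * m - \<mu> * int i = k - int j" using coprime_combination[OF n cop] by blast
      then have m: "int n * m + (int j - \<mu> * int i) = k" by simp
      let ?d = "Spow_coeff r \<mu> l (int i) * (r powi int i) powi int j"
      have "monomial (c / ?d) (int n * m) * Spow r \<mu> l (int i) (monomial 1 (int j)) = monomial c k"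
        using r l m by (simp add: Spow_monomial)
      then show ?thesis using Hmon[OF HS[OF tj, of i], of "c / ?d" m] by simp
    qed
    have "K \<subseteq> H"
    proof
      fix f assume f: "f \<in> K"
      have Hsum: "sum h I \<in> H" if "\<And>i. i \<in> I \<Longrightarrow> h i \<in> H" for I :: "nat set" and h
        using that by (induction I rule: infinite_finite_induct) (auto intro: H0 Hadd)
      have "(\<Sum>i<n. fls_compose_power (section_fls n (int i) f) n * fls_X ^ i) \<in> H"
      proof (rule Hsum)
        fix i
        have "section_fls n (int i) f \<in> K" using n f by (intro K_field_section) auto
        then show "fls_compose_power (section_fls n (int i) f) n * fls_X ^ i \<in> H"
          unfolding fls_X_power_eq_monomial using ti by (rule Hsm)
      qed
      then show "f \<in> H" using n by (simp add: fls_sections)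
    qed
    then have "H = K" using HK by (intro equalityI)
    then show ?thesis using N_module_simps(1)[OF n] by (intro disjI2) metis
  qed (use n in simp)
qed

end

section \<open>Morphisms between the modules attached to monomials\<close>

lift_definition coeff_mult :: "(int \<Rightarrow> 'a::field) \<Rightarrow> 'a fls \<Rightarrow> 'a fls" is
  "\<lambda>c f k. c k * f k"
  by (erule MOST_mono) simp

lemma coeff_mult_nth [simp]: "coeff_mult c f $$ k = c k * f $$ k"
  by (simp add: coeff_mult.rep_eq)

text \<open>A multiplier invariant under translation by the support of \<open>f\<close> commutes
  with multiplication by \<open>f\<close>; this serves for \<open>f\<close> in \<open>t^n\<close>
  and \<open>c\<close> of period \<open>n\<close>. The condition \<open>c k \<noteq> 0\<close>
  preserves the subdegree, hence the range of the Cauchy sum.\<close>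

lemma coeff_mult_mult:
  assumes c: "\<And>k. c k \<noteq> 0" and per: "\<And>i k. f $$ i \<noteq> 0 \<Longrightarrow> c (k - i) = c k"
  shows "coeff_mult c (f * g) = f * coeff_mult c g"
proof (rule fls_eqI)
  fix n
  have sd: "fls_subdegree (coeff_mult c g) = fls_subdegree g"
  proof (cases "g = 0")
    case True
    then have "coeff_mult c g = 0" by (intro fls_eqI) simp
    then show ?thesis using True by simp
  next
    case False
    then show ?thesis using c by (intro fls_subdegree_eqI) auto
  qed
  have "coeff_mult c (f * g) $$ n = (\<Sum>i=fls_subdegree f..n - fls_subdegree g. c n * (f $$ i * g $$ (n - i)))"
    by (simp add: fls_times_nth(2) sum_distrib_left)
  also have "\<dots> = (\<Sum>i=fls_subdegree f..n - fls_subdegree g. f $$ i * coeff_mult c g $$ (n - i))"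
  proof (rule sum.cong)
    fix i
    show "c n * (f $$ i * g $$ (n - i)) = f $$ i * coeff_mult c g $$ (n - i)"
      using per[of i n] by (cases "f $$ i = 0") auto
  qed simp
  also have "\<dots> = (f * coeff_mult c g) $$ n"
    by (simp only: fls_times_nth(2) sd)
  finally show "coeff_mult c (f * g) $$ n = (f * coeff_mult c g) $$ n" .
qed

lemma compose_power_compose_power:
  assumes "m > 0" "n > 0"
  shows "fls_compose_power (fls_compose_power f m) n = fls_compose_power f (n * m)"
proof (rule fls_eqI)
  fix k
  show "fls_compose_power (fls_compose_power f m) n $$ k = fls_compose_power f (n * m) $$ k"
  proof (cases "int n dvd k")
    case True
    then obtain j where "k = int n * j" by (elim dvdE)
    then show ?thesis using assms by (simp add: fls_nth_compose_power)
  next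
    case False
    then have "\<not> int n * int m dvd k" using dvd_mult_left by blast
    then show ?thesis using False assms by (simp add: fls_nth_compose_power)
  qed
qed

text \<open>A quadratic character: the cocycle that turns one \<open>n\<close>-th root of \<open>q\<close> into another one.\<close>

lemma root_change_cocycle:
  fixes \<zeta> :: "'c::field"
  assumes sq: "\<exists>\<omega>. \<omega> ^ 2 = \<zeta>" and n: "n > 0" and cop: "coprime (int n) \<mu>" and \<zeta>: "\<zeta> ^ n = 1"
  obtains c \<kappa> \<omega> where "\<kappa> \<noteq> 0" "c 0 = 1" "\<And>j. c (j + int n) = c j"
    "\<And>j. c (j - \<mu>) = \<kappa> * \<zeta> powi j * c j" "\<And>j. \<exists>e. c j = \<omega> powi e" "\<omega> ^ (2 * n) = 1"
proof -
  obtain \<omega> where \<omega>2: "\<omega> ^ 2 = \<zeta>" using sq by auto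
  have \<omega>1: "\<omega> ^ (2 * n) = 1" unfolding power_mult using \<omega>2 \<zeta> by simp
  have \<omega>0: "\<omega> \<noteq> 0" using \<omega>1 n by (metis power_0_left zero_neq_one mult_eq_0_iff not_gr_zero zero_neq_numeral)
  have \<zeta>0: "\<zeta> \<noteq> 0" using \<omega>2 \<omega>0 by auto
  have \<omega>per: "\<omega> powi (e + 2 * int n * t) = \<omega> powi e" for e t
  proof -
    have "\<omega> powi (2 * int n * t) = (\<omega> powi int (2 * n)) powi t" by (simp add: power_int_mult)
    also have "\<dots> = 1" using \<omega>1 by (simp only: power_int_of_nat) simp
    finally show ?thesis using \<omega>0 by (simp add: power_int_add)
  qed
  have \<zeta>per: "\<zeta> powi (e + int n * t) = \<zeta> powi e" for e t
    using \<zeta>0 \<zeta> by (simp add: power_int_add power_int_mult)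
  obtain v0 where "[\<mu> * v0 = 1] (mod int n)"
    using cop cong_solve_coprime_int[of \<mu> "int n"] by (auto simp: coprime_commute)
  then have "int n dvd \<mu> * v0 - 1" by (simp add: cong_iff_dvd_diff)
  then obtain u0 where u0: "\<mu> * v0 - 1 = int n * u0" by (elim dvdE)
  \<comment> \<open>\<open>v\<close> is minus the inverse of \<mu> modulo \<open>n\<close>:
    replacing \<open>j\<close> by \<open>j - \<mu>\<close> moves \<open>v * j\<close> by 1 modulo
    \<open>n\<close>.\<close>
  define v where "v = - v0"
  define u where "u = u0"
  have vu: "- (\<mu> * v) = 1 + int n * u" using u0 by (simp add: v_def u_def algebra_simps)
  \<comment> \<open>The linear part of \<open>E\<close> settles a question of parity: a shift of
    \<open>m\<close> by \<open>n * t\<close> changes \<open>E\<close> by a multiple of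
    \<open>2 * n\<close>, because \<open>t * (t - 1)\<close> is even, whereas
    \<open>- \<mu> * m * m\<close> alone could fail for odd \<open>n\<close>.\<close>
  define E where "E m = \<mu> * m * (int n - m)" for m
  have Eper: "\<omega> powi E (m + int n * t) = \<omega> powi E m" for m t
  proof -
    have "E (m + int n * t) = E m + \<mu> * int n * (- int n * (t * (t - 1)) - 2 * (m * t))"
      unfolding E_def by (simp add: algebra_simps)
    also have "\<dots> = E m + 2 * int n * (\<mu> * (- int n * tri t - m * t))"
      unfolding two_tri[symmetric] by (simp add: algebra_simps)
    finally show ?thesis using \<omega>per by simp
  qed
  define c where "c j = \<omega> powi E (v * j)" for j
  define \<kappa> where "\<kappa> = \<omega> powi (\<mu> * (int n - 1))"
  show ?thesis
  proof
    show "\<kappa> \<noteq> 0" using \<omega>0 by (simp add: \<kappa>_def)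
    show "c 0 = 1" by (simp add: c_def E_def)
    show "c (j + int n) = c j" for j
      using Eper[of "v * j" v] by (simp add: c_def distrib_left mult.commute)
    show "\<exists>e. c j = \<omega> powi e" for j by (auto simp: c_def)
    show "\<omega> ^ (2 * n) = 1" by fact
    show "c (j - \<mu>) = \<kappa> * \<zeta> powi j * c j" for j
    proof -
      define m where "m = v * j"
      have "v * (j - \<mu>) = (m + 1) + int n * u"
        using vu by (simp add: m_def algebra_simps)
      then have "c (j - \<mu>) = \<omega> powi E (m + 1)" using Eper by (simp add: c_def)
      \<comment> \<open>A quadratic function has linear differences; this produces the powers of
        \<zeta>, of which \<omega> is a square root.\<close>
      also have "E (m + 1) = E m + \<mu> * (int n - 1) + 2 * (- \<mu> * m)"
        by (simp add: E_def algebra_simps)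
      also have "\<omega> powi \<dots> = c j * \<kappa> * (\<omega> powi 2) powi (- \<mu> * m)"
        unfolding c_def \<kappa>_def m_def[symmetric] using \<omega>0
        by (simp only: power_int_add[OF disjI1] power_int_mult[of \<omega> 2] not_False_eq_True)
      also have "\<omega> powi 2 = \<zeta>" using \<omega>2 by simp
      also have "- \<mu> * m = j + int n * (u * j)"
      proof -
        have "- \<mu> * m = - (\<mu> * v) * j" by (simp add: m_def)
        also have "\<dots> = j + int n * (u * j)" unfolding vu by (simp add: algebra_simps)
        finally show ?thesis .
      qed
      also have "\<zeta> powi \<dots> = \<zeta> powi j" by (rule \<zeta>per)
      finally show ?thesis by (simp add: mult_ac)
    qed
  qed
qed

context absval
begin


section \<open>Isomorphisms between the modules and their invariants\<close>

lemma N_module_hom_Spow: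
  assumes n: "n > 0" "n' > 0" and nz: "r \<noteq> 0" "l \<noteq> 0" "r' \<noteq> 0" "l' \<noteq> 0"
    and h: "h \<in> qdm_hom K (N_module K n r \<mu> l) (N_module K n' r' \<mu>' l')"
    and x: "x \<in> K"
  shows "h (Spow r \<mu> l (int i) x) = Spow r' \<mu>' l' (int i) (h x)"
proof (induction i)
  case (Suc i)
  have "h (Spow r \<mu> l (int (Suc i)) x) = h (Spow r \<mu> l 1 (Spow r \<mu> l (int i) x))"
    using nz by simp
  also have "\<dots> = Spow r' \<mu>' l' 1 (h (Spow r \<mu> l (int i) x))"
    using h n x unfolding qdm_hom_def by simp
  also have "\<dots> = Spow r' \<mu>' l' (int (Suc i)) (h x)" using Suc nz by simp
  finally show ?case .
qed simp

lemma N_module_iso_invariants: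
  assumes n: "n > 0" "n' > 0" and nz: "r \<noteq> 0" "l \<noteq> 0" "r' \<noteq> 0" "l' \<noteq> 0"
    and r: "r ^ n = q" "r' ^ n' = q" and cop: "coprime (int n) \<mu>" "coprime (int n') \<mu>'"
    and iso: "qdm_iso K (N_module K n r \<mu> l) (N_module K n' r' \<mu>' l')"
  shows "n = n'" "\<mu> = \<mu>'" "r = r' \<Longrightarrow> \<exists>z k. z ^ n = 1 \<and> l' = l * z * r powi k"
proof -
  obtain h where h: "h \<in> qdm_hom K (N_module K n r \<mu> l) (N_module K n' r' \<mu>' l')"
    and bij: "bij_betw h K K"
    using iso n unfolding qdm_iso_def by auto
  have hlin: "h (fls_compose_power f n * x) = fls_compose_power f n' * h x"
    if "f \<in> K" "x \<in> K" for f x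
    using h n that unfolding qdm_hom_def by simp
  define v where "v = h 1"
  have "v \<noteq> 0"
  proof
    assume "v = 0"
    then have "h 1 = h 0" using hlin[of 0 1] by (simp add: v_def)
    then have "1 = (0::'c fls)"
      using bij_betw_imp_inj_on[OF bij] K_field_closed(1,2) by (metis inj_onD)
    then show False by simp
  qed
  define A where "A = Spow_coeff r \<mu> l (int n)"
  define A' where "A' = Spow_coeff r' \<mu>' l' (int n)"
  have A0: "A \<noteq> 0" "A' \<noteq> 0" using nz by (auto simp: A_def A'_def)
  \<comment> \<open>\<open>1\<close> is an eigenvector of \<Sigma>^n with eigenvalue
    \<open>A x^(-\<mu>)\<close> in the base field, and a morphism preserves such an
    equation.\<close>
  have "Spow r \<mu> l (int n) 1 = fls_compose_power (monomial A (- \<mu>)) n * 1"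
    using n by (simp add: Spow_def A_def mult.commute)
  then have "h (Spow r \<mu> l (int n) 1) = monomial A (int n' * (- \<mu>)) * v"
    using n hlin[of "monomial A (- \<mu>)" 1] by (simp add: v_def)
  moreover have "h (Spow r \<mu> l (int n) 1) = Spow r' \<mu>' l' (int n) v"
    unfolding v_def by (rule N_module_hom_Spow[OF n nz h]) auto
  ultimately have eq: "monomial A (int n' * (- \<mu>)) * v = monomial A' (- \<mu>' * int n) * sigma (r' ^ n) v"
    by (simp add: Spow_def A'_def)
  \<comment> \<open>Comparison of orders, which \<open>sigma\<close> does not change: it identifies
    the two fractions, and both are reduced.\<close>
  then have "fls_subdegree (monomial A (int n' * (- \<mu>)) * v) = fls_subdegree (monomial A' (- \<mu>' * int n) * sigma (r' ^ n) v)"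
    by simp
  then have slope: "int n' * \<mu> = int n * \<mu>'"
    using A0 \<open>v \<noteq> 0\<close> nz by (simp add: mult.commute)
  then have "int n dvd int n' * \<mu>" "int n' dvd int n * \<mu>'" by (simp, simp flip: slope)
  then have "int n dvd int n'" "int n' dvd int n"
    using cop by (simp_all add: coprime_dvd_mult_left_iff)
  then show nn: "n = n'" by (simp add: dvd_antisym)
  then show mm: "\<mu> = \<mu>'" using slope n by simp
  show "\<exists>z k. z ^ n = 1 \<and> l' = l * z * r powi k" if rr: "r = r'"
  proof -
    define d where "d = fls_subdegree v"
    have vd: "v $$ d \<noteq> 0" using \<open>v \<noteq> 0\<close> by (simp add: d_def)
    \<comment> \<open>Comparison of lowest coefficients: the one of \<open>v\<close> has degree
      \<open>d\<close> and is multiplied by \<open>(r ^ n) powi d\<close>, that is, by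
      \<open>q powi d\<close>.\<close>
    have "(monomial A (int n' * (- \<mu>)) * v) $$ (d - int n * \<mu>)
        = (monomial A' (- \<mu>' * int n) * sigma (r' ^ n) v) $$ (d - int n * \<mu>)"
      using eq by simp
    then have "A * v $$ d = A' * ((r ^ n) powi d * v $$ d)"
      using nn mm rr by (simp add: mult.commute)
    then have "A = A' * q powi d" using vd r by simp
    then have "l ^ n = l' ^ n * q powi d"
      using nz nn mm rr by (simp add: A_def A'_def Spow_coeff_def)
    also have "q powi d = (r powi d) ^ n"
      using r(1) by (metis mult.commute power_int_mult power_int_of_nat)
    finally have ln: "l ^ n = (l' * r powi d) ^ n" by (simp add: power_mult_distrib)
    define z where "z = l' * r powi d / l"
    have "z ^ n = 1" using ln nz unfolding z_def power_divide by simp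
    moreover have "l' = l * z * r powi (- d)"
      using nz by (simp add: z_def power_int_minus field_simps)
    ultimately show ?thesis by blast
  qed
qed

text \<open>The map \<open>f(t) \<mapsto> t^j f(\<zeta> t)\<close> joins two sources of
  isomorphisms: a rescaling of the basis changes \<open>l\<close> by a power of \<open>r\<close>,
  and the automorphism of the cover, linear over \<open>K\<close> as \<open>\<zeta> ^ n = 1\<close>,
  changes it by a root of unity.\<close>

lemma N_module_iso_shift:
  assumes n: "n > 0" and r: "r \<noteq> 0" and l: "l \<noteq> 0" and \<zeta>: "\<zeta> ^ n = 1"
  shows "qdm_iso K (N_module K n r \<mu> l)
    (N_module K n r \<mu> (l * \<zeta> powi (- \<mu>) * r powi (- j)))"
proof -
  have \<zeta>0: "\<zeta> \<noteq> 0" using \<zeta> n by (metis power_0_left zero_neq_one less_irrefl)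
  define h where "h f = monomial 1 j * sigma \<zeta> f" for f :: "'c fls"
  have "h \<in> qdm_hom K (N_module K n r \<mu> l)
      (N_module K n r \<mu> (l * \<zeta> powi (- \<mu>) * r powi (- j)))"
    unfolding qdm_hom_def
  proof (intro CollectI conjI ballI)
    fix f m :: "'c fls"
    have "h (fls_compose_power f n * m) = fls_compose_power f n * h m"
      using \<zeta>0 \<zeta> n by (simp add: h_def mult_ac)
    then show "h (f \<odot>\<^bsub>N_module K n r \<mu> l\<^esub> m) =
        f \<odot>\<^bsub>N_module K n r \<mu> (l * \<zeta> powi - \<mu> * r powi - j)\<^esub> h m"
      using n by simp
    have "h (Spow r \<mu> l 1 m) = Spow r \<mu> (l * \<zeta> powi (- \<mu>) * r powi (- j)) 1 (h m)"
    proof -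
      have "r powi (- j) * r powi j = 1" using r by (simp flip: power_int_add)
      then show ?thesis
        unfolding Spow_1 h_def using \<zeta>0 r
        by (simp add: mult.assoc mult.commute[of r] add.commute[of "- \<mu>"] del: power_int_minus)
    qed
    then show "h (Sig (N_module K n r \<mu> l) m) =
        Sig (N_module K n r \<mu> (l * \<zeta> powi - \<mu> * r powi - j)) (h m)"
      using n by simp
  qed (use n in \<open>auto simp: h_def algebra_simps\<close>)
  moreover have \<zeta>inv: "inverse \<zeta> powi (- j) * \<zeta> powi (- j) = 1"
    using \<zeta>0 by (simp flip: power_int_mult_distrib)
  have "bij_betw h K K"
    by (rule bij_betw_byWitness[where f' = "\<lambda>f. sigma (inverse \<zeta>) (monomial 1 (- j) * f)"])
      (use \<zeta>0 \<zeta>inv in \<open>auto simp: h_def\<close>)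
  ultimately show ?thesis unfolding qdm_iso_def using n by auto
qed

lemma N_module_iso_iff:
  assumes n: "n > 0" and r: "r ^ n = q" "r \<noteq> 0" and l: "l \<noteq> 0" "l' \<noteq> 0"
    and cop: "coprime (int n) \<mu>"
  shows "qdm_iso K (N_module K n r \<mu> l) (N_module K n r \<mu> l')
    \<longleftrightarrow> (\<exists>z k. z ^ n = 1 \<and> l' = l * z * r powi k)"
proof
  assume "\<exists>z k. z ^ n = 1 \<and> l' = l * z * r powi k"
  then obtain z k where z: "z ^ n = 1" "l' = l * z * r powi k" by blast
  have z0: "z \<noteq> 0" using z l by auto
  \<comment> \<open>\<mu> is invertible modulo \<open>n\<close>, so raising to the power
    \<open>- \<mu>\<close> permutes the \<open>n\<close>-th roots of unity; \<open>a\<close> serves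
    to write down the preimage of \<open>z\<close>.\<close>
  obtain a where "[\<mu> * a = 1] (mod int n)"
    using cop cong_solve_coprime_int[of \<mu> "int n"] by (auto simp: coprime_commute)
  then have "int n dvd \<mu> * a - 1" by (simp add: cong_iff_dvd_diff)
  then obtain m where "\<mu> * a - 1 = int n * m" by (elim dvdE)
  then have m: "\<mu> * a = 1 + int n * m" by simp
  define \<zeta> where "\<zeta> = z powi (- a)"
  have "\<zeta> powi (- \<mu>) = z powi (\<mu> * a)"
    unfolding \<zeta>_def power_int_mult[symmetric] by (simp add: mult.commute)
  also have "\<dots> = z" unfolding m using z0 z by (simp add: power_int_add power_int_mult)
  finally have "\<zeta> powi (- \<mu>) = z" .
  moreover have "\<zeta> ^ n = 1"
  proof -
    have "\<zeta> ^ n = (z powi int n) powi (- a)"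
      unfolding \<zeta>_def power_int_of_nat[symmetric] power_int_mult[symmetric] by (simp only: mult.commute)
    then show ?thesis using z by simp
  qed
  ultimately show "qdm_iso K (N_module K n r \<mu> l) (N_module K n r \<mu> l')"
    using N_module_iso_shift[OF n r(2) l(1), of \<zeta> \<mu> "- k"] z by simp
qed (use N_module_iso_invariants(3)[OF n n r(2) l(1) r(2) l(2) r(1) r(1) cop cop] in blast)


text \<open>If \<open>\<mu> / n = \<mu>\<^sub>0 / n\<^sub>0\<close> with \<open>n = d n\<^sub>0\<close>, keeping the exponents of \<open>t\<close> divisible by \<open>d\<close> maps
  \<open>Res_n M_(\<mu>,l,n)\<close> onto the module of the reduced fraction.\<close>

lemma N_module_descent:
  fixes r r0 l :: 'c
  assumes alg: "\<And>\<zeta>::'c. \<exists>\<omega>. \<omega> ^ 2 = \<zeta>"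
    and d: "d > 0" and n0: "n0 > 0" and cop: "coprime (int n0) \<mu>0"
    and nz: "r \<noteq> 0" "r0 \<noteq> 0" "l \<noteq> 0" and r: "r ^ (d * n0) = q" "r0 ^ n0 = q"
  obtains l0 h where "l0 \<noteq> 0" "\<And>v. h v $$ 0 = v $$ 0"
    "h \<in> qdm_hom K (N_module K (d * n0) r (int d * \<mu>0) l) (N_module K n0 r0 \<mu>0 l0)"
proof -
  \<comment> \<open>Both \<open>r ^ d\<close> and \<open>r0\<close> are \<open>n0\<close>-th roots
    of \<open>q\<close>, but they may be different ones.\<close>
  define \<zeta> where "\<zeta> = r0 / r ^ d"
  have \<zeta>0: "\<zeta> \<noteq> 0" using nz by (simp add: \<zeta>_def)
  have "q \<noteq> 0" using r(2) nz(2) by auto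
  then have "\<zeta> ^ n0 = 1" using r by (simp add: \<zeta>_def power_divide flip: power_mult)
  then obtain c \<kappa> \<omega> where \<kappa>: "\<kappa> \<noteq> 0" and c0: "c 0 = 1" and cper: "\<And>j. c (j + int n0) = c j"
    and crec: "\<And>j. c (j - \<mu>0) = \<kappa> * \<zeta> powi j * c j" and c\<omega>: "\<And>j. \<exists>e. c j = \<omega> powi e"
    and \<omega>: "\<omega> ^ (2 * n0) = 1"
    using root_change_cocycle[OF alg n0 cop] by metis
  \<comment> \<open>All values of \<open>c\<close> are powers of \<omega> and so have norm one: the
    twist preserves convergence.\<close>
  have N\<omega>: "N \<omega> = 1" using N_root_of_unit[OF \<omega>] n0 by simp
  then have \<omega>0: "\<omega> \<noteq> 0" by auto
  have cN: "N (c j) = 1" for j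
    using c\<omega>[of j] N\<omega> by (auto simp: N_power_int)
  have cnz: "c j \<noteq> 0" for j using c\<omega>[of j] \<omega>0 by auto
  have cper': "c (k - int n0 * m) = c k" for k m
  proof -
    have *: "c (k + int n0 * int i) = c k" for k i
    proof (induction i)
      case (Suc i)
      then show ?case using cper[of "k + int n0 * int i"] by (simp add: algebra_simps)
    qed simp
    show ?thesis
      using *[of k "nat (- m)"] *[of "k - int n0 * m" "nat m"] by (cases "m \<ge> 0") auto
  qed
  define l0 where "l0 = l * \<kappa>"
  define h where "h f = coeff_mult c (section_fls d 0 f)" for f :: "'c fls"
  have h_nth: "h f $$ k = c k * f $$ (int d * k)" for f k
    using d by (simp add: h_def section_fls_nth)
  have hK: "h f \<in> K" if "f \<in> K" for f
    unfolding h_def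
    by (rule K_field_reindex[OF K_field_section[OF that, of 0 d], of _ int 1]) (use d cN in \<open>auto simp: N_mult\<close>)
  have hsm: "h (fls_compose_power f (d * n0) * m) = fls_compose_power f n0 * h m" for f m
  proof -
    have "section_fls d 0 (fls_compose_power f (d * n0) * m) = fls_compose_power f n0 * section_fls d 0 m"
      using section_compose_power_mult[OF d d, of "fls_compose_power f n0" m] d n0
      by (simp add: compose_power_compose_power)
    then show ?thesis unfolding h_def
      using n0 cper' by (subst coeff_mult_mult[symmetric])
        (auto simp: cnz fls_nth_compose_power split: if_splits elim!: dvdE)
  qed
  have hS: "h (Spow r (int d * \<mu>0) l 1 f) = Spow r0 \<mu>0 l0 1 (h f)" for f
  proof (rule fls_eqI)
    fix k
    \<comment> \<open>The recursion for \<open>c\<close> exchanges \<open>r ^ d\<close> for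
      \<open>r0\<close>, at the cost of the constant \<kappa> that enters \<open>l0\<close>.\<close>
    have ck: "c k = \<kappa> * \<zeta> powi (k + \<mu>0) * c (k + \<mu>0)" using crec[of "k + \<mu>0"] by simp
    have "c k * r powi (int d * (k + \<mu>0)) = \<kappa> * (\<zeta> powi (k + \<mu>0) * r powi (int d * (k + \<mu>0))) * c (k + \<mu>0)"
      unfolding ck by (simp only: mult_ac)
    also have "\<zeta> powi (k + \<mu>0) * r powi (int d * (k + \<mu>0)) = r0 powi (k + \<mu>0)"
      using nz by (simp add: \<zeta>_def power_int_divide_distrib power_int_mult)
    finally have "l * (c k * r powi (int d * (k + \<mu>0))) * f $$ (int d * (k + \<mu>0))
        = l * (\<kappa> * r0 powi (k + \<mu>0) * c (k + \<mu>0)) * f $$ (int d * (k + \<mu>0))" by simp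
    moreover have "int d * k + int d * \<mu>0 = int d * (k + \<mu>0)" by (simp add: distrib_left)
    ultimately show "h (Spow r (int d * \<mu>0) l 1 f) $$ k = Spow r0 \<mu>0 l0 1 (h f) $$ k"
      by (simp add: h_nth Spow_1 l0_def mult_ac)
  qed
  have "h \<in> qdm_hom K (N_module K (d * n0) r (int d * \<mu>0) l) (N_module K n0 r0 \<mu>0 l0)"
    unfolding qdm_hom_def
  proof (intro CollectI conjI ballI)
    show "h (x \<oplus>\<^bsub>N_module K (d * n0) r (int d * \<mu>0) l\<^esub> y)
        = h x \<oplus>\<^bsub>N_module K n0 r0 \<mu>0 l0\<^esub> h y" for x y
      using d n0 by (intro fls_eqI) (simp add: h_nth distrib_left)
  qed (use d n0 hK hsm hS in simp_all)
  then show ?thesis using nz \<kappa> c0 by (intro that[of l0 h]) (auto simp: l0_def h_nth)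
qed

end

section \<open>The module of an operator\<close>

lemma skew_laurent_simps:
  "P \<in> carrier (skew_laurent F q) \<longleftrightarrow> finite {i. P i \<noteq> 0} \<and> range P \<subseteq> F"
  "\<zero>\<^bsub>skew_laurent F q\<^esub> = (\<lambda>k. 0)"
  "P \<oplus>\<^bsub>skew_laurent F q\<^esub> Q = (\<lambda>k. P k + Q k)"
  "P \<otimes>\<^bsub>skew_laurent F q\<^esub> Q = (\<lambda>k. \<Sum>i | P i \<noteq> 0. P i * sigma (q powi i) (Q (k - i)))"
  by (auto simp: skew_laurent_def)

lemma skew_mult_superset:
  assumes "finite A" "{i. P i \<noteq> 0} \<subseteq> A"
  shows "(P \<otimes>\<^bsub>skew_laurent F q\<^esub> Q) k = (\<Sum>i\<in>A. P i * sigma (q powi i) (Q (k - i)))"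
  unfolding skew_laurent_simps using assms by (intro sum.mono_neutral_left) auto

lemma skew_mult_add_left:
  assumes "finite {i. P i \<noteq> 0}" "finite {i. P' i \<noteq> 0}"
  shows "(\<lambda>k. P k + P' k) \<otimes>\<^bsub>skew_laurent F q\<^esub> Q
    = (\<lambda>k. (P \<otimes>\<^bsub>skew_laurent F q\<^esub> Q) k + (P' \<otimes>\<^bsub>skew_laurent F q\<^esub> Q) k)"
proof
  fix k
  let ?A = "{i. P i \<noteq> 0} \<union> {i. P' i \<noteq> 0}"
  have A: "finite ?A" "{i. P i \<noteq> 0} \<subseteq> ?A" "{i. P' i \<noteq> 0} \<subseteq> ?A" "{i. P i + P' i \<noteq> 0} \<subseteq> ?A"
    using assms by auto
  show "((\<lambda>k. P k + P' k) \<otimes>\<^bsub>skew_laurent F q\<^esub> Q) k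
    = (P \<otimes>\<^bsub>skew_laurent F q\<^esub> Q) k + (P' \<otimes>\<^bsub>skew_laurent F q\<^esub> Q) k"
    unfolding skew_mult_superset[OF A(1,2)] skew_mult_superset[OF A(1,3)]
      skew_mult_superset[OF A(1), of "\<lambda>k. P k + P' k", OF A(4)]
    by (simp add: distrib_right sum.distrib)
qed

lemma skew_monom_mult: "(skew_monom f j \<otimes>\<^bsub>skew_laurent F q\<^esub> Q) k = f * sigma (q powi j) (Q (k - j))"
  by (subst skew_mult_superset[of "{j}"]) (auto simp: skew_monom_def)

lemma skew_mult_support:
  assumes "(P \<otimes>\<^bsub>skew_laurent F q\<^esub> Q) k \<noteq> 0"
  obtains i j where "P i \<noteq> 0" "Q j \<noteq> 0" "k = i + j"
proof -
  obtain i where i: "P i \<noteq> 0" "P i * sigma (q powi i) (Q (k - i)) \<noteq> 0"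
    using assms unfolding skew_laurent_simps by (metis (mono_tags, lifting) mem_Collect_eq sum.neutral)
  then have "Q (k - i) \<noteq> 0" by auto
  then show ?thesis using i(1) by (intro that[of i "k - i"]) auto
qed

lemma skew_mult_finite_support:
  assumes "finite {i. P i \<noteq> 0}" "finite {i. Q i \<noteq> 0}"
  shows "finite {i. (P \<otimes>\<^bsub>skew_laurent F q\<^esub> Q) i \<noteq> 0}"
proof (rule finite_subset)
  show "finite ((\<lambda>(i, j). i + j) ` ({i. P i \<noteq> 0} \<times> {i. Q i \<noteq> 0}))" using assms by simp
  show "{i. (P \<otimes>\<^bsub>skew_laurent F q\<^esub> Q) i \<noteq> 0} \<subseteq> (\<lambda>(i, j). i + j) ` ({i. P i \<noteq> 0} \<times> {i. Q i \<noteq> 0})"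
    by (auto elim!: skew_mult_support)
qed

lemma operator_module_simps:
  "carrier (operator_module F q L)
    = (\<lambda>a. {\<lambda>k. h k + a k |h. h \<in> left_ideal_gen F q L}) ` carrier (skew_laurent F q)"
  "A \<oplus>\<^bsub>operator_module F q L\<^esub> B = {\<lambda>k. x k + y k |x y. x \<in> A \<and> y \<in> B}"
  "f \<odot>\<^bsub>operator_module F q L\<^esub> A
    = {\<lambda>k. h k + (skew_monom f 0 \<otimes>\<^bsub>skew_laurent F q\<^esub> P) k |h P. h \<in> left_ideal_gen F q L \<and> P \<in> A}"
  "Sig (operator_module F q L) A
    = {\<lambda>k. h k + (skew_monom 1 1 \<otimes>\<^bsub>skew_laurent F q\<^esub> P) k |h P. h \<in> left_ideal_gen F q L \<and> P \<in> A}"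
  by (auto simp: operator_module_def Let_def A_RCOSETS_def' a_r_coset_def' set_add_def' skew_laurent_def)

text \<open>The action of the skew ring on the elements of \<open>N_module\<close>: \<sigma> acts as
  \<open>Sig\<close>, and a coefficient \<open>a(x)\<close> as multiplication by
  \<open>a(t^n)\<close>.\<close>

definition act :: "nat \<Rightarrow> 'c::field \<Rightarrow> int \<Rightarrow> 'c \<Rightarrow> (int \<Rightarrow> 'c fls) \<Rightarrow> 'c fls \<Rightarrow> 'c fls" where
  "act n r \<mu> l P f = (\<Sum>i | P i \<noteq> 0. fls_compose_power (P i) n * Spow r \<mu> l i f)"

lemma act_superset:
  assumes "finite A" "{i. P i \<noteq> 0} \<subseteq> A"
  shows "act n r \<mu> l P f = (\<Sum>i\<in>A. fls_compose_power (P i) n * Spow r \<mu> l i f)"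
  unfolding act_def using assms by (intro sum.mono_neutral_left) auto

lemma act_zero [simp]: "act n r \<mu> l (\<lambda>k. 0) f = 0"
  by (simp add: act_def)

lemma act_add:
  assumes "finite {i. P i \<noteq> 0}" "finite {i. Q i \<noteq> 0}"
  shows "act n r \<mu> l (\<lambda>k. P k + Q k) f = act n r \<mu> l P f + act n r \<mu> l Q f"
proof -
  let ?A = "{i. P i \<noteq> 0} \<union> {i. Q i \<noteq> 0}"
  have A: "finite ?A" "{i. P i \<noteq> 0} \<subseteq> ?A" "{i. Q i \<noteq> 0} \<subseteq> ?A" "{i. P i + Q i \<noteq> 0} \<subseteq> ?A"
    using assms by auto
  show ?thesis
    unfolding act_superset[OF A(1,2)] act_superset[OF A(1,3)] act_superset[OF A(1), of "\<lambda>k. P k + Q k", OF A(4)]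
    by (simp add: distrib_right sum.distrib)
qed

lemma act_monom: "act n r \<mu> l (skew_monom f i) g = fls_compose_power f n * Spow r \<mu> l i g"
  by (subst act_superset[of "{i}"]) (auto simp: skew_monom_def)

text \<open>After regrouping along \<open>k = i + j\<close> this is the semilinearity of
  \<open>Spow\<close>; \<open>r ^ n = q\<close> makes \<open>sigma r\<close> act as
  \<open>sigma q\<close> on series in \<open>t^n\<close>.\<close>

lemma act_mult:
  assumes n: "n > 0" and r: "r ^ n = q" "r \<noteq> 0" and l: "l \<noteq> 0"
    and P: "finite {i. P i \<noteq> 0}" and Q: "finite {i. Q i \<noteq> 0}"
  shows "act n r \<mu> l (P \<otimes>\<^bsub>skew_laurent F q\<^esub> Q) f = act n r \<mu> l P (act n r \<mu> l Q f)"
proof -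
  let ?A = "{i. P i \<noteq> 0}" and ?B = "{i. Q i \<noteq> 0}"
  define C where "C = (\<lambda>(i, j). i + j) ` (?A \<times> ?B)"
  have C: "finite C" "{i. (P \<otimes>\<^bsub>skew_laurent F q\<^esub> Q) i \<noteq> 0} \<subseteq> C"
    using P Q by (auto simp: C_def elim!: skew_mult_support)
  have "act n r \<mu> l (P \<otimes>\<^bsub>skew_laurent F q\<^esub> Q) f
      = (\<Sum>k\<in>C. \<Sum>i\<in>?A. fls_compose_power (P i * sigma (q powi i) (Q (k - i))) n * Spow r \<mu> l k f)"
    unfolding act_superset[OF C] unfolding skew_laurent_simps(4) compose_power_sum sum_distrib_right ..
  also have "\<dots> = (\<Sum>i\<in>?A. \<Sum>k\<in>C. fls_compose_power (P i * sigma (q powi i) (Q (k - i))) n * Spow r \<mu> l k f)"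
    by (rule sum.swap)
  also have "\<dots> = (\<Sum>i\<in>?A. \<Sum>j\<in>?B. fls_compose_power (P i * sigma (q powi i) (Q j)) n * Spow r \<mu> l (i + j) f)"
  proof (rule sum.cong)
    fix i assume i: "i \<in> ?A"
    have "(\<Sum>k\<in>C. fls_compose_power (P i * sigma (q powi i) (Q (k - i))) n * Spow r \<mu> l k f)
        = (\<Sum>k\<in>(\<lambda>j. i + j) ` ?B. fls_compose_power (P i * sigma (q powi i) (Q (k - i))) n * Spow r \<mu> l k f)"
    proof (rule sum.mono_neutral_right)
      show "(\<lambda>j. i + j) ` ?B \<subseteq> C" using i by (auto simp: C_def)
      show "\<forall>k\<in>C - (\<lambda>j. i + j) ` ?B. fls_compose_power (P i * sigma (q powi i) (Q (k - i))) n * Spow r \<mu> l k f = 0"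
      proof
        fix k assume k: "k \<in> C - (\<lambda>j. i + j) ` ?B"
        then have "Q (k - i) = 0" by (auto simp: image_iff dest: spec[of _ "k - i"])
        then show "fls_compose_power (P i * sigma (q powi i) (Q (k - i))) n * Spow r \<mu> l k f = 0" by simp
      qed
    qed (use C in simp)
    also have "\<dots> = (\<Sum>j\<in>?B. fls_compose_power (P i * sigma (q powi i) (Q j)) n * Spow r \<mu> l (i + j) f)"
      by (subst sum.reindex) (auto simp: inj_on_def)
    finally show "(\<Sum>k\<in>C. fls_compose_power (P i * sigma (q powi i) (Q (k - i))) n * Spow r \<mu> l k f)
      = (\<Sum>j\<in>?B. fls_compose_power (P i * sigma (q powi i) (Q j)) n * Spow r \<mu> l (i + j) f)" .
  qed simp
  also have "\<dots> = (\<Sum>i\<in>?A. fls_compose_power (P i) n * Spow r \<mu> l i (act n r \<mu> l Q f))"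
  proof (rule sum.cong)
    fix i
    have ri: "(r powi i) ^ n = q powi i"
      unfolding r(1)[symmetric] power_int_of_nat[symmetric] power_int_mult[symmetric] by (simp only: mult.commute)
    show "(\<Sum>j\<in>?B. fls_compose_power (P i * sigma (q powi i) (Q j)) n * Spow r \<mu> l (i + j) f)
      = fls_compose_power (P i) n * Spow r \<mu> l i (act n r \<mu> l Q f)"
      unfolding act_def Spow_sum sum_distrib_left
      using n r l by (intro sum.cong) (simp_all add: Spow_smult sigma_compose_power[OF n ri] mult.assoc)
  qed simp
  finally show ?thesis by (simp add: act_def)
qed

lemma skew_of_poly_support: "{i. skew_of_poly L i \<noteq> 0} \<subseteq> int ` {..degree L}"
proof
  fix i assume i: "i \<in> {i. skew_of_poly L i \<noteq> 0}"
  then have "i = int (nat i)" "nat i \<le> degree L"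
    by (auto simp: skew_of_poly_def le_degree split: if_splits)
  then show "i \<in> int ` {..degree L}" by blast
qed

lemma act_poly:
  "act n r \<mu> l (skew_of_poly L) f
    = (\<Sum>i\<le>degree L. fls_compose_power (coeff L i) n * Spow r \<mu> l (int i) f)"
proof -
  have "act n r \<mu> l (skew_of_poly L) f
      = (\<Sum>i\<in>int ` {..degree L}. fls_compose_power (skew_of_poly L i) n * Spow r \<mu> l i f)"
    by (rule act_superset[OF _ skew_of_poly_support]) simp
  then show ?thesis by (simp add: sum.reindex skew_of_poly_def)
qed

context absval
begin

abbreviation "D q \<equiv> skew_laurent K q"
abbreviation "I q L \<equiv> left_ideal_gen K q L"

lemma skew_carrier_closed:
  "(\<lambda>k. 0) \<in> carrier (D q)"
  "f \<in> K \<Longrightarrow> skew_monom f i \<in> carrier (D q)"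
  "P \<in> carrier (D q) \<Longrightarrow> Q \<in> carrier (D q) \<Longrightarrow> (\<lambda>k. P k + Q k) \<in> carrier (D q)"
  "P \<in> carrier (D q) \<Longrightarrow> (\<lambda>k. - P k) \<in> carrier (D q)"
  "P \<in> carrier (D q) \<Longrightarrow> Q \<in> carrier (D q) \<Longrightarrow> P \<otimes>\<^bsub>D q\<^esub> Q \<in> carrier (D q)"
proof -
  show "(\<lambda>k. 0) \<in> carrier (D q)" by (auto simp: skew_laurent_simps)
  show "f \<in> K \<Longrightarrow> skew_monom f i \<in> carrier (D q)"
    by (auto simp: skew_laurent_simps skew_monom_def)
  show "(\<lambda>k. P k + Q k) \<in> carrier (D q)" if "P \<in> carrier (D q)" "Q \<in> carrier (D q)"
    using that unfolding skew_laurent_simps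
    by (auto intro: rev_finite_subset[of "{i. P i \<noteq> 0} \<union> {i. Q i \<noteq> 0}"])
  show "P \<in> carrier (D q) \<Longrightarrow> (\<lambda>k. - P k) \<in> carrier (D q)"
    by (auto simp: skew_laurent_simps)
  show "P \<otimes>\<^bsub>D q\<^esub> Q \<in> carrier (D q)" if P: "P \<in> carrier (D q)" and Q: "Q \<in> carrier (D q)"
  proof -
    have "(P \<otimes>\<^bsub>D q\<^esub> Q) k \<in> K" for k
      unfolding skew_laurent_simps(4)
    proof (rule K_field_sum)
      fix i
      have "P i \<in> K" "Q (k - i) \<in> K" using P Q by (auto simp: skew_laurent_simps)
      then show "P i * sigma (q powi i) (Q (k - i)) \<in> K" by (intro K_field_closed)
    qed
    then show ?thesis
      using P Q skew_mult_finite_support unfolding skew_laurent_simps(1) by blast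
  qed
qed

lemma act_closed: "P \<in> carrier (D q) \<Longrightarrow> f \<in> K \<Longrightarrow> act n r \<mu> l P f \<in> K"
  unfolding act_def
  by (rule K_field_sum) (auto simp: skew_laurent_simps intro!: K_field_closed(5) K_field_compose_power)

section \<open>Morphisms given by a solution \<open>v\<close> of the operator
  \<open>L\<close>\<close>

context
  fixes q :: 'c and n :: nat and r l :: 'c and \<mu> :: int and L :: "'c fls poly" and v :: "'c fls"
  assumes n: "n > 0" and r: "r ^ n = q" "r \<noteq> 0" and l: "l \<noteq> 0"
    and L: "\<And>i. coeff L i \<in> K" and v: "v \<in> K"
    and Lv: "(\<Sum>i\<le>degree L. fls_compose_power (coeff L i) n * Spow r \<mu> l (int i) v) = 0"
begin

lemma skew_of_poly_carrier: "skew_of_poly L \<in> carrier (D q)"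
proof -
  have "finite {i. skew_of_poly L i \<noteq> 0}" by (rule finite_subset[OF skew_of_poly_support]) simp
  then show ?thesis using L by (auto simp: skew_laurent_simps skew_of_poly_def)
qed

text \<open>\<open>L\<close> kills \<open>v\<close>, hence so does every left multiple of
  \<open>L\<close>: the value of \<open>P\<close> at \<open>v\<close> depends only on the coset of
  \<open>P\<close>.\<close>

lemma left_idealD:
  assumes "h \<in> I q L"
  shows "h \<in> carrier (D q)" "act n r \<mu> l h v = 0"
proof -
  obtain P where P: "P \<in> carrier (D q)" "h = P \<otimes>\<^bsub>D q\<^esub> skew_of_poly L"
    using assms unfolding left_ideal_gen_def by blast
  show "h \<in> carrier (D q)" unfolding P(2) using P(1) skew_of_poly_carrier by (rule skew_carrier_closed)
  have fin: "finite {i. P i \<noteq> 0}" "finite {i. skew_of_poly L i \<noteq> 0}"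
    using P skew_of_poly_carrier by (auto simp: skew_laurent_simps)
  show "act n r \<mu> l h v = 0"
    unfolding P(2) act_mult[OF n r l fin] act_poly Lv by (simp add: act_def)
qed

lemma zero_in_left_ideal: "(\<lambda>k. 0) \<in> I q L"
  unfolding left_ideal_gen_def
  by (intro CollectI exI[of _ "\<lambda>k. 0"]) (auto simp: skew_laurent_simps)

lemma act_add_carrier:
  "P \<in> carrier (D q) \<Longrightarrow> Q \<in> carrier (D q) \<Longrightarrow>
    act n r \<mu> l (\<lambda>k. P k + Q k) v = act n r \<mu> l P v + act n r \<mu> l Q v"
  by (rule act_add) (auto simp: skew_laurent_simps)

lemma act_monom_mult:
  "f \<in> K \<Longrightarrow> P \<in> carrier (D q) \<Longrightarrow>
    act n r \<mu> l (skew_monom f i \<otimes>\<^bsub>D q\<^esub> P) v = fls_compose_power f n * Spow r \<mu> l i (act n r \<mu> l P v)"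
  by (subst act_mult[OF n r l])
    (use skew_carrier_closed(2)[of f i q] in \<open>auto simp: skew_laurent_simps act_monom\<close>)

lemma operator_module_cosetD:
  assumes "A \<in> carrier (operator_module K q L)"
  obtains w where "A \<noteq> {}" "\<And>P. P \<in> A \<Longrightarrow> P \<in> carrier (D q) \<and> act n r \<mu> l P v = w"
proof -
  obtain a where a: "a \<in> carrier (D q)" and A: "A = {\<lambda>k. h k + a k |h. h \<in> I q L}"
    using assms unfolding operator_module_simps by blast
  show ?thesis
  proof (rule that[of "act n r \<mu> l a v"])
    show "A \<noteq> {}" using zero_in_left_ideal unfolding A by blast
    show "P \<in> carrier (D q) \<and> act n r \<mu> l P v = act n r \<mu> l a v" if P: "P \<in> A" for P
    proof -
      obtain h where h: "h \<in> I q L" "P = (\<lambda>k. h k + a k)" using P unfolding A by blast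
      show ?thesis unfolding h(2)
        using left_idealD[OF h(1)] a by (simp add: act_add_carrier skew_carrier_closed)
    qed
  qed
qed

text \<open>The coset of \<open>P\<close> goes to the value of \<open>P\<close> at \<open>v\<close>.
  The coset of the unit goes to \<open>v\<close>, so the morphism is nonzero whenever
  \<open>v\<close> is.\<close>

lemma operator_module_hom:
  obtains \<phi> m where "\<phi> \<in> qdm_hom K (operator_module K q L) (N_module K n r \<mu> l)"
    "m \<in> carrier (operator_module K q L)" "\<phi> m = v"
proof -
  let ?O = "operator_module K q L"
  define \<phi> where "\<phi> A = act n r \<mu> l (SOME P. P \<in> A) v" for A
  have \<phi>I: "\<phi> A = w" if "A \<noteq> {}" "\<And>P. P \<in> A \<Longrightarrow> act n r \<mu> l P v = w" for A w
    using that some_in_eq[of A] by (simp add: \<phi>_def)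
  have coset: "A \<noteq> {} \<and> (\<forall>P\<in>A. P \<in> carrier (D q) \<and> act n r \<mu> l P v = \<phi> A)" if A: "A \<in> carrier ?O" for A
  proof -
    obtain w where w: "A \<noteq> {}" "\<And>P. P \<in> A \<Longrightarrow> P \<in> carrier (D q) \<and> act n r \<mu> l P v = w"
      using operator_module_cosetD[OF A] by blast
    then have "\<phi> A = w" by (intro \<phi>I) auto
    then show ?thesis using w by simp
  qed
  have \<phi>K: "\<phi> A \<in> K" if A: "A \<in> carrier ?O" for A
  proof -
    obtain P where P: "P \<in> carrier (D q)" "act n r \<mu> l P v = \<phi> A" using coset[OF A] by blast
    show ?thesis using act_closed[OF P(1) v, of n r \<mu> l] unfolding P(2) .
  qed
  have \<phi>add: "\<phi> (A \<oplus>\<^bsub>?O\<^esub> B) = \<phi> A + \<phi> B" if A: "A \<in> carrier ?O" and B: "B \<in> carrier ?O" for A B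
  proof (rule \<phi>I)
    show "A \<oplus>\<^bsub>?O\<^esub> B \<noteq> {}" using coset[OF A] coset[OF B] unfolding operator_module_simps by blast
    fix P assume "P \<in> A \<oplus>\<^bsub>?O\<^esub> B"
    then obtain x y where "x \<in> A" "y \<in> B" "P = (\<lambda>k. x k + y k)" unfolding operator_module_simps by blast
    then show "act n r \<mu> l P v = \<phi> A + \<phi> B" using coset[OF A] coset[OF B] by (simp add: act_add_carrier)
  qed
  have \<phi>mon: "\<phi> {\<lambda>k. h k + (skew_monom f i \<otimes>\<^bsub>D q\<^esub> P) k |h P. h \<in> I q L \<and> P \<in> A}
      = fls_compose_power f n * Spow r \<mu> l i (\<phi> A)" if A: "A \<in> carrier ?O" and f: "f \<in> K" for A f i
  proof (rule \<phi>I)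
    show "{\<lambda>k. h k + (skew_monom f i \<otimes>\<^bsub>D q\<^esub> P) k |h P. h \<in> I q L \<and> P \<in> A} \<noteq> {}"
      using coset[OF A] zero_in_left_ideal by blast
    fix P assume "P \<in> {\<lambda>k. h k + (skew_monom f i \<otimes>\<^bsub>D q\<^esub> P) k |h P. h \<in> I q L \<and> P \<in> A}"
    then obtain h Q where h: "h \<in> I q L" "Q \<in> A" and P: "P = (\<lambda>k. h k + (skew_monom f i \<otimes>\<^bsub>D q\<^esub> Q) k)"
      by blast
    have Q: "Q \<in> carrier (D q)" "act n r \<mu> l Q v = \<phi> A" using coset[OF A] h by auto
    show "act n r \<mu> l P v = fls_compose_power f n * Spow r \<mu> l i (\<phi> A)"
      unfolding P
      by (subst act_add_carrier)
        (use left_idealD[OF h(1)] f Q in \<open>auto simp: act_monom_mult intro: skew_carrier_closed\<close>)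
  qed
  have "\<phi> \<in> qdm_hom K ?O (N_module K n r \<mu> l)"
    unfolding qdm_hom_def
  proof (intro CollectI conjI ballI)
    fix f A assume f: "f \<in> K" and A: "A \<in> carrier ?O"
    show "\<phi> (f \<odot>\<^bsub>?O\<^esub> A) = f \<odot>\<^bsub>N_module K n r \<mu> l\<^esub> \<phi> A"
      unfolding operator_module_simps(3) \<phi>mon[OF A f] using n by simp
  next
    fix A assume A: "A \<in> carrier ?O"
    show "\<phi> (Sig ?O A) = Sig (N_module K n r \<mu> l) (\<phi> A)"
      unfolding operator_module_simps(4) \<phi>mon[OF A K_field_closed(2)] using n by simp
  qed (use n \<phi>K \<phi>add in auto)
  moreover define m where "m = {\<lambda>k. h k + skew_monom 1 0 k |h. h \<in> I q L}"
  have mc: "m \<in> carrier ?O"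
    unfolding operator_module_simps m_def by (rule imageI) (intro skew_carrier_closed(2) K_field_closed)
  moreover have "\<phi> m = v"
  proof -
    have "skew_monom 1 0 \<in> m" unfolding m_def using zero_in_left_ideal by force
    then have "\<phi> m = act n r \<mu> l (skew_monom 1 0) v" using coset[OF mc] by simp
    then show ?thesis using n by (simp add: act_monom)
  qed
  ultimately show ?thesis using that by blast
qed

text \<open>The inverse of the preceding morphism: \<open>w\<close> goes to the set of all
  \<open>P\<close> with value \<open>w\<close> at \<open>v\<close>. This set is nonempty as
  \<open>v\<close> generates, and a single coset as the annihilator of \<open>v\<close> is the
  ideal.\<close>

lemma N_module_iso_operator_module:
  assumes ker: "\<And>P. P \<in> carrier (D q) \<Longrightarrow> act n r \<mu> l P v = 0 \<Longrightarrow> P \<in> I q L"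
    and surj: "\<And>w. w \<in> K \<Longrightarrow> \<exists>P\<in>carrier (D q). act n r \<mu> l P v = w"
  shows "qdm_iso K (N_module K n r \<mu> l) (operator_module K q L)"
proof -
  let ?O = "operator_module K q L"
  define h where "h w = {P \<in> carrier (D q). act n r \<mu> l P v = w}" for w
  have diff: "(\<lambda>k. P k - Q k) \<in> carrier (D q) \<and> act n r \<mu> l (\<lambda>k. P k - Q k) v = act n r \<mu> l P v - act n r \<mu> l Q v"
    if "P \<in> carrier (D q)" "Q \<in> carrier (D q)" for P Q
  proof -
    have R: "(\<lambda>k. P k + - Q k) \<in> carrier (D q)" using that by (intro skew_carrier_closed)
    then have "act n r \<mu> l (\<lambda>k. (P k + - Q k) + Q k) v = act n r \<mu> l (\<lambda>k. P k + - Q k) v + act n r \<mu> l Q v"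
      using that(2) by (rule act_add_carrier)
    then show ?thesis using R by simp
  qed
  have split: "\<exists>x\<in>I q L. P = (\<lambda>k. x k + Q k)"
    if "P \<in> carrier (D q)" "Q \<in> carrier (D q)" "act n r \<mu> l P v = act n r \<mu> l Q v" for P Q
    by (rule bexI[of _ "\<lambda>k. P k - Q k"]) (use diff[OF that(1,2)] that(3) ker in auto)
  have coset: "{\<lambda>k. x k + a k |x. x \<in> I q L} = h (act n r \<mu> l a v)" if a: "a \<in> carrier (D q)" for a
  proof (intro equalityI subsetI)
    fix P assume "P \<in> {\<lambda>k. x k + a k |x. x \<in> I q L}"
    then obtain x where "x \<in> I q L" "P = (\<lambda>k. x k + a k)" by blast
    then show "P \<in> h (act n r \<mu> l a v)"
      using left_idealD a by (auto simp: h_def act_add_carrier skew_carrier_closed)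
  next
    fix P assume "P \<in> h (act n r \<mu> l a v)"
    then show "P \<in> {\<lambda>k. x k + a k |x. x \<in> I q L}" using split[OF _ a] unfolding h_def by blast
  qed
  have carrier_eq: "carrier ?O = h ` K"
  proof (intro equalityI subsetI)
    fix A assume "A \<in> carrier ?O"
    then show "A \<in> h ` K"
      unfolding operator_module_simps using coset act_closed[OF _ v] by blast
  next
    fix A assume "A \<in> h ` K"
    then obtain a where "a \<in> carrier (D q)" "A = h (act n r \<mu> l a v)" using surj by blast
    then show "A \<in> carrier ?O" unfolding operator_module_simps using coset by blast
  qed
  have inj: "inj_on h K"
  proof (rule inj_onI)
    fix x y assume "x \<in> K" "h x = h y"
    then show "x = y" using surj[of x] unfolding h_def by blast
  qed
  have hmon: "h (fls_compose_power f n * Spow r \<mu> l i w)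
      = {\<lambda>k. x k + (skew_monom f i \<otimes>\<^bsub>D q\<^esub> P) k |x P. x \<in> I q L \<and> P \<in> h w}"
    if w: "w \<in> K" and f: "f \<in> K" for f i w
  proof (intro equalityI subsetI)
    fix P assume P: "P \<in> h (fls_compose_power f n * Spow r \<mu> l i w)"
    obtain Q where Q: "Q \<in> carrier (D q)" "act n r \<mu> l Q v = w" using surj[OF w] by blast
    have "skew_monom f i \<otimes>\<^bsub>D q\<^esub> Q \<in> carrier (D q)" using f Q by (intro skew_carrier_closed)
    moreover have "act n r \<mu> l (skew_monom f i \<otimes>\<^bsub>D q\<^esub> Q) v = act n r \<mu> l P v"
      using P Q f by (simp add: h_def act_monom_mult)
    ultimately obtain x where "x \<in> I q L" "P = (\<lambda>k. x k + (skew_monom f i \<otimes>\<^bsub>D q\<^esub> Q) k)"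
      using split[of P "skew_monom f i \<otimes>\<^bsub>D q\<^esub> Q"] P unfolding h_def by auto
    then show "P \<in> {\<lambda>k. x k + (skew_monom f i \<otimes>\<^bsub>D q\<^esub> P) k |x P. x \<in> I q L \<and> P \<in> h w}"
      using Q unfolding h_def by blast
  next
    fix P assume "P \<in> {\<lambda>k. x k + (skew_monom f i \<otimes>\<^bsub>D q\<^esub> P) k |x P. x \<in> I q L \<and> P \<in> h w}"
    then obtain x Q where x: "x \<in> I q L" and Q: "Q \<in> carrier (D q)" "act n r \<mu> l Q v = w"
      and P: "P = (\<lambda>k. x k + (skew_monom f i \<otimes>\<^bsub>D q\<^esub> Q) k)"
      unfolding h_def by blast
    have mQ: "skew_monom f i \<otimes>\<^bsub>D q\<^esub> Q \<in> carrier (D q)" using f Q by (intro skew_carrier_closed)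
    show "P \<in> h (fls_compose_power f n * Spow r \<mu> l i w)"
      unfolding P h_def using left_idealD[OF x] mQ Q f
      by (simp add: act_add_carrier act_monom_mult skew_carrier_closed(3))
  qed
  have hadd: "h (w + w') = {\<lambda>k. x k + y k |x y. x \<in> h w \<and> y \<in> h w'}"
    if w: "w \<in> K" and w': "w' \<in> K" for w w'
  proof (intro equalityI subsetI)
    fix P assume P: "P \<in> h (w + w')"
    obtain Q where Q: "Q \<in> carrier (D q)" "act n r \<mu> l Q v = w'" using surj[OF w'] by blast
    have "(\<lambda>k. P k - Q k) \<in> h w" "Q \<in> h w'" using P Q diff[of P Q] by (auto simp: h_def)
    then show "P \<in> {\<lambda>k. x k + y k |x y. x \<in> h w \<and> y \<in> h w'}"
      by (intro CollectI exI[of _ "\<lambda>k. P k - Q k"] exI[of _ Q]) simp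
  next
    fix P assume "P \<in> {\<lambda>k. x k + y k |x y. x \<in> h w \<and> y \<in> h w'}"
    then obtain x y where "x \<in> h w" "y \<in> h w'" "P = (\<lambda>k. x k + y k)" by blast
    then show "P \<in> h (w + w')" by (simp add: h_def act_add_carrier skew_carrier_closed(3))
  qed
  have "h \<in> qdm_hom K (N_module K n r \<mu> l) ?O"
    unfolding qdm_hom_def
  proof (intro CollectI conjI ballI)
    fix f w assume "f \<in> K" "w \<in> carrier (N_module K n r \<mu> l)"
    then have fw: "w \<in> K" "f \<in> K" using n by auto
    show "h (f \<odot>\<^bsub>N_module K n r \<mu> l\<^esub> w) = f \<odot>\<^bsub>?O\<^esub> h w"
      unfolding operator_module_simps(3) hmon[OF fw, symmetric] using n by simp
  next
    fix w assume "w \<in> carrier (N_module K n r \<mu> l)"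
    then have w: "w \<in> K" using n by simp
    show "h (Sig (N_module K n r \<mu> l) w) = Sig ?O (h w)"
      unfolding operator_module_simps(4) hmon[OF w K_field_closed(2), symmetric] using n by simp
  next
    fix w w' assume "w \<in> carrier (N_module K n r \<mu> l)" "w' \<in> carrier (N_module K n r \<mu> l)"
    then have ww: "w \<in> K" "w' \<in> K" using n by auto
    show "h (w \<oplus>\<^bsub>N_module K n r \<mu> l\<^esub> w') = h w \<oplus>\<^bsub>?O\<^esub> h w'"
      unfolding operator_module_simps(2) hadd[OF ww, symmetric] using n by simp
  qed (use n carrier_eq in auto)
  moreover have "bij_betw h (carrier (N_module K n r \<mu> l)) (carrier ?O)"
    using inj carrier_eq n by (simp add: bij_betw_def)
  ultimately show ?thesis unfolding qdm_iso_def by blast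
qed

end

end

section \<open>The two-term operators\<close>

lemma monomial_inverse: "c \<noteq> 0 \<Longrightarrow> monomial (inverse c) (- i) * monomial c i = 1"
  by simp

text \<open>The operator \<open>x^a \<sigma>^n - \<Lambda> x^b\<close>. With two exponents the
  coefficients can avoid poles for either sign of \<open>a - b\<close>.\<close>

definition two_term :: "nat \<Rightarrow> int \<Rightarrow> int \<Rightarrow> 'c::field \<Rightarrow> 'c fls poly" where
  "two_term n a b \<Lambda> = monom (monomial 1 a) n + monom (monomial (- \<Lambda>) b) 0"

lemma coeff_two_term:
  "n > 0 \<Longrightarrow> coeff (two_term n a b \<Lambda>) i = (if i = n then monomial 1 a else if i = 0 then monomial (- \<Lambda>) b else 0)"
  by (simp add: two_term_def)

lemma degree_two_term:
  assumes "n > 0"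
  shows "degree (two_term n a b \<Lambda>) = n"
proof (rule antisym)
  show "degree (two_term n a b \<Lambda>) \<le> n"
    by (rule degree_le) (use assms in \<open>auto simp: coeff_two_term\<close>)
  show "n \<le> degree (two_term n a b \<Lambda>)"
    by (rule le_degree) (use assms in \<open>auto simp: coeff_two_term\<close>)
qed

context absval
begin

text \<open>This \<Lambda> is the constant in \<Sigma>^n applied to \<open>1\<close>, which equals
  \<open>\<Lambda> x^(-\<mu>)\<close>.\<close>

lemma two_term_kills_1:
  assumes n: "n > 0" and \<Lambda>: "\<Lambda> = Spow_coeff r \<mu> l (int n)" and ab: "a - b = \<mu>"
  shows "(\<Sum>i\<le>degree (two_term n a b \<Lambda>). fls_compose_power (coeff (two_term n a b \<Lambda>) i) n * Spow r \<mu> l (int i) 1) = 0"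
proof -
  have "(\<Sum>i\<le>degree (two_term n a b \<Lambda>). fls_compose_power (coeff (two_term n a b \<Lambda>) i) n * Spow r \<mu> l (int i) 1)
      = (\<Sum>i\<in>{0, n}. fls_compose_power (coeff (two_term n a b \<Lambda>) i) n * Spow r \<mu> l (int i) 1)"
    unfolding degree_two_term[OF n] using n by (intro sum.mono_neutral_right) (auto simp: coeff_two_term)
  also have "\<dots> = monomial (- \<Lambda>) (int n * b) + monomial 1 (int n * a) * monomial \<Lambda> (- \<mu> * int n)"
    using n by (simp add: coeff_two_term Spow_def Spow_coeff_def \<Lambda>)
  also have "\<dots> = 0"
  proof -
    have "int n * a + - \<mu> * int n = int n * b" using ab by (simp add: algebra_simps)
    then show ?thesis by (intro fls_eqI) simp
  qed
  finally show ?thesis .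
qed

text \<open>Modulo \<open>x^a \<sigma>^n - \<Lambda> x^b\<close> every power of \<open>\<sigma>\<close> reduces to one of the first \<open>n\<close>, whose images
  of \<open>1\<close> are supported in different classes modulo \<open>n\<close>.\<close>

lemma two_term_remainder:
  assumes n: "n > 0" and q: "q \<noteq> 0" and \<Lambda>: "\<Lambda> \<noteq> 0" and P: "P \<in> carrier (D q)"
  shows "\<exists>Q\<in>carrier (D q). \<exists>R\<in>carrier (D q). (\<forall>i. R i \<noteq> 0 \<longrightarrow> 0 \<le> i \<and> i < int n) \<and>
    P = (\<lambda>k. (Q \<otimes>\<^bsub>D q\<^esub> skew_of_poly (two_term n a b \<Lambda>)) k + R k)"
proof -
  let ?L = "skew_of_poly (two_term n a b \<Lambda>)"
  define G where "G P \<longleftrightarrow> (\<exists>Q\<in>carrier (D q). \<exists>R\<in>carrier (D q). (\<forall>i. R i \<noteq> 0 \<longrightarrow> 0 \<le> i \<and> i < int n) \<and>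
    P = (\<lambda>k. (Q \<otimes>\<^bsub>D q\<^esub> ?L) k + R k))" for P
  have G_add: "G (\<lambda>k. P k + P' k)" if GP: "G P" "G P'" for P P'
  proof -
    obtain Q R Q' R' where
      Q: "Q \<in> carrier (D q)" "R \<in> carrier (D q)" "\<forall>i. R i \<noteq> 0 \<longrightarrow> 0 \<le> i \<and> i < int n" "P = (\<lambda>k. (Q \<otimes>\<^bsub>D q\<^esub> ?L) k + R k)"
      and Q': "Q' \<in> carrier (D q)" "R' \<in> carrier (D q)" "\<forall>i. R' i \<noteq> 0 \<longrightarrow> 0 \<le> i \<and> i < int n" "P' = (\<lambda>k. (Q' \<otimes>\<^bsub>D q\<^esub> ?L) k + R' k)"
      using GP unfolding G_def by blast
    have QQ: "(\<lambda>k. Q k + Q' k) \<otimes>\<^bsub>D q\<^esub> ?L = (\<lambda>k. (Q \<otimes>\<^bsub>D q\<^esub> ?L) k + (Q' \<otimes>\<^bsub>D q\<^esub> ?L) k)"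
      using Q(1) Q'(1) by (intro skew_mult_add_left) (auto simp: skew_laurent_simps)
    have "(\<lambda>k. P k + P' k) = (\<lambda>k. ((\<lambda>k. Q k + Q' k) \<otimes>\<^bsub>D q\<^esub> ?L) k + (R k + R' k))"
      unfolding QQ Q(4) Q'(4) by (simp only: ac_simps)
    moreover have "\<forall>i. R i + R' i \<noteq> 0 \<longrightarrow> 0 \<le> i \<and> i < int n"
      using Q(3) Q'(3) by (metis add.right_neutral)
    moreover have "(\<lambda>k. Q k + Q' k) \<in> carrier (D q)" "(\<lambda>k. R k + R' k) \<in> carrier (D q)"
      using Q(1,2) Q'(1,2) by (simp_all add: skew_carrier_closed(3))
    ultimately show ?thesis unfolding G_def
      by (intro bexI[of _ "\<lambda>k. Q k + Q' k"] bexI[of _ "\<lambda>k. R k + R' k"] conjI)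
  qed
  have G_ideal: "G (Q \<otimes>\<^bsub>D q\<^esub> ?L)" if "Q \<in> carrier (D q)" for Q
    unfolding G_def using that skew_carrier_closed(1)[of q] by (intro bexI[of _ Q] bexI[of _ "\<lambda>k. 0"]) auto
  have monL: "skew_monom g j \<otimes>\<^bsub>D q\<^esub> ?L
      = (\<lambda>k. skew_monom (g * monomial ((q powi j) powi a) a) (j + int n) k
          + skew_monom (g * monomial (- \<Lambda> * (q powi j) powi b) b) j k)" for g j
  proof
    fix k
    consider "k = j" | "k = j + int n" "k \<noteq> j" | "k \<noteq> j" "k \<noteq> j + int n" by blast
    then show "(skew_monom g j \<otimes>\<^bsub>D q\<^esub> ?L) k = skew_monom (g * monomial ((q powi j) powi a) a) (j + int n) k
          + skew_monom (g * monomial (- \<Lambda> * (q powi j) powi b) b) j k"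
    proof cases
      case 1
      then show ?thesis unfolding skew_monom_mult
        using n by (simp add: skew_of_poly_def coeff_two_term skew_monom_def)
    next
      case 2
      then show ?thesis unfolding skew_monom_mult
        using n by (simp add: skew_of_poly_def coeff_two_term skew_monom_def)
    next
      case 3
      then have "nat (k - j) \<noteq> n" "k - j \<ge> 0 \<Longrightarrow> nat (k - j) \<noteq> 0" using n by auto
      then show ?thesis unfolding skew_monom_mult
        using 3 n by (auto simp: skew_of_poly_def coeff_two_term skew_monom_def)
    qed
  qed
  \<comment> \<open>The leading coefficient \<open>x^a\<close> is invertible: subtracting a multiple
    of \<open>\<sigma>^j L\<close> trades \<open>\<sigma>^(j + n)\<close> for
    \<open>\<sigma>^j\<close>.\<close>
  have up: "G (skew_monom f (j + int n))" if IH: "\<And>f. f \<in> K \<Longrightarrow> G (skew_monom f j)" and f: "f \<in> K" for f j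
  proof -
    define g where "g = f * monomial (inverse ((q powi j) powi a)) (- a)"
    have g: "g \<in> K" using f by (auto simp: g_def)
    have "g * monomial ((q powi j) powi a) a = f" using q by (simp add: g_def mult.assoc)
    then have "skew_monom f (j + int n) = (\<lambda>k. (skew_monom g j \<otimes>\<^bsub>D q\<^esub> ?L) k
        + skew_monom (- (g * monomial (- \<Lambda> * (q powi j) powi b) b)) j k)"
      unfolding monL by (auto simp: skew_monom_def)
    moreover have "G (skew_monom g j \<otimes>\<^bsub>D q\<^esub> ?L)" using g by (intro G_ideal skew_carrier_closed)
    moreover have "G (skew_monom (- (g * monomial (- \<Lambda> * (q powi j) powi b) b)) j)"
      using g by (intro IH K_field_uminus K_field_closed)
    ultimately show ?thesis using G_add by simp
  qed
  \<comment> \<open>The trailing coefficient is invertible too, which allows raising the negative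
    powers of \<sigma>.\<close>
  have down: "G (skew_monom f j)" if IH: "\<And>f. f \<in> K \<Longrightarrow> G (skew_monom f (j + int n))" and f: "f \<in> K" for f j
  proof -
    define g where "g = f * monomial (inverse (- \<Lambda> * (q powi j) powi b)) (- b)"
    have g: "g \<in> K" using f by (auto simp: g_def)
    have "- \<Lambda> * (q powi j) powi b \<noteq> 0" using q \<Lambda> by simp
    from monomial_inverse[OF this] have "g * monomial (- \<Lambda> * (q powi j) powi b) b = f"
      unfolding g_def mult.assoc by simp
    then have "skew_monom f j = (\<lambda>k. (skew_monom g j \<otimes>\<^bsub>D q\<^esub> ?L) k
        + skew_monom (- (g * monomial ((q powi j) powi a) a)) (j + int n) k)"
      unfolding monL by (auto simp: skew_monom_def)
    moreover have "G (skew_monom g j \<otimes>\<^bsub>D q\<^esub> ?L)" using g by (intro G_ideal skew_carrier_closed)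
    moreover have "G (skew_monom (- (g * monomial ((q powi j) powi a) a)) (j + int n))"
      using g by (intro IH K_field_uminus K_field_closed)
    ultimately show ?thesis using G_add by simp
  qed
  have base: "G (skew_monom f j)" if "f \<in> K" "0 \<le> j" "j < int n" for f j
    unfolding G_def
  proof (intro bexI conjI)
    show "skew_monom f j = (\<lambda>k. ((\<lambda>k. 0) \<otimes>\<^bsub>D q\<^esub> ?L) k + skew_monom f j k)"
      by (simp add: skew_laurent_simps)
    show "skew_monom f j \<in> carrier (D q)" using that by (intro skew_carrier_closed)
    show "\<forall>i. skew_monom f j i \<noteq> 0 \<longrightarrow> 0 \<le> i \<and> i < int n" using that by (simp add: skew_monom_def)
  qed (rule skew_carrier_closed)
  have G_monom: "G (skew_monom f k)" if f: "f \<in> K" for f k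
  proof -
    define j where "j = k mod int n"
    have j: "0 \<le> j" "j < int n" using n by (auto simp: j_def)
    have up': "G (skew_monom f (j + int n * int i))" if "f \<in> K" for i f
      using that
    proof (induction i arbitrary: f)
      case (Suc i)
      then show ?case using up[of "j + int n * int i" f] by (simp add: algebra_simps)
    qed (use base j in simp)
    have down': "G (skew_monom f (j - int n * int i))" if "f \<in> K" for i f
      using that
    proof (induction i arbitrary: f)
      case (Suc i)
      then show ?case using down[of "j - int n * int (Suc i)" f] by (simp add: algebra_simps)
    qed (use base j in simp)
    have k: "k = j + int n * (k div int n)" by (simp add: j_def)
    show ?thesis
      using up'[OF f, of "nat (k div int n)"] down'[OF f, of "nat (- (k div int n))"] k
      by (cases "k div int n \<ge> 0") auto
  qed
  have "G P" if "finite A" "\<And>i. P i \<noteq> 0 \<Longrightarrow> i \<in> A" "\<And>i. P i \<in> K" for A P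
    using that
  proof (induction A arbitrary: P rule: finite_induct)
    case empty
    then have "P = skew_monom 0 0" by (auto simp: skew_monom_def)
    then show ?case using G_monom by simp
  next
    case (insert x A)
    have "G (P(x := 0))"
      by (rule insert.IH) (use insert in \<open>auto split: if_splits\<close>)
    moreover have "G (skew_monom (P x) x)" using insert.prems by (intro G_monom)
    moreover have "P = (\<lambda>k. (P(x := 0)) k + skew_monom (P x) x k)" by (auto simp: skew_monom_def)
    ultimately show ?case using G_add by metis
  qed
  from this[of "{i. P i \<noteq> 0}" P] have "G P" using P by (auto simp: skew_laurent_simps)
  then show ?thesis unfolding G_def .
qed

text \<open>The vector \<open>1\<close> generates the module, and its annihilator is the left ideal,
  since a remainder of degree below \<open>n\<close> that kills \<open>1\<close> is zero.\<close>

lemma N_module_iso_two_term: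
  assumes n: "n > 0" and r: "r ^ n = q" "r \<noteq> 0" and l: "l \<noteq> 0" and cop: "coprime (int n) \<mu>"
    and \<Lambda>: "\<Lambda> = Spow_coeff r \<mu> l (int n)" and ab: "a - b = \<mu>"
  shows "qdm_iso K (N_module K n r \<mu> l) (operator_module K q (two_term n a b \<Lambda>))"
proof (rule N_module_iso_operator_module[OF n r l])
  let ?L = "two_term n a b \<Lambda>"
  have L: "coeff ?L i \<in> K" for i using n by (simp add: coeff_two_term)
  then show "coeff ?L i \<in> K" for i .
  show "1 \<in> K" by simp
  note kills = two_term_kills_1[OF n \<Lambda> ab]
  then show "(\<Sum>i\<le>degree ?L. fls_compose_power (coeff ?L i) n * Spow r \<mu> l (int i) 1) = 0" .
  have q0: "q \<noteq> 0" and \<Lambda>0: "\<Lambda> \<noteq> 0" using r l by (auto simp: \<Lambda>)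
  show "P \<in> I q ?L" if P: "P \<in> carrier (D q)" and 0: "act n r \<mu> l P 1 = 0" for P
  proof -
    obtain Q R where Q: "Q \<in> carrier (D q)" and R: "R \<in> carrier (D q)" "\<forall>i. R i \<noteq> 0 \<longrightarrow> 0 \<le> i \<and> i < int n"
      and PQ: "P = (\<lambda>k. (Q \<otimes>\<^bsub>D q\<^esub> skew_of_poly ?L) k + R k)"
      using two_term_remainder[OF n q0 \<Lambda>0 P] by blast
    have QI: "Q \<otimes>\<^bsub>D q\<^esub> skew_of_poly ?L \<in> I q ?L" using Q unfolding left_ideal_gen_def by blast
    note QL = left_idealD[OF n r l L K_field_closed(2) kills QI]
    have "act n r \<mu> l P 1 = act n r \<mu> l R 1"
      unfolding PQ using QL R by (subst act_add) (auto simp: skew_laurent_simps(1))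
    then have act0: "(\<Sum>i\<in>{0..<int n}. fls_compose_power (R i) n * Spow r \<mu> l i 1) = 0"
      using 0 R(2) by (subst (asm) act_superset[of "{0..<int n}"]) auto
    have "R i $$ k = 0" if i: "i \<in> {0..<int n}" for i k
    proof -
      \<comment> \<open>At the index \<open>int n * k - \<mu> * i\<close> only the summand
        \<open>i\<close> is visible, the numbers \<open>- \<mu> * i'\<close> being distinct modulo
        \<open>n\<close>.\<close>
      have "0 = (\<Sum>i'\<in>{0..<int n}. (fls_compose_power (R i') n * Spow r \<mu> l i' 1) $$ (int n * k - \<mu> * i))"
        using arg_cong[OF act0, of "\<lambda>f. f $$ (int n * k - \<mu> * i)"] by (simp only: fls_nth_sum) simp
      also have "\<dots> = (\<Sum>i'\<in>{0..<int n}. if i' = i then Spow_coeff r \<mu> l i * R i $$ k else 0)"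
      proof (rule sum.cong)
        fix i' assume i': "i' \<in> {0..<int n}"
        have eq: "int n * k - \<mu> * i - - \<mu> * i' = int n * k + \<mu> * (i' - i)" by (simp add: algebra_simps)
        have "int n dvd int n * k + \<mu> * (i' - i) \<longleftrightarrow> i' = i"
        proof
          assume "int n dvd int n * k + \<mu> * (i' - i)"
          then have "int n dvd i' - i"
            using cop by (simp add: dvd_add_right_iff coprime_dvd_mult_right_iff)
          then show "i' = i" using i i' zdvd_imp_le[of "int n" "i' - i"] zdvd_imp_le[of "int n" "i - i'"]
            by (cases i i' rule: linorder_cases) (auto simp: dvd_diff_commute)
        qed simp
        then show "(fls_compose_power (R i') n * Spow r \<mu> l i' 1) $$ (int n * k - \<mu> * i)
            = (if i' = i then Spow_coeff r \<mu> l i * R i $$ k else 0)"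
          using n unfolding Spow_def sigma_one_1 mult_1_right mult_monomial_nth eq
          by (simp add: fls_nth_compose_power)
      qed simp
      also have "\<dots> = Spow_coeff r \<mu> l i * R i $$ k" using i by simp
      finally show ?thesis using r l by simp
    qed
    then have "R = (\<lambda>i. 0)" using R(2) by (intro ext) (metis atLeastLessThan_iff fls_eqI fls_zero_nth)
    then show ?thesis using QI unfolding PQ by simp
  qed
  show "\<exists>P\<in>carrier (D q). act n r \<mu> l P 1 = w" if w: "w \<in> K" for w
  proof -
    define Im where "Im = (\<lambda>P. act n r \<mu> l P 1) ` carrier (D q)"
    have Im_add: "x + y \<in> Im" if xy: "x \<in> Im" "y \<in> Im" for x y
    proof -
      obtain P Q where PQ: "P \<in> carrier (D q)" "Q \<in> carrier (D q)" "x = act n r \<mu> l P 1" "y = act n r \<mu> l Q 1"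
        using xy unfolding Im_def by blast
      then have "x + y = act n r \<mu> l (\<lambda>k. P k + Q k) 1"
        by (subst act_add) (auto simp: skew_laurent_simps)
      then show ?thesis unfolding Im_def using PQ by (auto intro: skew_carrier_closed(3))
    qed
    have Im_sum: "sum h A \<in> Im" if "\<And>i. i \<in> A \<Longrightarrow> h i \<in> Im" for A :: "nat set" and h
      using that
    proof (induction A rule: infinite_finite_induct)
      case empty
      show ?case using skew_carrier_closed(1)[of q] unfolding Im_def by (auto intro!: image_eqI[of _ _ "\<lambda>k. 0"])
    next
      case (infinite A)
      show ?case using infinite skew_carrier_closed(1)[of q] unfolding Im_def by (auto intro!: image_eqI[of _ _ "\<lambda>k. 0"])
    qed (auto intro: Im_add)
    have "(\<Sum>j<n. fls_compose_power (section_fls n (int j) w) n * fls_X ^ j) \<in> Im"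
    proof (rule Im_sum)
      fix j
      \<comment> \<open>Up to a constant, \<open>t^j\<close> is \<open>x^m\<close> times \<Sigma>^i
        applied to \<open>1\<close>; the inverse in \<open>f\<close> removes the constant.\<close>
      obtain i m where im: "int n * m - \<mu> * int i = int j" using coprime_combination[OF n cop] by blast
      define f where "f = section_fls n (int j) w * monomial (inverse (Spow_coeff r \<mu> l (int i))) m"
      have f: "f \<in> K" unfolding f_def using w n by (intro K_field_closed K_field_section) auto
      have "act n r \<mu> l (skew_monom f (int i)) 1 = fls_compose_power (section_fls n (int j) w) n * fls_X ^ j"
        using n r l im by (simp add: act_monom f_def Spow_def fls_X_power_eq_monomial mult.assoc)
      then show "fls_compose_power (section_fls n (int j) w) n * fls_X ^ j \<in> Im"
        unfolding Im_def using skew_carrier_closed(2)[OF f] by (metis image_eqI)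
    qed
    then have "w \<in> Im" using n by (simp add: fls_sections)
    then show ?thesis unfolding Im_def by auto
  qed
qed

end

section \<open>Newton polygons\<close>

lemma x_order_exists:
  assumes "L \<noteq> 0"
  shows "\<exists>i. coeff L i \<noteq> 0 \<and> fls_subdegree (coeff L i) = x_order L"
    and "coeff L i \<noteq> 0 \<Longrightarrow> x_order L \<le> fls_subdegree (coeff L i)"
proof -
  let ?S = "{fls_subdegree (coeff L i) |i. coeff L i \<noteq> 0}"
  have "?S \<subseteq> (\<lambda>i. fls_subdegree (coeff L i)) ` {..degree L}" by (auto simp: le_degree)
  then have fin: "finite ?S" by (rule finite_subset) simp
  have "coeff L (degree L) \<noteq> 0" using assms by simp
  then have "?S \<noteq> {}" by blast
  from Min_in[OF fin this] show "\<exists>i. coeff L i \<noteq> 0 \<and> fls_subdegree (coeff L i) = x_order L"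
    unfolding x_order_def by auto
  show "coeff L i \<noteq> 0 \<Longrightarrow> x_order L \<le> fls_subdegree (coeff L i)"
    unfolding x_order_def by (rule Min_le[OF fin]) blast
qed

lemma x_order_eqI:
  assumes "coeff L i \<noteq> 0" "fls_subdegree (coeff L i) = m"
    and "\<And>j. coeff L j \<noteq> 0 \<Longrightarrow> m \<le> fls_subdegree (coeff L j)"
  shows "x_order L = m"
proof -
  have "L \<noteq> 0" using assms(1) by auto
  then show ?thesis using x_order_exists assms by (metis order_antisym)
qed

lemma coeff_clear_x: "coeff (clear_x L) i = monomial 1 (- x_order L) * coeff L i"
  unfolding clear_x_def X_intpow_eq_monomial by simp

lemma coeff_clear_x_0 [simp]: "coeff (clear_x L) i = 0 \<longleftrightarrow> coeff L i = 0"
  by (simp add: coeff_clear_x)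

lemma fls_subdegree_coeff_clear_x:
  "coeff L i \<noteq> 0 \<Longrightarrow> fls_subdegree (coeff (clear_x L) i) = fls_subdegree (coeff L i) - x_order L"
  by (simp add: coeff_clear_x)

definition newton_points :: "'c::field fls poly \<Rightarrow> (real \<times> real) set" where
  "newton_points L = {(real i, k) | i k. coeff (clear_x L) i \<noteq> 0 \<and>
                                    real_of_int (fls_subdegree (coeff (clear_x L) i)) \<le> k}"

text \<open>The slope from the leftmost vertex to the next one on its lower right.\<close>

lemma exists_slope:
  assumes L: "coeff L i0 \<noteq> 0" "coeff L j0 \<noteq> 0" "i0 \<noteq> j0"
  obtains s i j where "s \<in> slopes L" "i < j" "coeff L i \<noteq> 0" "coeff L j \<noteq> 0"
    "real (j - i) * s = real_of_int (fls_subdegree (coeff L j) - fls_subdegree (coeff L i))"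
    "\<forall>k. coeff L k \<noteq> 0 \<longrightarrow>
      real_of_int (fls_subdegree (coeff L i)) - s * real i \<le> real_of_int (fls_subdegree (coeff L k)) - s * real k"
proof -
  define e where "e k = real_of_int (fls_subdegree (coeff L k))" for k
  define i where "i = (LEAST i. coeff L i \<noteq> 0)"
  have i: "coeff L i \<noteq> 0" unfolding i_def by (rule LeastI[of _ i0]) fact
  have imin: "i \<le> k" if "coeff L k \<noteq> 0" for k unfolding i_def using that by (rule Least_le)
  define J where "J = {j. coeff L j \<noteq> 0 \<and> j \<noteq> i}"
  have "J \<subseteq> {..degree L}" by (auto simp: J_def le_degree)
  then have finJ: "finite J" by (rule finite_subset) simp
  have neJ: "J \<noteq> {}" using L unfolding J_def by auto
  define t where "t j = (e j - e i) / (real j - real i)" for j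
  \<comment> \<open>The least slope of a chord from the leftmost index \<open>i\<close>: no point
    lies below the line of this slope through the point at \<open>i\<close>.\<close>
  define s where "s = Min (t ` J)"
  have "s \<in> t ` J" unfolding s_def using finJ neJ by (intro Min_in) auto
  then obtain j where j: "j \<in> J" "s = t j" by blast
  have smin: "s \<le> t k" if "k \<in> J" for k unfolding s_def using that finJ by simp
  have ij: "i < j" "coeff L j \<noteq> 0" using j(1) imin[of j] by (auto simp: J_def)
  have ejs: "e j - e i = s * (real j - real i)" using ij j(2) by (simp add: t_def)
  have low: "e i - s * real i \<le> e k - s * real k" if k: "coeff L k \<noteq> 0" for k
  proof (cases "k = i")
    case False
    then have "k \<in> J" "i < k" using k imin[OF k] by (auto simp: J_def)
    then have "s * (real k - real i) \<le> e k - e i"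
      using smin[of k] by (simp add: t_def pos_le_divide_eq)
    then show ?thesis by (simp add: algebra_simps)
  qed simp
  let ?x = "real_of_int (x_order L)"
  define c where "c = e i - ?x - s * real i"
  define P where "P = newton_polygon L"
  \<comment> \<open>A normal vector of the lines of slope \<open>s\<close>; the supporting line of
    this direction cuts out the edge.\<close>
  define A where "A = (- s, 1 :: real)"
  have inner_A: "A \<bullet> p = snd p - s * fst p" for p :: "real \<times> real"
    by (cases p) (simp add: A_def)
  have "newton_points L \<subseteq> {p. A \<bullet> p \<ge> c}"
  proof
    fix p assume "p \<in> newton_points L"
    then obtain k y where p: "p = (real k, y)" and k: "coeff L k \<noteq> 0" and y: "e k - ?x \<le> y"
      unfolding newton_points_def by (auto simp: fls_subdegree_coeff_clear_x e_def)
    then show "p \<in> {p. A \<bullet> p \<ge> c}" using low[OF k] by (auto simp: inner_A c_def)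
  qed
  then have PA: "P \<subseteq> {p. A \<bullet> p \<ge> c}"
    unfolding P_def newton_polygon_def newton_points_def by (intro hull_minimal convex_halfspace_ge)
  define E where "E = P \<inter> {p. A \<bullet> p = c}"
  have "E face_of P"
    unfolding E_def using PA by (intro face_of_Int_supporting_hyperplane_ge)
      (auto simp: P_def newton_polygon_def convex_convex_hull)
  have vertex: "(real k, e k - ?x) \<in> P" if "coeff L k \<noteq> 0" for k
    unfolding P_def newton_polygon_def using that
    by (intro hull_inc) (auto simp: fls_subdegree_coeff_clear_x e_def)
  have pE: "(real i, e i - ?x) \<in> E" "(real j, e j - ?x) \<in> E"
    unfolding E_def using vertex i ij ejs by (auto simp: inner_A c_def algebra_simps)
  \<comment> \<open>Dimension count: the face lies on a line and contains two distinct
    points.\<close>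
  have "aff_dim E \<le> aff_dim {p. A \<bullet> p = c}" by (rule aff_dim_subset) (auto simp: E_def)
  also have "\<dots> = 1" by (subst aff_dim_hyperplane) (auto simp: A_def zero_prod_def)
  finally have "aff_dim E \<le> 1" .
  moreover have "aff_dim {(real i, e i - ?x), (real j, e j - ?x)} \<le> aff_dim E"
    using pE by (intro aff_dim_subset) auto
  then have "aff_dim E \<ge> 1" using ij by (simp add: aff_dim_2)
  ultimately have "E edge_of P" using \<open>E face_of P\<close> by (simp add: edge_of_def)
  moreover have "s = ((e j - ?x) - (e i - ?x)) / (real j - real i)"
    using ejs ij by (simp add: field_simps)
  ultimately have "s \<in> slopes L"
    unfolding slopes_def P_def using pE ij
    by (intro CollectI exI[of _ "real i"] exI[of _ "e i - ?x"] exI[of _ "real j"] exI[of _ "e j - ?x"] exI[of _ E]) simp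
  moreover have "real (j - i) * s = real_of_int (fls_subdegree (coeff L j) - fls_subdegree (coeff L i))"
    using ejs ij by (simp add: e_def of_nat_diff mult.commute)
  ultimately show ?thesis using that ij i low unfolding e_def by blast
qed

text \<open>The polygon is the part of a vertical strip above one segment. Vertical sides do not
  carry two points with different abscissae, so only the segment yields a slope.\<close>

lemma slopes_two_term:
  assumes n: "n > 0" and L: "\<And>i. coeff L i \<noteq> 0 \<longleftrightarrow> i = 0 \<or> i = n" and s: "s \<in> slopes L"
  shows "s = real_of_int (fls_subdegree (coeff L n) - fls_subdegree (coeff L 0)) / real n"
proof -
  let ?x = "x_order L"
  define e0 where "e0 = real_of_int (fls_subdegree (coeff L 0) - ?x)"
  define en where "en = real_of_int (fls_subdegree (coeff L n) - ?x)"
  define \<sigma> where "\<sigma> = (en - e0) / real n"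
  have en: "en = e0 + \<sigma> * real n" using n by (simp add: \<sigma>_def)
  define P where "P = newton_polygon L"
  define W where "W = {p :: real \<times> real. 0 \<le> fst p \<and> fst p \<le> real n \<and> e0 \<le> snd p - \<sigma> * fst p}"
  \<comment> \<open>The open version of \<open>W\<close>; it lies in the interior of
    \<open>P\<close>, which a proper face avoids.\<close>
  define W' where "W' = {p :: real \<times> real. 0 < fst p \<and> fst p < real n \<and> e0 < snd p - \<sigma> * fst p}"
  have pts: "{(real i, k) | i k. coeff (clear_x L) i \<noteq> 0 \<and>
      real_of_int (fls_subdegree (coeff (clear_x L) i)) \<le> k} = {(0, k) |k. e0 \<le> k} \<union> {(real n, k) |k. en \<le> k}"
    using L by (auto simp: fls_subdegree_coeff_clear_x e0_def en_def)
  have "convex W"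
  proof -
    have "W = {p. (1, 0) \<bullet> p \<ge> 0} \<inter> {p. (1, 0) \<bullet> p \<le> real n} \<inter> {p. (- \<sigma>, 1) \<bullet> p \<ge> e0}"
      by (auto simp: W_def)
    then show ?thesis by (auto intro!: convex_Int convex_halfspace_ge convex_halfspace_le)
  qed
  then have PW: "P \<subseteq> W"
    unfolding P_def newton_polygon_def pts by (intro hull_minimal) (auto simp: W_def en)
  have W'P: "W' \<subseteq> P"
  proof
    fix p assume "p \<in> W'"
    then obtain x y where p: "p = (x, y)" and x: "0 < x" "x < real n" and y: "e0 < y - \<sigma> * x"
      by (cases p) (auto simp: W'_def)
    define \<delta> where "\<delta> = y - \<sigma> * x - e0"
    have "(0, e0 + \<delta>) \<in> P" "(real n, en + \<delta>) \<in> P"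
      unfolding P_def newton_polygon_def pts using y by (auto intro!: hull_inc simp: \<delta>_def)
    then have "(1 - x / real n) *\<^sub>R (0, e0 + \<delta>) + (x / real n) *\<^sub>R (real n, en + \<delta>) \<in> P"
      using x n by (intro convexD) (auto simp: P_def newton_polygon_def convex_convex_hull)
    moreover have "(1 - x / real n) *\<^sub>R (0, e0 + \<delta>) + (x / real n) *\<^sub>R (real n, en + \<delta>) = p"
      using n by (simp add: p \<delta>_def en field_simps)
    ultimately show "p \<in> P" by simp
  qed
  have "open W'"
    unfolding W'_def by (intro open_Collect_conj open_Collect_less continuous_intros)
  then have W'int: "W' \<subseteq> interior P" using W'P by (rule interior_maximal[rotated])
  obtain x y x' y' E where E: "E edge_of P" and xy: "(x, y) \<in> E" "(x', y') \<in> E" "x \<noteq> x'"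
    and sxy: "s = (y' - y) / (x' - x)"
    using s unfolding slopes_def P_def by blast
  have EP: "E \<subseteq> P" using E by (auto simp: edge_of_def dest: face_of_imp_subset)
  have "(real n / 2, e0 + 1 + \<sigma> * (real n / 2)) \<in> W'" using n by (simp add: W'_def)
  then have "W' \<noteq> {}" by blast
  \<comment> \<open>\<open>P\<close> has dimension 2, so the edge \<open>E\<close> is a proper
    face.\<close>
  then have "aff_dim P = 2" using W'int by (subst aff_dim_nonempty_interior) auto
  then have "E \<noteq> P" using E by (auto simp: edge_of_def)
  then have disj: "E \<inter> interior P = {}" using E by (auto simp: edge_of_def dest: face_of_disjoint_interior)
  \<comment> \<open>The midpoint lies strictly between the vertical sides. Not being in
    \<open>W'\<close>, it cannot lie above the segment, and this puts both of its end points on the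
    line of slope \<sigma>.\<close>
  define m where "m = (1/2) *\<^sub>R (x, y) + (1/2) *\<^sub>R (x', y')"
  have "convex E" using E by (auto simp: edge_of_def dest: face_of_imp_convex)
  then have "m \<in> E" unfolding m_def using xy by (intro convexD) auto
  then have "m \<notin> W'" using disj W'int by blast
  moreover have "(x, y) \<in> W" "(x', y') \<in> W" using xy EP PW by auto
  ultimately have "y = e0 + \<sigma> * x" "y' = e0 + \<sigma> * x'"
    using xy(3) by (auto simp: m_def W_def W'_def algebra_simps)
  then have "y' - y = \<sigma> * (x' - x)" by (simp add: algebra_simps)
  then have "s = \<sigma>" using xy(3) by (simp add: sxy)
  then show ?thesis by (simp add: \<sigma>_def e0_def en_def)
qed

section \<open>Characteristic polynomials\<close>

text \<open>Apart from \<open>l powi i\<close>, this is the factor in \<open>Spow\<close>; it links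
  the characteristic polynomial to the action on \<open>N_module\<close>.\<close>

lemma twist_factor:
  assumes "r \<noteq> 0"
  shows "(\<Prod>j<i. sigma (r ^ j) (fls_X_intpow (- \<mu>))) = monomial (r powi (- \<mu> * tri (int i))) (- \<mu> * int i)"
  unfolding X_intpow_eq_monomial
proof (induction i)
  case (Suc i)
  have "tri (int (Suc i)) = tri (int i) + int i" using tri_add[of 1 "int i"] by simp
  then have "- \<mu> * tri (int (Suc i)) = - \<mu> * tri (int i) + int i * (- \<mu>)"
    by (simp add: algebra_simps)
  then have "r powi (- \<mu> * tri (int (Suc i))) = r powi (- \<mu> * tri (int i)) * r powi (int i * (- \<mu>))"
    using assms by (simp only: power_int_add[OF disjI1] not_False_eq_True)
  also have "r powi (int i * (- \<mu>)) = (r ^ i) powi (- \<mu>)"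
    by (simp only: power_int_mult power_int_of_nat)
  finally have "r powi (- \<mu> * tri (int (Suc i))) = r powi (- \<mu> * tri (int i)) * (r ^ i) powi (- \<mu>)" .
  moreover have "- \<mu> * int (Suc i) = - \<mu> * int i + - \<mu>" by (simp add: algebra_simps)
  ultimately show ?case using Suc by (simp del: mult_minus_left)
qed simp

lemma coeff_twist:
  assumes "r \<noteq> 0"
  shows "coeff (twist r \<mu> L) i = coeff L i * monomial (r powi (- \<mu> * tri (int i))) (- \<mu> * int i)"
proof -
  have "coeff (twist r \<mu> L) i
      = (\<Sum>k\<le>degree L. if k = i then coeff L k * monomial (r powi (- \<mu> * tri (int k))) (- \<mu> * int k) else 0)"
    unfolding twist_def coeff_sum coeff_monom twist_factor[OF assms] ..
  also have "\<dots> = coeff L i * monomial (r powi (- \<mu> * tri (int i))) (- \<mu> * int i)"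
    by (cases "i \<le> degree L") (auto simp: sum.delta coeff_eq_0)
  finally show ?thesis .
qed

lemma coeff_ramify: "coeff (ramify n L) i = fls_compose_power (coeff L i) n"
  by (simp add: ramify_def coeff_map_poly)

lemma ramify_1 [simp]: "ramify 1 L = L"
  by (rule poly_eqI) (simp add: coeff_ramify)

lemma coeff_twist_ramify_0 [simp]:
  "r \<noteq> 0 \<Longrightarrow> n > 0 \<Longrightarrow> coeff (twist r \<mu> (ramify n L)) i = 0 \<longleftrightarrow> coeff L i = 0"
  by (simp add: coeff_twist coeff_ramify)

lemma fls_subdegree_twist_ramify:
  "r \<noteq> 0 \<Longrightarrow> n > 0 \<Longrightarrow> coeff L i \<noteq> 0 \<Longrightarrow>
    fls_subdegree (coeff (twist r \<mu> (ramify n L)) i) = int n * fls_subdegree (coeff L i) - \<mu> * int i"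
  by (simp add: coeff_twist coeff_ramify fls_subdegree_compose_power)

lemma coeff_char_polynomial: "coeff (char_polynomial r \<mu> L) i = coeff (twist r \<mu> L) i $$ x_order (twist r \<mu> L)"
  by (simp add: char_polynomial_def coeff_map_poly coeff_clear_x)

section \<open>Convergent solutions\<close>

text \<open>The equations \<open>\<Sum>_(j\<le>k) p_(k-j) (l r^j) y_j = 0\<close>, solved for
  \<open>y_k\<close> with \<open>y_0 = 1\<close>. A vanishing divisor would give 0 by convention;
  \<open>convergent_solution\<close> excludes it.\<close>

function solution_coeff :: "(nat \<Rightarrow> 'c::field \<Rightarrow> 'c) \<Rightarrow> 'c \<Rightarrow> 'c \<Rightarrow> nat \<Rightarrow> 'c" where
  "solution_coeff p r l k = (if k = 0 then 1
     else - (\<Sum>j<k. p (k - j) (l * r ^ j) * solution_coeff p r l j) / p 0 (l * r ^ k))"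
  by pat_completeness auto
termination by (relation "Wellfounded.measure (\<lambda>(p, r, l, k). k)") auto

declare solution_coeff.simps [simp del]

context absval
begin

text \<open>\<open>p m\<close> collects the coefficients of \<open>x^m\<close>: applied to \<open>y = \<Sum> y_k x^k\<close> times a solution of
  \<open>\<sigma> e = l e\<close>, the operator \<open>\<Sum> \<beta>_i \<sigma>^i\<close> gives \<open>\<Sum>_(j\<le>m) p_(m-j) (l r^j) y_j\<close> in degree \<open>m\<close>.  As
  \<open>|r| = 1\<close>, the only obstruction to convergence is the size of the products of the \<open>p_0 (l r^k)\<close>.\<close>

lemma convergent_solution:
  fixes \<beta> :: "nat \<Rightarrow> 'c fps"
  assumes \<beta>: "\<And>i. convergent_fps N (\<beta> i)" and r: "N r = 1"
    and p: "p = (\<lambda>m y. \<Sum>i\<le>d. fps_nth (\<beta> i) m * y ^ i)"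
    and root: "p 0 l = 0" and nonroot: "\<And>k. k > 0 \<Longrightarrow> p 0 (l * r ^ k) \<noteq> 0"
    and small: "geom (\<lambda>k. inverse (\<Prod>j<k. N (p 0 (l * r ^ Suc j))))"
  obtains y where "convergent_fps N y" "fps_nth y 0 = 1"
    "(\<Sum>i\<le>d. fps_to_fls (\<beta> i) * (monomial (l ^ i) 0 * sigma (r ^ i) (fps_to_fls y))) = 0"
proof -
  define Y where "Y = solution_coeff p r l"
  have Y0: "Y 0 = 1" by (simp add: Y_def solution_coeff.simps)
  have Yk: "Y k * p 0 (l * r ^ k) = - (\<Sum>j<k. p (k - j) (l * r ^ j) * Y j)" if "k > 0" for k
    using nonroot[OF that] that by (simp add: Y_def solution_coeff.simps[of p r l k])
  \<comment> \<open>A bound for \<open>p m\<close> along the orbit \<open>l r^j\<close>, uniform in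
    \<open>j\<close> because \<open>N r = 1\<close>.\<close>
  define c where "c m = (\<Sum>i\<le>d. N (fps_nth (\<beta> i) m) * N l ^ i)" for m
  have c0: "c m \<ge> 0" for m unfolding c_def by (intro sum_nonneg) auto
  have "geom c"
    unfolding c_def
  proof (rule geom_sum)
    fix i
    have "geom (\<lambda>m. N (fps_nth (\<beta> i) m))" using \<beta>[of i] by (simp add: convergent_fps_iff)
    then show "geom (\<lambda>m. N (fps_nth (\<beta> i) m) * N l ^ i)"
      by (rule geom_mult[OF _ geom_const]) auto
  qed simp
  then obtain B where B: "B \<ge> 1" "\<And>m. c m \<le> B ^ (m + 1)" by (rule geomE) blast
  have pc: "N (p m (l * r ^ j)) \<le> c m" for m j
    unfolding p c_def using r
    by (intro order_trans[OF N_sum]) (simp add: N_mult N_power)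
  define \<Delta> where "\<Delta> k = (\<Prod>j<k. N (p 0 (l * r ^ Suc j)))" for k
  have \<Delta>0: "\<Delta> k \<ge> 0" for k unfolding \<Delta>_def by (intro prod_nonneg) auto
  have \<Delta>pos: "\<Delta> k > 0" for k unfolding \<Delta>_def
  proof (rule prod_pos)
    show "0 < N (p 0 (l * r ^ Suc j))" for j using nonroot[of "Suc j"] by simp
  qed
  define A where "A = max 1 (c 0)"
  have \<Delta>A: "\<Delta> (j + i) \<le> \<Delta> j * A ^ i" for i j
  proof (induction i)
    case (Suc i)
    have "\<Delta> (j + Suc i) = \<Delta> (j + i) * N (p 0 (l * r ^ Suc (j + i)))" by (simp add: \<Delta>_def)
    also have "\<dots> \<le> (\<Delta> j * A ^ i) * A"
      using Suc \<Delta>0 pc[of 0 "Suc (j + i)"] by (intro mult_mono) (auto simp: A_def)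
    finally show ?case by (simp add: mult_ac)
  qed simp
  \<comment> \<open>Multiplying by the product of the divisors up to index \<open>k\<close> frees
    the recursion of small divisors; they return only at the end, through the hypothesis
    \<open>small\<close>.\<close>
  define w where "w k = N (Y k) * \<Delta> k" for k
  have "geom w"
  proof (rule geom_recursion)
    fix k :: nat assume k: "k > 0"
    have "w k = N (Y k * p 0 (l * r ^ k)) * \<Delta> (k - 1)"
      using k by (cases k) (auto simp: w_def \<Delta>_def N_mult)
    also have "\<dots> \<le> (\<Sum>j<k. N (p (k - j) (l * r ^ j) * Y j)) * \<Delta> (k - 1)"
      unfolding Yk[OF k] N_minus by (intro mult_right_mono N_sum \<Delta>0)
    also have "\<dots> = (\<Sum>j<k. N (p (k - j) (l * r ^ j)) * (N (Y j) * \<Delta> (k - 1)))"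
      by (simp only: sum_distrib_right N_mult mult.assoc)
    also have "\<dots> \<le> (\<Sum>j<k. B * (A * B) ^ (k - j) * w j)"
    proof (rule sum_mono)
      fix j assume "j \<in> {..<k}"
      then have j: "j < k" by simp
      \<comment> \<open>\<open>\<Delta> (k - 1)\<close> holds the divisors up to index
        \<open>k - 1\<close>; each one beyond index \<open>j\<close> costs at most a factor
        \<open>A\<close>.\<close>
      have "\<Delta> (k - 1) \<le> \<Delta> j * A ^ (k - 1 - j)" using \<Delta>A[of j "k - 1 - j"] j by simp
      also have "\<dots> \<le> \<Delta> j * A ^ (k - j)"
        using \<Delta>0 by (intro mult_left_mono power_increasing) (auto simp: A_def)
      finally have le1: "N (Y j) * \<Delta> (k - 1) \<le> N (Y j) * (\<Delta> j * A ^ (k - j))" by (rule mult_left_mono) simp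
      have le2: "N (p (k - j) (l * r ^ j)) \<le> B ^ (k - j + 1)"
        using pc[of "k - j" j] B(2)[of "k - j"] by linarith
      have ge: "0 \<le> B ^ (k - j + 1)" "0 \<le> N (Y j) * \<Delta> (k - 1)" using B(1) \<Delta>0 by simp_all
      have "N (p (k - j) (l * r ^ j)) * (N (Y j) * \<Delta> (k - 1))
          \<le> B ^ (k - j + 1) * (N (Y j) * (\<Delta> j * A ^ (k - j)))"
        by (rule mult_mono[OF le2 le1 ge])
      also have "\<dots> = B * (A * B) ^ (k - j) * w j"
        by (simp add: w_def power_mult_distrib mult_ac)
      finally show "N (p (k - j) (l * r ^ j)) * (N (Y j) * \<Delta> (k - 1)) \<le> B * (A * B) ^ (k - j) * w j" .
    qed
    finally show "w k \<le> (\<Sum>j<k. B * (A * B) ^ (k - j) * w j)" .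
  qed (use B in \<open>auto simp: A_def w_def \<Delta>0\<close>)
  moreover have "geom (\<lambda>k. inverse (\<Delta> k))" using small by (simp only: \<Delta>_def)
  ultimately have "geom (\<lambda>k. w k * inverse (\<Delta> k))"
    by (rule geom_mult) (auto simp: w_def \<Delta>0)
  moreover have "w k * inverse (\<Delta> k) = N (Y k)" for k
    using \<Delta>pos[of k] by (simp add: w_def)
  ultimately have conv: "convergent_fps N (Abs_fps Y)" by (simp add: convergent_fps_iff)
  have sol: "(\<Sum>i\<le>d. fps_to_fls (\<beta> i) * (monomial (l ^ i) 0 * sigma (r ^ i) (fps_to_fls (Abs_fps Y)))) = 0"
  proof -
    define Z where "Z i = Abs_fps (\<lambda>k. (l * r ^ k) ^ i * Y k)" for i
    have Z: "monomial (l ^ i) 0 * sigma (r ^ i) (fps_to_fls (Abs_fps Y)) = fps_to_fls (Z i)" for i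
    proof (rule fls_eqI)
      fix k
      have "(r ^ i) powi int m = (r ^ m) ^ i" for m by (simp flip: power_mult add: mult.commute)
      then show "(monomial (l ^ i) 0 * sigma (r ^ i) (fps_to_fls (Abs_fps Y))) $$ k = fps_to_fls (Z i) $$ k"
        by (cases "k \<ge> 0") (auto simp: Z_def power_mult_distrib elim!: nonneg_int_cases)
    qed
    have "(\<Sum>i\<le>d. Z i * \<beta> i) = 0"
    proof (rule fps_ext)
      fix m
      have "fps_nth (\<Sum>i\<le>d. Z i * \<beta> i) m = (\<Sum>i\<le>d. \<Sum>j=0..m. (l * r ^ j) ^ i * Y j * fps_nth (\<beta> i) (m - j))"
        by (simp add: fps_sum_nth fps_mult_nth Z_def)
      also have "\<dots> = (\<Sum>j=0..m. \<Sum>i\<le>d. (l * r ^ j) ^ i * Y j * fps_nth (\<beta> i) (m - j))"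
        by (rule sum.swap)
      also have "\<dots> = (\<Sum>j=0..m. p (m - j) (l * r ^ j) * Y j)"
        by (simp add: p sum_distrib_left mult_ac)
      also have "\<dots> = 0"
      proof (cases "m = 0")
        case False
        have "{0..m} = insert m {..<m}" by auto
        then show ?thesis using Yk[of m] False by (simp add: mult.commute)
      qed (use root in simp)
      finally show "fps_nth (\<Sum>i\<le>d. Z i * \<beta> i) m = fps_nth 0 m" by simp
    qed
    moreover have "fps_to_fls (\<Sum>i\<le>d. Z i * \<beta> i) = (\<Sum>i\<le>d. fps_to_fls (\<beta> i) * fps_to_fls (Z i))"
      by (induction d) (auto simp: fls_times_fps_to_fls mult.commute)
    ultimately show ?thesis unfolding Z by simp
  qed
  show ?thesis by (rule that[OF conv _ sol]) (simp add: Y0)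
qed

section \<open>Small divisors and \<open>q\<close>-Pochhammer symbols\<close>

lemma geom_shift: "geom a \<Longrightarrow> geom (\<lambda>k. a (Suc k))"
proof (elim geomE)
  fix B assume B: "1 \<le> B" "\<And>n. a n \<le> B ^ (n + 1)"
  have "a (Suc k) \<le> B ^ (2 * (k + 1))" for k
    by (rule order_trans[OF B(2)[of "Suc k"] power_increasing]) (use B(1) in auto)
  then show ?thesis using B(1) by (intro geom_stretch[of B _ 2])
qed

lemma geom_unshift: "geom (\<lambda>k. a (Suc k)) \<Longrightarrow> geom a"
proof (elim geomE)
  fix B assume B: "1 \<le> B" "\<And>n. a (Suc n) \<le> B ^ (n + 1)"
  have "a k \<le> B ^ k + a 0 + \<bar>a 0\<bar>" for k
    using B(2)[of "k - 1"] B(1) by (cases k) auto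
  moreover have "geom (\<lambda>k. B ^ k + a 0 + \<bar>a 0\<bar>)"
    using B(1) by (intro geom_add geom_const geom_power) auto
  ultimately show ?thesis by (rule geom_mono[rotated])
qed

lemma qpoch_Suc_left: "qpoch l r (Suc k) = (1 - l) * (\<Prod>j<k. 1 - r ^ Suc j * l)"
  unfolding qpoch_def by (subst prod.lessThan_Suc_shift) simp

text \<open>\<open>1 - r^j z\<close> divides \<open>1 - (r^j z)^n = 1 - q^j\<close>.\<close>

lemma geom_qpoch_root:
  assumes q: "N q = 1" "\<And>k::nat. k \<ge> 1 \<Longrightarrow> q ^ k \<noteq> 1"
    and standing: "geom (\<lambda>k. inverse (N (qpoch q q k)))"
    and n: "n > 0" and r: "r ^ n = q" and z: "z ^ n = 1"
  shows "geom (\<lambda>k. inverse (\<Prod>j<k. N (1 - r ^ Suc j * z)))"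
proof -
  have Nr: "N r = 1" "N z = 1" using N_root_of_unit[OF r q(1) n] N_root_of_unit[OF z _ n] by auto
  have le: "N (1 - q ^ Suc j) \<le> real n * N (1 - r ^ Suc j * z)" for j
  proof -
    define w where "w = r ^ Suc j * z"
    have "w ^ n = q ^ Suc j"
      unfolding w_def power_mult_distrib z using r by (metis mult.commute mult.right_neutral power_mult)
    then have "1 - q ^ Suc j = (1 - w) * (\<Sum>i<n. w ^ i)" by (metis one_diff_power_eq)
    then have "N (1 - q ^ Suc j) = N (1 - w) * N (\<Sum>i<n. w ^ i)" by (simp only: N_mult)
    also have "\<dots> \<le> N (1 - w) * real n"
    proof (rule mult_left_mono)
      have "N (\<Sum>i<n. w ^ i) \<le> (\<Sum>i<n. N (w ^ i))" by (rule N_sum)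
      also have "\<dots> = real n" using Nr by (simp add: w_def N_power N_mult)
      finally show "N (\<Sum>i<n. w ^ i) \<le> real n" .
    qed simp
    finally show ?thesis by (simp add: w_def mult.commute)
  qed
  have "inverse (\<Prod>j<k. N (1 - r ^ Suc j * z)) \<le> real n ^ k * inverse (N (qpoch q q k))" for k
  proof -
    have "N (qpoch q q k) = (\<Prod>j<k. N (1 - q ^ Suc j))"
      by (simp add: qpoch_def N_prod mult.commute)
    moreover have pos: "(\<Prod>j<k. N (1 - q ^ Suc j)) > 0"
      using q(2) by (intro prod_pos) (metis N_pos One_nat_def Suc_le_mono le0 right_minus_eq)
    moreover have "(\<Prod>j<k. N (1 - q ^ Suc j)) \<le> (\<Prod>j<k. real n * N (1 - r ^ Suc j * z))"
      using le by (intro prod_mono) auto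
    then have "(\<Prod>j<k. N (1 - q ^ Suc j)) \<le> real n ^ k * (\<Prod>j<k. N (1 - r ^ Suc j * z))"
      by (simp add: prod.distrib)
    moreover from this pos have "(\<Prod>j<k. N (1 - r ^ Suc j * z)) > 0"
      using n by (smt (verit) zero_less_mult_iff zero_less_power of_nat_0_less_iff)
    ultimately show ?thesis by (simp add: field_simps)
  qed
  moreover have "geom (\<lambda>k. real n ^ k * inverse (N (qpoch q q k)))"
    using standing by (intro geom_mult geom_power) auto
  ultimately show ?thesis by (rule geom_mono[rotated])
qed

text \<open>Convergence of \<open>q_phi\<close> controls only the product over \<Lambda>. As
  \<open>N r = 1\<close>, the other symbols are at most \<open>(1 + N l') ^ k\<close>, and
  multiplying by them isolates the one of \<open>l\<close>.\<close>

lemma geom_qpoch_factor: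
  assumes conv: "convergent_fps N (q_phi r \<Lambda>)" and fin: "finite \<Lambda>" and r: "N r = 1"
    and nz: "\<And>l k. l \<in> \<Lambda> \<Longrightarrow> qpoch l r k \<noteq> 0" and l: "l \<in> \<Lambda>"
  shows "geom (\<lambda>k. inverse (N (qpoch l r k)))"
proof -
  have "geom (\<lambda>k. N (1 / (\<Prod>l\<in>\<Lambda>. qpoch l r k)))"
    using conv by (simp add: convergent_fps_iff q_phi_def)
  moreover have bd: "N (qpoch l' r k) \<le> (1 + N l') ^ k" for l' k
  proof -
    have "N (qpoch l' r k) \<le> (\<Prod>j<k. 1 + N l')"
      unfolding qpoch_def N_prod
    proof (rule prod_mono)
      fix j
      show "0 \<le> N (1 - r ^ j * l') \<and> N (1 - r ^ j * l') \<le> 1 + N l'"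
        using N_diff[of 1 "r ^ j * l'"] r by (simp add: N_mult N_power)
    qed
    then show ?thesis by simp
  qed
  have "geom (\<lambda>k. \<Prod>l'\<in>\<Lambda> - {l}. N (qpoch l' r k))"
  proof (rule geom_prod)
    show "geom (\<lambda>k. N (qpoch l' r k))" for l' by (rule geom_mono[OF geom_power bd]) simp
  qed (use fin in auto)
  ultimately have "geom (\<lambda>k. N (1 / (\<Prod>l\<in>\<Lambda>. qpoch l r k)) * (\<Prod>l'\<in>\<Lambda> - {l}. N (qpoch l' r k)))"
    by (rule geom_mult) (auto intro: prod_nonneg)
  moreover have "N (1 / (\<Prod>l\<in>\<Lambda>. qpoch l r k)) * (\<Prod>l'\<in>\<Lambda> - {l}. N (qpoch l' r k)) = inverse (N (qpoch l r k))" for k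
  proof -
    have "(\<Prod>l'\<in>\<Lambda> - {l}. N (qpoch l' r k)) \<noteq> 0" using nz fin by simp
    then show ?thesis
      unfolding prod.remove[OF fin l] by (simp add: N_divide N_mult N_prod field_simps)
  qed
  ultimately show ?thesis by simp
qed

end

text \<open>A polynomial without nonzero roots is a monomial, which cannot have two nonzero
  coefficients.\<close>

lemma alg_closed_nonzero_root:
  fixes p :: "'a::alg_closed_field poly"
  assumes "coeff p i \<noteq> 0" "coeff p j \<noteq> 0" "i \<noteq> j"
  shows "\<exists>x. x \<noteq> 0 \<and> poly p x = 0"
proof (rule ccontr)
  assume no: "\<not> ?thesis"
  have p0: "p \<noteq> 0" using assms by auto
  obtain A where A: "p = Polynomial.smult (lead_coeff p) (\<Prod>x\<in>#A. [:-x, 1:])"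
    using alg_closed_imp_factorization[OF p0] by blast
  have "x = 0" if "x \<in># A" for x
  proof -
    have "[:-x, 1:] dvd p" using that by (subst A) (intro dvd_smult dvd_prod_mset, auto)
    then show ?thesis using no by (auto simp: poly_eq_0_iff_dvd)
  qed
  then have "set_mset A \<subseteq> {0}" by auto
  then obtain k where k: "A = replicate_mset k 0" using set_mset_subset_singletonD by metis
  then have "(\<Prod>x\<in>#A. [:-x, 1:]) = [:0, 1:] ^ k" by simp
  then have "p = monom (lead_coeff p) k"
    using A by (simp add: monom_altdef)
  then have "i = k" "j = k" using assms by (metis coeff_monom)+
  then show False using assms by simp
qed

section \<open>Exponents, and the convergent solution belonging to a slope\<close>

lemma finite_exponents: "char_polynomial r \<mu> L \<noteq> 0 \<Longrightarrow> finite (exponents r \<mu> L)"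
  unfolding exponents_def by (rule finite_subset[OF _ poly_roots_finite]) auto

lemma finite_exponent_quotients:
  assumes "char_polynomial r \<mu> L \<noteq> 0"
  shows "finite (exponent_quotients r \<mu> L)"
proof (rule finite_subset)
  show "exponent_quotients r \<mu> L \<subseteq> (\<lambda>(l, l'). l / l') ` (exponents r \<mu> L \<times> exponents r \<mu> L)"
    by (auto simp: exponent_quotients_def)
qed (use finite_exponents[OF assms] in auto)

lemma qpoch_exponent_quotients:
  assumes "l \<in> exponent_quotients r \<mu> L" "r \<noteq> 0"
  shows "qpoch l r k \<noteq> 0"
proof
  assume "qpoch l r k = 0"
  then obtain j where "1 - r ^ j * l = 0" by (auto simp: qpoch_def)
  then have "l = r powi (- int j)" using assms(2) by (simp add: power_int_minus field_simps)
  then show False using assms(1) by (auto simp: exponent_quotients_def)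
qed

text \<open>The index \<open>i\<close> lies on the supporting line of slope
  \<open>\<mu> / n\<close>, and the coefficients on this line survive in the characteristic
  polynomial.\<close>

lemma coeff_char_polynomial_ramify_nonzero:
  assumes r: "r \<noteq> 0" and n: "n > 0"
    and min: "\<And>k. coeff L k \<noteq> 0 \<Longrightarrow> int n * fls_subdegree (coeff L i) - \<mu> * int i \<le> int n * fls_subdegree (coeff L k) - \<mu> * int k"
    and i: "coeff L i \<noteq> 0"
  shows "coeff (char_polynomial r \<mu> (ramify n L)) i \<noteq> 0"
proof -
  let ?T = "twist r \<mu> (ramify n L)"
  have "x_order ?T = int n * fls_subdegree (coeff L i) - \<mu> * int i"
    by (rule x_order_eqI[of _ i]) (use r n i min in \<open>auto simp: fls_subdegree_twist_ramify\<close>)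
  then have "x_order ?T = fls_subdegree (coeff ?T i)"
    using r n i by (simp add: fls_subdegree_twist_ramify)
  moreover have "coeff ?T i \<noteq> 0" using r n i by simp
  ultimately show ?thesis by (simp add: coeff_char_polynomial)
qed

text \<open>The exponent \<open>l\<close> is chosen so that no \<open>l r^k\<close> with \<open>k > 0\<close> is an exponent; then all small
  divisors come from the pairs excluded by admissibility or from \<open>(q;q)_k\<close>.\<close>

lemma exists_convergent_solution:
  fixes N :: "'c::alg_closed_field \<Rightarrow> real" and L :: "'c fls poly"
  assumes N: "absval N" and q: "N q = 1" "\<And>k::nat. k \<ge> 1 \<Longrightarrow> q ^ k \<noteq> 1"
    and standing: "geom (\<lambda>k. inverse (N (qpoch q q k)))"
    and n: "n > 0" and r: "r ^ n = q" and L: "\<And>i. coeff L i \<in> K_field N"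
    and ij: "coeff L i \<noteq> 0" "coeff L j \<noteq> 0" "i \<noteq> j"
    and min: "\<And>k. coeff L k \<noteq> 0 \<Longrightarrow> int n * fls_subdegree (coeff L i) - \<mu> * int i \<le> int n * fls_subdegree (coeff L k) - \<mu> * int k"
    and eq: "int n * fls_subdegree (coeff L j) - \<mu> * int j = int n * fls_subdegree (coeff L i) - \<mu> * int i"
    and adm: "admissible_slope N r \<mu> (ramify n L)"
  obtains l v where "l \<noteq> 0" "v \<in> K_field N" "fls_nth v 0 = 1"
    "(\<Sum>i\<le>degree L. fls_compose_power (coeff L i) n * Spow r \<mu> l (int i) v) = 0"
proof -
  interpret absval N by fact
  have Nr: "N r = 1" using N_root_of_unit[OF r q(1) n] .
  then have r0: "r \<noteq> 0" by auto
  have rroot: "r ^ k \<noteq> 1" if "k \<ge> 1" for k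
  proof
    assume "r ^ k = 1"
    then have "q ^ k = 1" unfolding r[symmetric] by (metis mult.commute power_mult power_one)
    then show False using q(2)[OF that] by simp
  qed
  define T where "T = twist r \<mu> (ramify n L)"
  define ch where "ch = char_polynomial r \<mu> (ramify n L)"
  have ci: "coeff ch i \<noteq> 0" unfolding ch_def by (rule coeff_char_polynomial_ramify_nonzero[OF r0 n min ij(1)])
  have cj: "coeff ch j \<noteq> 0" unfolding ch_def
    by (rule coeff_char_polynomial_ramify_nonzero[OF r0 n _ ij(2)]) (use min eq in auto)
  have ch0: "ch \<noteq> 0" using ci by auto
  define E where "E = exponents r \<mu> (ramify n L)"
  have E_iff: "x \<in> E \<longleftrightarrow> x \<noteq> 0 \<and> poly ch x = 0" for x by (simp add: E_def exponents_def ch_def)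
  have finE: "finite E" unfolding E_def using ch0 unfolding ch_def by (rule finite_exponents)
  obtain l0 where l0: "l0 \<in> E" using alg_closed_nonzero_root[OF ci cj ij(3)] E_iff by blast
  obtain l where lE: "l \<in> E" and lmax: "\<And>k. k > 0 \<Longrightarrow> l * r ^ k \<notin> E"
  proof -
    \<comment> \<open>\<open>E\<close> is finite and \<open>r\<close> is not a root of unity, so
      only finitely many \<open>l0 * r ^ k\<close> lie in \<open>E\<close>; the last of them is
      taken as \<open>l\<close>.\<close>
    define Ks where "Ks = {k::nat. l0 * r ^ k \<in> E}"
    have "inj_on (\<lambda>k. l0 * r ^ k) Ks"
    proof (rule linorder_inj_onI)
      fix a b :: nat assume ab: "a < b"
      have "r ^ b = r ^ a * r ^ (b - a)" using ab by (simp flip: power_add)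
      then show "l0 * r ^ a \<noteq> l0 * r ^ b" using rroot[of "b - a"] ab r0 l0 E_iff by auto
    qed auto
    moreover have "finite ((\<lambda>k. l0 * r ^ k) ` Ks)"
      by (rule finite_subset[OF _ finE]) (auto simp: Ks_def)
    ultimately have finK: "finite Ks" by (rule finite_imageD[rotated])
    have "0 \<in> Ks" using l0 by (simp add: Ks_def)
    then have M: "Max Ks \<in> Ks" using finK by (intro Max_in) auto
    show ?thesis
    proof (rule that[of "l0 * r ^ Max Ks"])
      show "l0 * r ^ Max Ks \<in> E" using M by (simp add: Ks_def)
      fix k :: nat assume k: "k > 0"
      have "Max Ks + k \<notin> Ks" using Max_ge[OF finK, of "Max Ks + k"] k by auto
      then show "l0 * r ^ Max Ks * r ^ k \<notin> E" by (simp add: Ks_def power_add mult.assoc)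
    qed
  qed
  have l: "l \<noteq> 0" "poly ch l = 0" using lE E_iff by auto
  define \<Lambda> where "\<Lambda> = exponent_quotients r \<mu> (ramify n L)"
  have fin\<Lambda>: "finite \<Lambda>" unfolding \<Lambda>_def using ch0 unfolding ch_def by (rule finite_exponent_quotients)
  have conv: "convergent_fps N (q_phi r \<Lambda>)" using adm by (simp add: admissible_slope_def \<Lambda>_def)
  \<comment> \<open>\<open>ch\<close> splits into linear factors, so the divisors are treated one
    root \<open>x\<close> at a time; the root 0 contributes factors of constant norm.\<close>
  have factor: "geom (\<lambda>k. inverse (\<Prod>j<k. N (l * r ^ Suc j - x)))" if x: "poly ch x = 0" for x
  proof (cases "x = 0")
    case True
    have "geom (\<lambda>k. inverse (N l) ^ k)" by (rule geom_power) simp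
    then show ?thesis using True Nr by (simp add: N_mult N_power power_inverse)
  next
    case x0: False
    then have xE: "x \<in> E" using x E_iff by simp
    have prod: "inverse (\<Prod>j<k. N (l * r ^ Suc j - x)) = inverse (N x) ^ k * inverse (\<Prod>j<k. N (1 - r ^ Suc j * (l / x)))" for k
    proof -
      have "N (l * r ^ Suc j - x) = N x * N (1 - r ^ Suc j * (l / x))" for j
      proof -
        have "l * r ^ Suc j - x = - (x * (1 - r ^ Suc j * (l / x)))" using x0 by (simp add: field_simps)
        then show ?thesis by (simp only: N_minus N_mult)
      qed
      then show ?thesis by (simp add: prod.distrib inverse_mult_distrib power_inverse)
    qed
    have "geom (\<lambda>k. inverse (\<Prod>j<k. N (1 - r ^ Suc j * (l / x))))"
    proof (cases "x = l")
      case True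
      then show ?thesis using geom_qpoch_root[OF q standing n r, of 1] l by simp
    next
      case False
      \<comment> \<open>Otherwise \<open>x\<close> would be \<open>l * r ^ k\<close> with some
        \<open>k > 0\<close>, against the choice of \<open>l\<close>; hence \<open>l / x\<close> is
        one of the quotients that admissibility controls.\<close>
      have "l / x \<noteq> r powi k" if "k \<le> 0" for k
      proof
        assume "l / x = r powi k"
        then have "x = l * r ^ nat (- k)" using that x0 r0
          by (simp add: power_int_def field_simps split: if_splits)
        then show False using lmax[of "nat (- k)"] xE False by (cases "nat (- k) = 0") auto
      qed
      then have mem: "l / x \<in> \<Lambda>" using lE xE unfolding \<Lambda>_def exponent_quotients_def E_def by blast
      have "geom (\<lambda>k. inverse (N (qpoch (l / x) r k)))"
      proof (rule geom_qpoch_factor[OF conv fin\<Lambda> Nr _ mem])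
        show "qpoch l' r k \<noteq> 0" if "l' \<in> \<Lambda>" for l' k
          using qpoch_exponent_quotients[OF that[unfolded \<Lambda>_def] r0] .
      qed
      \<comment> \<open>The divisors start at index 1, so the factor \<open>1 - l / x\<close> of
        index 0 is removed from the symbol.\<close>
      then have "geom (\<lambda>k. N (1 - l / x) * inverse (N (qpoch (l / x) r (Suc k))))"
        by (intro geom_mult geom_const geom_shift) auto
      moreover have "N (1 - l / x) * inverse (N (qpoch (l / x) r (Suc k)))
          = inverse (\<Prod>j<k. N (1 - r ^ Suc j * (l / x)))" for k
      proof -
        have "a * inverse (a * b) = inverse b" if "a \<noteq> 0" for a b :: real using that by simp
        moreover have "N (1 - l / x) \<noteq> 0" using False x0 by simp
        ultimately show ?thesis unfolding qpoch_Suc_left N_mult N_prod by blast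
      qed
      ultimately show ?thesis by (simp only:)
    qed
    then have "geom (\<lambda>k. inverse (N x) ^ k * inverse (\<Prod>j<k. N (1 - r ^ Suc j * (l / x))))"
      by (intro geom_mult geom_power) (auto intro!: prod_nonneg)
    then show ?thesis unfolding prod .
  qed
  obtain A where A: "ch = Polynomial.smult (lead_coeff ch) (\<Prod>x\<in>#A. [:-x, 1:])"
    using alg_closed_imp_factorization[OF ch0] by blast
  have A_root: "poly ch x = 0" if "x \<in># A" for x
  proof -
    have "[:-x, 1:] dvd ch" using that by (subst A) (intro dvd_smult dvd_prod_mset, auto)
    then show ?thesis by (simp add: poly_eq_0_iff_dvd)
  qed
  have prod_A: "geom (\<lambda>k. inverse (\<Prod>j<k. N (poly (\<Prod>x\<in>#A. [:-x, 1:]) (l * r ^ Suc j))))"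
    using A_root
  proof (induction A)
    case empty
    then show ?case using geom_const[of 1] by simp
  next
    case (add x A)
    have "geom (\<lambda>k. inverse (\<Prod>j<k. N (l * r ^ Suc j - x)) * inverse (\<Prod>j<k. N (poly (\<Prod>x\<in>#A. [:-x, 1:]) (l * r ^ Suc j))))"
      using add by (intro geom_mult factor) (auto intro!: prod_nonneg)
    moreover have "poly (\<Prod>x\<in>#add_mset x A. [:-x, 1:]) y = (y - x) * poly (\<Prod>x\<in>#A. [:-x, 1:]) y" for y
      by (simp add: algebra_simps)
    ultimately show ?case by (simp only: N_mult prod.distrib inverse_mult_distrib)
  qed
  have small: "geom (\<lambda>k. inverse (\<Prod>j<k. N (poly ch (l * r ^ Suc j))))"
  proof -
    have "geom (\<lambda>k. inverse (N (lead_coeff ch)) ^ k * inverse (\<Prod>j<k. N (poly (\<Prod>x\<in>#A. [:-x, 1:]) (l * r ^ Suc j))))"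
      using prod_A by (intro geom_mult geom_power) (auto intro!: prod_nonneg)
    moreover have "inverse (\<Prod>j<k. N (poly ch (l * r ^ Suc j)))
        = inverse (N (lead_coeff ch)) ^ k * inverse (\<Prod>j<k. N (poly (\<Prod>x\<in>#A. [:-x, 1:]) (l * r ^ Suc j)))" for k
      by (subst A) (simp add: N_mult prod.distrib power_inverse)
    ultimately show ?thesis by simp
  qed
  \<comment> \<open>The twisted operator is \<open>t^m0\<close> times the operator with the power
    series coefficients \<open>\<beta> i\<close>, whose constant terms are the coefficients of
    \<open>ch\<close>.\<close>
  define m0 where "m0 = x_order T"
  define \<beta> where "\<beta> i = fls_regpart (coeff (clear_x T) i)" for i
  have T0: "coeff T i = 0 \<longleftrightarrow> coeff L i = 0" for i unfolding T_def using r0 n by simp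
  have "T \<noteq> 0" using T0[of i] ij(1) by (metis coeff_0)
  have \<beta>_eq: "fps_to_fls (\<beta> i) = coeff (clear_x T) i" for i
  proof -
    have "fls_subdegree (coeff (clear_x T) i) \<ge> 0"
      using x_order_exists(2)[OF \<open>T \<noteq> 0\<close>, of i]
      by (cases "coeff T i = 0") (auto simp: fls_subdegree_coeff_clear_x coeff_clear_x)
    then show ?thesis unfolding \<beta>_def by simp
  qed
  have TK: "coeff T i \<in> K_field N" for i
    unfolding T_def using L by (simp add: coeff_twist[OF r0] coeff_ramify K_field_closed(5) K_field_compose_power)
  have \<beta>conv: "convergent_fps N (\<beta> i)" for i
    using TK[of i] unfolding germ_fps_to_fls[symmetric] \<beta>_eq K_field_iff[symmetric] coeff_clear_x by auto
  have ch\<beta>: "poly ch y = (\<Sum>i\<le>degree L. fps_nth (\<beta> i) 0 * y ^ i)" for y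
  proof -
    have c: "coeff ch i = fps_nth (\<beta> i) 0" for i
      by (simp add: ch_def \<beta>_def coeff_char_polynomial T_def coeff_clear_x)
    have "degree ch \<le> degree L"
    proof (rule degree_le, intro allI impI)
      fix i assume "degree L < i"
      then show "coeff ch i = 0" using T0[of i] by (simp add: c \<beta>_def coeff_clear_x coeff_eq_0)
    qed
    then have "(\<Sum>i\<le>degree L. coeff ch i * y ^ i) = (\<Sum>i\<le>degree ch. coeff ch i * y ^ i)"
      by (intro sum.mono_neutral_right) (auto simp: coeff_eq_0)
    then show ?thesis by (simp add: poly_altdef c)
  qed
  obtain y where y: "convergent_fps N y" "fps_nth y 0 = 1"
    and ysol: "(\<Sum>i\<le>degree L. fps_to_fls (\<beta> i) * (monomial (l ^ i) 0 * sigma (r ^ i) (fps_to_fls y))) = 0"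
  proof (rule convergent_solution[where \<beta> = \<beta> and d = "degree L" and l = l and r = r
        and p = "\<lambda>m y. \<Sum>i\<le>degree L. fps_nth (\<beta> i) m * y ^ i"])
    show "(\<Sum>i\<le>degree L. fps_nth (\<beta> i) 0 * l ^ i) = 0" using l by (simp flip: ch\<beta>)
    show "(\<Sum>i\<le>degree L. fps_nth (\<beta> i) 0 * (l * r ^ k) ^ i) \<noteq> 0" if "k > 0" for k
      unfolding ch\<beta>[symmetric] using lmax[OF that] E_iff[of "l * r ^ k"] l r0 by simp
    show "geom (\<lambda>k. inverse (\<Prod>j<k. N (\<Sum>i\<le>degree L. fps_nth (\<beta> i) 0 * (l * r ^ Suc j) ^ i)))"
      using small unfolding ch\<beta> .
  qed (use \<beta>conv Nr in auto)
  have "(\<Sum>i\<le>degree L. fls_compose_power (coeff L i) n * Spow r \<mu> l (int i) (fps_to_fls y))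
      = monomial 1 m0 * (\<Sum>i\<le>degree L. fps_to_fls (\<beta> i) * (monomial (l ^ i) 0 * sigma (r ^ i) (fps_to_fls y)))"
    unfolding sum_distrib_left
  proof (rule sum.cong)
    fix i
    have "coeff T i = monomial 1 m0 * fps_to_fls (\<beta> i)"
      unfolding \<beta>_eq coeff_clear_x m0_def by simp
    then have "monomial 1 m0 * (fps_to_fls (\<beta> i) * (monomial (l ^ i) 0 * sigma (r ^ i) (fps_to_fls y)))
        = coeff T i * (monomial (l ^ i) 0 * sigma (r ^ i) (fps_to_fls y))" by (simp add: mult.assoc)
    also have "\<dots> = fls_compose_power (coeff L i) n * Spow r \<mu> l (int i) (fps_to_fls y)"
      by (simp add: T_def coeff_twist[OF r0] coeff_ramify Spow_def Spow_coeff_def mult.assoc mult.commute[of "l ^ i"])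
    finally show "fls_compose_power (coeff L i) n * Spow r \<mu> l (int i) (fps_to_fls y)
        = monomial 1 m0 * (fps_to_fls (\<beta> i) * (monomial (l ^ i) 0 * sigma (r ^ i) (fps_to_fls y)))" ..
  qed simp
  then have "(\<Sum>i\<le>degree L. fls_compose_power (coeff L i) n * Spow r \<mu> l (int i) (fps_to_fls y)) = 0"
    using ysol by simp
  then show ?thesis
    using l y by (intro that[of l "fps_to_fls y"]) (auto simp: K_field_iff germ_fps_to_fls)
qed

section \<open>Irreducible modules\<close>

text \<open>If \<open>L\<close> has a single term, it is invertible and its module is zero.\<close>

lemma (in absval) operator_module_two_coeffs:
  assumes L: "L \<noteq> 0" "\<And>i. coeff L i \<in> K" and q: "q \<noteq> 0"
    and iso: "qdm_iso K M (operator_module K q L)"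
    and M: "qdiff_module K q M" "qdm_irreducible K M"
  obtains i j where "coeff L i \<noteq> 0" "coeff L j \<noteq> 0" "i \<noteq> j"
proof -
  have i: "coeff L (degree L) \<noteq> 0" using L by simp
  define d where "d = int (degree L)"
  define a where "a = coeff L (degree L)"
  show ?thesis
  proof (cases "\<exists>j. j \<noteq> degree L \<and> coeff L j \<noteq> 0")
    case True
    then show ?thesis using that i by metis
  next
    case False
    have sL: "skew_of_poly L = skew_monom a d"
    proof
      fix k
      show "skew_of_poly L k = skew_monom a d k"
      proof (cases "k = d")
        case kd: False
        then have "k \<ge> 0 \<Longrightarrow> nat k \<noteq> degree L" by (auto simp: d_def)
        then show ?thesis using kd False by (auto simp: skew_of_poly_def skew_monom_def)
      qed (simp add: skew_of_poly_def skew_monom_def d_def a_def)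
    qed
    have all: "P \<in> I q L" if P: "P \<in> carrier (D q)" for P
    proof -
      \<comment> \<open>For \<open>L = a \<sigma>^d\<close> this is the product of \<open>P\<close>
        with the inverse of \<open>L\<close> in the skew ring.\<close>
      define Q where "Q j = P (j + d) * inverse (sigma (q powi j) a)" for j
      have "Q j \<in> K" for j
        unfolding Q_def using P L(2) by (intro K_field_closed) (auto simp: skew_laurent_simps a_def)
      moreover have "finite {j. Q j \<noteq> 0}"
      proof (rule finite_subset)
        show "{j. Q j \<noteq> 0} \<subseteq> (\<lambda>k. k - d) ` {k. P k \<noteq> 0}"
          by (auto simp: Q_def image_iff intro!: exI[of _ "_ + d"])
      qed (use P in \<open>auto simp: skew_laurent_simps\<close>)
      ultimately have Q: "Q \<in> carrier (D q)" by (auto simp: skew_laurent_simps)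
      have "P = Q \<otimes>\<^bsub>D q\<^esub> skew_of_poly L"
      proof
        fix k
        have "(Q \<otimes>\<^bsub>D q\<^esub> skew_of_poly L) k = (\<Sum>i\<in>{i. Q i \<noteq> 0} \<union> {k - d}. Q i * sigma (q powi i) (skew_of_poly L (k - i)))"
          using Q by (intro skew_mult_superset) (auto simp: skew_laurent_simps)
        also have "\<dots> = (\<Sum>i\<in>{i. Q i \<noteq> 0} \<union> {k - d}. if i = k - d then Q i * sigma (q powi i) a else 0)"
          unfolding sL by (intro sum.cong) (auto simp: skew_monom_def)
        also have "\<dots> = Q (k - d) * sigma (q powi (k - d)) a"
          using Q by (subst sum.delta) (auto simp: skew_laurent_simps)
        also have "\<dots> = P k" using i q by (simp add: Q_def a_def)
        finally show "P k = (Q \<otimes>\<^bsub>D q\<^esub> skew_of_poly L) k" ..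
      qed
      then show ?thesis using Q unfolding left_ideal_gen_def by blast
    qed
    have IC: "h \<in> carrier (D q)" if "h \<in> I q L" for h
    proof -
      have "skew_of_poly L \<in> carrier (D q)"
        unfolding sL a_def using L(2) by (intro skew_carrier_closed(2))
      then show ?thesis using that unfolding left_ideal_gen_def by (auto intro: skew_carrier_closed(5))
    qed
    have "{\<lambda>k. h k + b k |h. h \<in> I q L} = I q L" if b: "b \<in> carrier (D q)" for b
    proof (intro equalityI subsetI)
      fix P assume "P \<in> {\<lambda>k. h k + b k |h. h \<in> I q L}"
      then obtain h where h: "h \<in> I q L" "P = (\<lambda>k. h k + b k)" by blast
      show "P \<in> I q L" unfolding h(2) by (rule all[OF skew_carrier_closed(3)[OF IC[OF h(1)] b]])
    next
      fix P assume P: "P \<in> I q L"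
      have "(\<lambda>k. P k + - b k) \<in> I q L" 
        by (rule all[OF skew_carrier_closed(3)[OF IC[OF P] skew_carrier_closed(4)[OF b]]])
      then show "P \<in> {\<lambda>k. h k + b k |h. h \<in> I q L}" by force
    qed
    then have one: "carrier (operator_module K q L) \<subseteq> {I q L}"
      unfolding operator_module_simps by blast
    obtain h where h: "bij_betw h (carrier M) (carrier (operator_module K q L))"
      using iso unfolding qdm_iso_def by blast
    interpret M: module "fls_subring K" M using qdiff_moduleD[OF M(1)] by blast
    have "x = \<zero>\<^bsub>M\<^esub>" if "x \<in> carrier M" for x
      using h that one M.zero_closed unfolding bij_betw_def inj_on_def by (metis image_subset_iff singletonD)
    then have "carrier M = {\<zero>\<^bsub>M\<^esub>}" using M.zero_closed by blast
    then show ?thesis using M(2) unfolding qdm_irreducible_def by blast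
  qed
qed

text \<open>The target of \<phi> is known to be irreducible only once the fraction is reduced. The
  descent keeps the coefficient of index 0, so the normalisation of \<open>\<phi> m\<close> prevents
  the composite from vanishing. The bound \<open>n0 \<le> n\<close> serves the admissible case,
  where \<open>n = 1\<close>.\<close>

lemma irreducible_iso_N_module:
  fixes N :: "'c::alg_closed_field \<Rightarrow> real" and qr :: "nat \<Rightarrow> 'c"
  assumes N: "absval N" and q: "q \<noteq> 0" "\<And>k::nat. k \<ge> 1 \<Longrightarrow> q ^ k \<noteq> 1"
    and qr: "\<And>n::nat. n \<ge> 1 \<Longrightarrow> qr n ^ n = q"
    and n: "n \<ge> 1" and l: "l \<noteq> 0"
    and M: "qdiff_module (K_field N) q M" "qdm_irreducible (K_field N) M"
    and \<phi>: "\<phi> \<in> qdm_hom (K_field N) M (N_module (K_field N) n (qr n) \<mu> l)"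
    and m: "m \<in> carrier M" "fls_nth (\<phi> m) 0 = 1"
  obtains n0 \<mu>0 l0 where "n0 > 0" "n0 \<le> n" "coprime (int n0) \<mu>0" "l0 \<noteq> 0"
    "qdm_iso (K_field N) M (N_module (K_field N) n0 (qr n0) \<mu>0 l0)"
proof -
  interpret absval N by fact
  have qr0: "qr k \<noteq> 0" if "k \<ge> 1" for k using qr[OF that] q that by (metis power_0_left not_one_le_zero)
  define d where "d = nat (gcd (int n) \<mu>)"
  have dg: "int d = gcd (int n) \<mu>" by (simp add: d_def)
  have d: "d > 0" using n unfolding d_def by (metis gcd_pos_int not_one_le_zero of_nat_eq_0_iff zero_less_nat_eq)
  have "int d dvd int n" "int d dvd \<mu>" unfolding dg by auto
  then obtain n0 \<mu>0 where n0: "n = d * n0" and \<mu>0: "\<mu> = int d * \<mu>0"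
    by (metis dvdE int_dvd_int_iff)
  have n0pos: "n0 > 0" using n n0 by (cases n0) auto
  have "int d * gcd (int n0) \<mu>0 = int d"
  proof -
    have "gcd (int d * int n0) (int d * \<mu>0) = int d * gcd (int n0) \<mu>0"
      by (simp add: gcd_mult_left)
    then show ?thesis using dg unfolding n0 \<mu>0 by simp
  qed
  then have cop: "coprime (int n0) \<mu>0" using d by (simp add: coprime_iff_gcd_eq_1)
  have sq: "\<exists>\<omega>. \<omega> ^ 2 = \<zeta>" for \<zeta> :: 'c using nth_root_exists[of 2 \<zeta>] by auto
  have rn: "qr n ^ (d * n0) = q" using qr[OF n] n0 by simp
  have rn0: "qr n0 ^ n0 = q" using qr[of n0] n0pos by simp
  have qr0n: "qr n0 \<noteq> 0" using qr0[of n0] n0pos by simp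
  have "\<exists>l0 h. l0 \<noteq> 0 \<and> (\<forall>v. fls_nth (h v) 0 = fls_nth v 0) \<and>
      h \<in> qdm_hom (K_field N) (N_module (K_field N) n (qr n) \<mu> l) (N_module (K_field N) n0 (qr n0) \<mu>0 l0)"
  proof (rule N_module_descent[OF sq d n0pos cop qr0[OF n] qr0n l rn rn0, folded n0 \<mu>0])
    fix l0 h assume "l0 \<noteq> 0" and hv: "\<And>v. fls_nth (h v) 0 = fls_nth v 0"
      and "h \<in> qdm_hom (K_field N) (N_module (K_field N) n (qr n) \<mu> l) (N_module (K_field N) n0 (qr n0) \<mu>0 l0)"
    moreover from hv have "\<forall>v. fls_nth (h v) 0 = fls_nth v 0" by (rule allI)
    ultimately show "\<exists>l0 h. l0 \<noteq> 0 \<and> (\<forall>v. fls_nth (h v) 0 = fls_nth v 0) \<and>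
      h \<in> qdm_hom (K_field N) (N_module (K_field N) n (qr n) \<mu> l) (N_module (K_field N) n0 (qr n0) \<mu>0 l0)"
      by blast
  qed
  then obtain l0 h where l0: "l0 \<noteq> 0" and h0: "\<forall>v. fls_nth (h v) 0 = fls_nth v 0"
    and h: "h \<in> qdm_hom (K_field N) (N_module (K_field N) n (qr n) \<mu> l) (N_module (K_field N) n0 (qr n0) \<mu>0 l0)"
    by blast
  have "qdm_iso (K_field N) M (N_module (K_field N) n0 (qr n0) \<mu>0 l0)"
  proof (rule schur[OF M])
    show "qdiff_module (K_field N) q (N_module (K_field N) n0 (qr n0) \<mu>0 l0)"
      using n0pos rn0 qr0n l0 by (intro qdiff_module_N_module) auto
    show "qdm_irreducible (K_field N) (N_module (K_field N) n0 (qr n0) \<mu>0 l0)"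
      using n0pos rn0 qr0n l0 q(2) cop by (intro irreducible_N_module[where q = q]) auto
    show "(\<lambda>x. h (\<phi> x)) \<in> qdm_hom (K_field N) M (N_module (K_field N) n0 (qr n0) \<mu>0 l0)"
      by (rule qdm_hom_compose[OF \<phi> h])
    show "m \<in> carrier M" by fact
    have "fls_nth (h (\<phi> m)) 0 \<noteq> 0" using h0 m by simp
    then show "h (\<phi> m) \<noteq> \<zero>\<^bsub>N_module (K_field N) n0 (qr n0) \<mu>0 l0\<^esub>" using n0pos by auto
  qed
  moreover have "n0 \<le> n" using d unfolding n0 by simp
  ultimately show ?thesis using that n0pos cop l0 by blast
qed

text \<open>Scaling by \<open>n\<close> turns the supporting line of real slope \<open>s\<close>
  into integer inequalities for the ramified operator, with slope \<mu>.\<close>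

lemma slope_solution:
  fixes N :: "'c::alg_closed_field \<Rightarrow> real"
  assumes N: "absval N" and q: "N q = 1" "\<And>k::nat. k \<ge> 1 \<Longrightarrow> q ^ k \<noteq> 1"
    and standing: "geom (\<lambda>k. inverse (N (qpoch q q k)))"
    and L: "\<And>i. coeff L i \<in> K_field N" and ij: "coeff L i \<noteq> 0" "coeff L j \<noteq> 0" "i < j"
    and slope: "real (j - i) * s = real_of_int (fls_subdegree (coeff L j) - fls_subdegree (coeff L i))"
    and low: "\<And>k. coeff L k \<noteq> 0 \<Longrightarrow>
      real_of_int (fls_subdegree (coeff L i)) - s * real i \<le> real_of_int (fls_subdegree (coeff L k)) - s * real k"
    and n: "n \<ge> 1" and r: "r ^ n = q" and \<mu>: "real n * s = of_int \<mu>"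
    and adm: "admissible_slope N r \<mu> (ramify n L)"
  obtains l v where "l \<noteq> 0" "v \<in> K_field N" "fls_nth v 0 = 1"
    "(\<Sum>i\<le>degree L. fls_compose_power (coeff L i) n * Spow r \<mu> l (int i) v) = 0"
proof -
  have scale: "real_of_int (int n * fls_subdegree (coeff L k) - \<mu> * int k)
      = real n * (real_of_int (fls_subdegree (coeff L k)) - s * real k)" for k
    using \<mu> by (simp add: right_diff_distrib flip: mult.assoc)
  have min: "int n * fls_subdegree (coeff L i) - \<mu> * int i \<le> int n * fls_subdegree (coeff L k) - \<mu> * int k"
    if "coeff L k \<noteq> 0" for k
    unfolding of_int_le_iff[where 'a = real, symmetric] scale using low[OF that] by (intro mult_left_mono) auto
  have eq: "int n * fls_subdegree (coeff L j) - \<mu> * int j = int n * fls_subdegree (coeff L i) - \<mu> * int i"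
  proof -
    have "real_of_int (fls_subdegree (coeff L j)) - s * real j = real_of_int (fls_subdegree (coeff L i)) - s * real i"
      using slope ij(3) by (simp add: of_nat_diff algebra_simps)
    then show ?thesis unfolding of_int_eq_iff[where 'a = real, symmetric] scale by (simp only:)
  qed
  show ?thesis
    by (rule exists_convergent_solution[OF N q standing _ r L ij(1,2) _ min eq adm that])
      (use n ij in auto)
qed

section \<open>Formal modules are cyclic\<close>

text \<open>Elimination: an unknown \<open>p\<close> with nonzero coefficient in the equation
  \<open>x\<close> is solved for, which leaves one equation and one unknown less.\<close>

lemma nontrivial_relation:
  fixes c :: "'i \<Rightarrow> 'b \<Rightarrow> 'a::field"
  assumes "finite B" "finite J" "card B < card J"
  shows "\<exists>a. (\<exists>i\<in>J. a i \<noteq> 0) \<and> (\<forall>b\<in>B. (\<Sum>i\<in>J. a i * c i b) = 0)"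
  using assms
proof (induction B arbitrary: c J rule: finite_induct)
  case empty
  then have "J \<noteq> {}" by auto
  then show ?case by (intro exI[of _ "\<lambda>_. 1"]) auto
next
  case (insert x B)
  show ?case
  proof (cases "\<forall>i\<in>J. c i x = 0")
    case True
    obtain a where a: "\<exists>i\<in>J. a i \<noteq> 0" "\<forall>b\<in>B. (\<Sum>i\<in>J. a i * c i b) = 0"
      using insert.IH[of J c] insert.prems insert.hyps by auto
    have "(\<Sum>i\<in>J. a i * c i x) = 0" using True by simp
    then show ?thesis using a by (intro exI[of _ a]) auto
  next
    case False
    then obtain p where p: "p \<in> J" "c p x \<noteq> 0" by blast
    define c' where "c' i b = c i b - c i x / c p x * c p b" for i b
    have "card B < card (J - {p})" using insert.prems insert.hyps p by simp
    then obtain a where a: "\<exists>i\<in>J - {p}. a i \<noteq> 0" "\<forall>b\<in>B. (\<Sum>i\<in>J - {p}. a i * c' i b) = 0"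
      using insert.IH[of "J - {p}" c'] insert.prems by blast
    \<comment> \<open>The value of the eliminated unknown that satisfies the equation
      \<open>x\<close>.\<close>
    define t where "t = - (\<Sum>i\<in>J - {p}. a i * c i x) / c p x"
    define a' where "a' = a(p := t)"
    have split: "(\<Sum>i\<in>J. a' i * c i b) = t * c p b + (\<Sum>i\<in>J - {p}. a i * c i b)" for b
      using insert.prems p by (simp add: sum.remove[of J p] a'_def)
    have "(\<Sum>i\<in>J. a' i * c i x) = 0" unfolding split using p by (simp add: t_def)
    moreover have "(\<Sum>i\<in>J. a' i * c i b) = 0" if "b \<in> B" for b
    proof -
      have "0 = (\<Sum>i\<in>J - {p}. a i * c' i b)" using a that by simp
      also have "\<dots> = (\<Sum>i\<in>J - {p}. a i * c i b) - (\<Sum>i\<in>J - {p}. a i * c i x) * (c p b / c p x)"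
      proof -
        have "a i * c' i b = a i * c i b - a i * c i x * (c p b / c p x)" for i
          by (simp add: c'_def right_diff_distrib)
        then show ?thesis by (simp only: sum_subtractf sum_distrib_right)
      qed
      also have "\<dots> = (\<Sum>i\<in>J. a' i * c i b)" unfolding split by (simp add: t_def)
      finally show ?thesis ..
    qed
    moreover have "\<exists>i\<in>J. a' i \<noteq> 0" using a(1) by (auto simp: a'_def)
    ultimately show ?thesis by (intro exI[of _ a']) auto
  qed
qed

section \<open>Orbits of \<Sigma> and cyclic vectors\<close>

primrec lincomb :: "('c::field fls, 'm, 'e) module_scheme \<Rightarrow> (nat \<Rightarrow> 'm) \<Rightarrow> nat \<Rightarrow> (nat \<Rightarrow> 'c fls) \<Rightarrow> 'm" where
  "lincomb M e 0 a = \<zero>\<^bsub>M\<^esub>"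
| "lincomb M e (Suc n) a = lincomb M e n a \<oplus>\<^bsub>M\<^esub> a n \<odot>\<^bsub>M\<^esub> e n"

locale formal_module =
  fixes M :: "('c::field fls, 'm) qdm" and q :: 'c
  assumes M: "qdiff_module UNIV q M" and q: "q \<noteq> 0"
begin

sublocale M: module "fls_subring UNIV" M
  using qdiff_moduleD(1)[OF M] .

lemmas Sig_M = qdiff_moduleD(2-5)[OF M]

lemma smult_M [simp]:
  "x \<in> carrier M \<Longrightarrow> f \<odot>\<^bsub>M\<^esub> x \<in> carrier M"
  "x \<in> carrier M \<Longrightarrow> 0 \<odot>\<^bsub>M\<^esub> x = \<zero>\<^bsub>M\<^esub>"
  "f \<odot>\<^bsub>M\<^esub> \<zero>\<^bsub>M\<^esub> = \<zero>\<^bsub>M\<^esub>"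
  "x \<in> carrier M \<Longrightarrow> 1 \<odot>\<^bsub>M\<^esub> x = x"
  using M.smult_closed[of f x] M.smult_l_null[of x] M.smult_r_null[of f] M.smult_one[of x] by simp_all

lemma smult_M_distrib:
  "x \<in> carrier M \<Longrightarrow> (f + g) \<odot>\<^bsub>M\<^esub> x = f \<odot>\<^bsub>M\<^esub> x \<oplus>\<^bsub>M\<^esub> g \<odot>\<^bsub>M\<^esub> x"
  "x \<in> carrier M \<Longrightarrow> y \<in> carrier M \<Longrightarrow> f \<odot>\<^bsub>M\<^esub> (x \<oplus>\<^bsub>M\<^esub> y) = f \<odot>\<^bsub>M\<^esub> x \<oplus>\<^bsub>M\<^esub> f \<odot>\<^bsub>M\<^esub> y"
  "x \<in> carrier M \<Longrightarrow> (f * g) \<odot>\<^bsub>M\<^esub> x = f \<odot>\<^bsub>M\<^esub> (g \<odot>\<^bsub>M\<^esub> x)"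
  using M.smult_l_distr[of f g x] M.smult_r_distr[of f x y] M.smult_assoc1[of f g x] by simp_all

lemma Sig_M_zero: "Sig M \<zero>\<^bsub>M\<^esub> = \<zero>\<^bsub>M\<^esub>"
  using Sig_M by (intro additive_zero[OF M.abelian_group_axioms M.abelian_group_axioms]) auto

end

locale formal_orbit = formal_module M q for M :: "('c::field fls, 'm) qdm" and q +
  fixes e :: "nat \<Rightarrow> 'm"
  assumes e: "\<And>k. e k \<in> carrier M" and Sig_e: "\<And>k. Sig M (e k) = e (Suc k)"
begin

abbreviation "lc \<equiv> lincomb M e"

lemma lc_closed [simp]: "lc n a \<in> carrier M"
  by (induction n) (auto simp: e)

lemma lc_cong: "(\<And>k. k < n \<Longrightarrow> a k = b k) \<Longrightarrow> lc n a = lc n b"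
  by (induction n) auto

lemma lc_add: "lc n (\<lambda>k. a k + b k) = lc n a \<oplus>\<^bsub>M\<^esub> lc n b"
proof (induction n)
  case (Suc n)
  have "lc (Suc n) (\<lambda>k. a k + b k) = (lc n a \<oplus>\<^bsub>M\<^esub> lc n b) \<oplus>\<^bsub>M\<^esub> (a n \<odot>\<^bsub>M\<^esub> e n \<oplus>\<^bsub>M\<^esub> b n \<odot>\<^bsub>M\<^esub> e n)"
    using Suc by (simp add: smult_M_distrib e)
  also have "\<dots> = lc (Suc n) a \<oplus>\<^bsub>M\<^esub> lc (Suc n) b"
    by (simp add: e M.a_ac)
  finally show ?case .
qed simp

lemma lc_smult: "lc n (\<lambda>k. f * a k) = f \<odot>\<^bsub>M\<^esub> lc n a"
  by (induction n) (simp_all add: smult_M_distrib e)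

lemma lc_diff_smult:
  assumes "lc n b = \<zero>\<^bsub>M\<^esub>"
  shows "lc n (\<lambda>k. a k - f * b k) = lc n a"
proof -
  have "lc n (\<lambda>k. a k - f * b k) = lc n (\<lambda>k. a k + (- f) * b k)" by simp
  also have "\<dots> = lc n a" unfolding lc_add lc_smult assms by simp
  finally show ?thesis .
qed

lemma lc_trailing:
  assumes "n \<le> n'" "\<And>k. n \<le> k \<Longrightarrow> k < n' \<Longrightarrow> a k = 0"
  shows "lc n' a = lc n a"
  using assms by (induction n' rule: dec_induct) (auto simp: e)

lemma lc_unit: "n > 0 \<Longrightarrow> lc n (\<lambda>k. if k = 0 then 1 else 0) = e 0"
  by (subst lc_trailing[of 1]) (auto simp: e)

lemma Sig_lc: "Sig M (lc n a) = lc (Suc n) (\<lambda>k. if k = 0 then 0 else sigma q (a (k - 1)))"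
proof (induction n)
  case 0
  then show ?case by (simp add: Sig_M_zero e)
next
  case (Suc n)
  have "Sig M (lc (Suc n) a) = Sig M (lc n a) \<oplus>\<^bsub>M\<^esub> sigma q (a n) \<odot>\<^bsub>M\<^esub> e (Suc n)"
    using Sig_M(2,3) e Sig_e by simp
  also have "\<dots> = lc (Suc (Suc n)) (\<lambda>k. if k = 0 then 0 else sigma q (a (k - 1)))"
    unfolding Suc by simp
  finally show ?case .
qed

lemma lc_relation_exists: "\<exists>d a. a d = 1 \<and> lc (Suc d) a = \<zero>\<^bsub>M\<^esub>"
proof -
  obtain B where B: "finite B" "B \<subseteq> carrier M"
    and gen: "\<forall>m\<in>carrier M. \<exists>c\<in>B \<rightarrow> UNIV. m = (\<Oplus>\<^bsub>M\<^esub>b\<in>B. c b \<odot>\<^bsub>M\<^esub> b)"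
    using M unfolding qdiff_module_def by blast
  have "\<exists>c. e k = (\<Oplus>\<^bsub>M\<^esub>b\<in>B. c b \<odot>\<^bsub>M\<^esub> b)" for k using gen e by blast
  then obtain c where c: "\<And>k. e k = (\<Oplus>\<^bsub>M\<^esub>b\<in>B. c k b \<odot>\<^bsub>M\<^esub> b)" by metis
  have BM: "b \<in> carrier M" if "b \<in> B" for b using B that by blast
  have lc_gen: "lc n a = (\<Oplus>\<^bsub>M\<^esub>b\<in>B. (\<Sum>k<n. a k * c k b) \<odot>\<^bsub>M\<^esub> b)" for n a
  proof (induction n)
    case 0
    have "(\<Oplus>\<^bsub>M\<^esub>b\<in>B. 0 \<odot>\<^bsub>M\<^esub> b) = (\<Oplus>\<^bsub>M\<^esub>b\<in>B. \<zero>\<^bsub>M\<^esub>)"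
      using BM by (intro M.finsum_cong') auto
    then show ?case by simp
  next
    case (Suc n)
    have "a n \<odot>\<^bsub>M\<^esub> e n = (\<Oplus>\<^bsub>M\<^esub>b\<in>B. a n \<odot>\<^bsub>M\<^esub> (c n b \<odot>\<^bsub>M\<^esub> b))"
      unfolding c[of n] using B BM by (intro M.finsum_smult_ldistr) auto
    also have "\<dots> = (\<Oplus>\<^bsub>M\<^esub>b\<in>B. (a n * c n b) \<odot>\<^bsub>M\<^esub> b)"
      using BM by (intro M.finsum_cong') (auto simp: smult_M_distrib)
    finally have "lc (Suc n) a = (\<Oplus>\<^bsub>M\<^esub>b\<in>B. (\<Sum>k<n. a k * c k b) \<odot>\<^bsub>M\<^esub> b) \<oplus>\<^bsub>M\<^esub> (\<Oplus>\<^bsub>M\<^esub>b\<in>B. (a n * c n b) \<odot>\<^bsub>M\<^esub> b)"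
      using Suc by simp
    also have "\<dots> = (\<Oplus>\<^bsub>M\<^esub>b\<in>B. (\<Sum>k<n. a k * c k b) \<odot>\<^bsub>M\<^esub> b \<oplus>\<^bsub>M\<^esub> (a n * c n b) \<odot>\<^bsub>M\<^esub> b)"
      using BM by (intro M.finsum_addf[symmetric]) auto
    also have "\<dots> = (\<Oplus>\<^bsub>M\<^esub>b\<in>B. (\<Sum>k<Suc n. a k * c k b) \<odot>\<^bsub>M\<^esub> b)"
      using BM by (intro M.finsum_cong') (auto simp: smult_M_distrib)
    finally show ?case .
  qed
  obtain a where a: "\<exists>k\<in>{..<Suc (card B)}. a k \<noteq> 0" "\<forall>b\<in>B. (\<Sum>k<Suc (card B). a k * c k b) = 0"
    using nontrivial_relation[OF B(1), of "{..<Suc (card B)}" c] by auto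
  have "lc (Suc (card B)) a = (\<Oplus>\<^bsub>M\<^esub>b\<in>B. \<zero>\<^bsub>M\<^esub>)"
    unfolding lc_gen using a BM by (intro M.finsum_cong') auto
  then have a0: "lc (Suc (card B)) a = \<zero>\<^bsub>M\<^esub>" by simp
  \<comment> \<open>The last nonzero coefficient: the relation is cut there and made monic.\<close>
  define d where "d = Max {k \<in> {..<Suc (card B)}. a k \<noteq> 0}"
  have "d \<in> {k \<in> {..<Suc (card B)}. a k \<noteq> 0}" unfolding d_def using a by (intro Max_in) auto
  then have d: "d < Suc (card B)" "a d \<noteq> 0" by auto
  have "a k = 0" if "Suc d \<le> k" "k < Suc (card B)" for k
  proof (rule ccontr)
    assume "a k \<noteq> 0"
    then have "k \<le> d" unfolding d_def using that by (intro Max_ge) auto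
    then show False using that by simp
  qed
  then have "lc (Suc d) a = \<zero>\<^bsub>M\<^esub>" using lc_trailing[of "Suc d" "Suc (card B)" a] a0 d by simp
  then have "lc (Suc d) (\<lambda>k. inverse (a d) * a k) = \<zero>\<^bsub>M\<^esub>" unfolding lc_smult by simp
  then show ?thesis using d by (intro exI[of _ d] exI[of _ "\<lambda>k. inverse (a d) * a k"]) auto
qed

text \<open>Minimality of \<open>d\<close> makes the vectors \<open>e k\<close> with
  \<open>k < d\<close> independent. Their span is stable under \<open>Sig\<close> by the relation
  and under its inverse by \<open>a 0 \<noteq> 0\<close>, so irreducibility makes it the whole
  module.\<close>

lemma cyclic_basis:
  assumes irr: "qdm_irreducible UNIV M" and e0: "e 0 \<noteq> \<zero>\<^bsub>M\<^esub>"
  obtains d a where "d > 0" "a d = 1" "a 0 \<noteq> 0" "lc (Suc d) a = \<zero>\<^bsub>M\<^esub>"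
    "\<And>c k. lc d c = \<zero>\<^bsub>M\<^esub> \<Longrightarrow> k < d \<Longrightarrow> c k = 0"
    "\<And>x. x \<in> carrier M \<Longrightarrow> \<exists>c. x = lc d c"
proof -
  define d where "d = (LEAST d. \<exists>a. a d = 1 \<and> lc (Suc d) a = \<zero>\<^bsub>M\<^esub>)"
  obtain a where a: "a d = 1" "lc (Suc d) a = \<zero>\<^bsub>M\<^esub>"
    using LeastI_ex[OF lc_relation_exists] unfolding d_def by blast
  have dmin: "d \<le> d'" if "b d' = 1" "lc (Suc d') b = \<zero>\<^bsub>M\<^esub>" for d' b
    unfolding d_def using that by (intro Least_le) blast
  have indep: "c k = 0" if c: "lc d c = \<zero>\<^bsub>M\<^esub>" and k: "k < d" for c k
  proof (rule ccontr)
    assume ck: "c k \<noteq> 0"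
    define t where "t = Max {k \<in> {..<d}. c k \<noteq> 0}"
    have "t \<in> {k \<in> {..<d}. c k \<noteq> 0}" unfolding t_def using ck k by (intro Max_in) auto
    then have t: "t < d" "c t \<noteq> 0" by auto
    have "c k = 0" if "Suc t \<le> k" "k < d" for k
    proof (rule ccontr)
      assume "c k \<noteq> 0"
      then have "k \<le> t" unfolding t_def using that by (intro Max_ge) auto
      then show False using that by simp
    qed
    then have "lc (Suc t) c = \<zero>\<^bsub>M\<^esub>" using lc_trailing[of "Suc t" d c] c t by simp
    then have "lc (Suc t) (\<lambda>k. inverse (c t) * c k) = \<zero>\<^bsub>M\<^esub>" unfolding lc_smult by simp
    then have "d \<le> t" using t by (intro dmin[of "\<lambda>k. inverse (c t) * c k"]) auto
    then show False using t by simp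
  qed
  have d: "d > 0"
  proof (rule ccontr)
    assume "\<not> d > 0"
    then have "e 0 = \<zero>\<^bsub>M\<^esub>" using a e by simp
    then show False using e0 by simp
  qed
  have inv_sigma: "sigma q (sigma (inverse q) f) = f" for f using q by simp
  \<comment> \<open>Otherwise the relation is the image under \<open>Sig\<close> of one of length
    \<open>d\<close>, still with a nonzero last coefficient, against independence.\<close>
  have a0: "a 0 \<noteq> 0"
  proof
    assume a0: "a 0 = 0"
    have "Sig M (lc d (\<lambda>k. sigma (inverse q) (a (Suc k)))) = lc (Suc d) a"
      unfolding Sig_lc by (rule lc_cong) (use a0 q in auto)
    then have "Sig M (lc d (\<lambda>k. sigma (inverse q) (a (Suc k)))) = Sig M \<zero>\<^bsub>M\<^esub>" using a Sig_M_zero by simp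
    then have "lc d (\<lambda>k. sigma (inverse q) (a (Suc k))) = \<zero>\<^bsub>M\<^esub>"
      using Sig_M(1) unfolding bij_betw_def inj_on_def by simp
    from indep[OF this, of "d - 1"] show False using d a by simp
  qed
  define H where "H = range (lc d)"
  have reduce: "lc (Suc d) c = lc d (\<lambda>k. c k - c d * a k)" for c
  proof -
    have "lc (Suc d) c = lc (Suc d) (\<lambda>k. c k - c d * a k)" by (rule lc_diff_smult[OF a(2), symmetric])
    also have "\<dots> = lc d (\<lambda>k. c k - c d * a k)"
      using a(1) by (intro lc_trailing) (auto simp: le_less_Suc_eq)
    finally show ?thesis .
  qed
  have "submodule H (fls_subring UNIV) M"
  proof (rule M.submoduleI)
    show "H \<subseteq> carrier M" by (auto simp: H_def)
    have "lc d (\<lambda>k. 0 * 0) = \<zero>\<^bsub>M\<^esub>" unfolding lc_smult by simp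
    then show "\<zero>\<^bsub>M\<^esub> \<in> H" unfolding H_def by (metis rangeI)
    show "\<ominus>\<^bsub>M\<^esub> x \<in> H" if x: "x \<in> H" for x
    proof -
      obtain c where c: "x = lc d c" using x unfolding H_def by (rule rangeE)
      have "lc d (\<lambda>k. (- 1) * c k) \<oplus>\<^bsub>M\<^esub> lc d c = lc d (\<lambda>k. 0 * c k)" by (simp flip: lc_add)
      also have "\<dots> = \<zero>\<^bsub>M\<^esub>" unfolding lc_smult by simp
      finally have "\<ominus>\<^bsub>M\<^esub> x = lc d (\<lambda>k. (- 1) * c k)" unfolding c by (intro M.minus_equality) auto
      then show ?thesis unfolding H_def by (metis rangeI)
    qed
    show "x \<oplus>\<^bsub>M\<^esub> y \<in> H" if x: "x \<in> H" and y: "y \<in> H" for x y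
    proof -
      obtain c where c: "x = lc d c" using x unfolding H_def by (rule rangeE)
      obtain c' where c': "y = lc d c'" using y unfolding H_def by (rule rangeE)
      show ?thesis unfolding c c' lc_add[symmetric] H_def by (rule rangeI)
    qed
    show "f \<odot>\<^bsub>M\<^esub> x \<in> H" if x: "x \<in> H" for f x
    proof -
      obtain c where c: "x = lc d c" using x unfolding H_def by (rule rangeE)
      show ?thesis unfolding c lc_smult[symmetric] H_def by (rule rangeI)
    qed
  qed
  moreover have "Sig M ` H = H"
  proof (intro equalityI subsetI)
    fix y assume "y \<in> Sig M ` H"
    then obtain c where "y = Sig M (lc d c)" unfolding H_def by blast
    then show "y \<in> H" unfolding Sig_lc reduce H_def by simp
  next
    fix y assume "y \<in> H"
    then obtain c where c: "y = lc d c" unfolding H_def by blast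
    \<comment> \<open>Padding by 0 and subtracting a multiple of the relation removes the
      coefficient of \<open>e 0\<close>; what remains is an image under \<open>Sig\<close>.\<close>
    define c1 where "c1 k = (if k < d then c k else 0)" for k
    define c2 where "c2 k = c1 k - c 0 / a 0 * a k" for k
    have "y = lc d c1" unfolding c c1_def by (rule lc_cong) simp
    also have "\<dots> = lc (Suc d) c1" by (rule lc_trailing[symmetric]) (auto simp: c1_def)
    also have "\<dots> = lc (Suc d) c2" unfolding c2_def by (rule lc_diff_smult[OF a(2), symmetric])
    also have "\<dots> = Sig M (lc d (\<lambda>k. sigma (inverse q) (c2 (Suc k))))"
      unfolding Sig_lc by (rule lc_cong) (use q d a0 in \<open>auto simp: c2_def c1_def\<close>)
    finally show "y \<in> Sig M ` H" unfolding H_def by blast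
  qed
  ultimately have "H = {\<zero>\<^bsub>M\<^esub>} \<or> H = carrier M"
    using irr unfolding qdm_irreducible_def qdiff_submodule_def by blast
  moreover have "e 0 \<in> H" unfolding H_def lc_unit[OF d, symmetric] by (rule rangeI)
  ultimately have "H = carrier M" using e0 by auto
  then have gen: "\<exists>c. x = lc d c" if "x \<in> carrier M" for x using that unfolding H_def by blast
  show ?thesis by (rule that[OF d a(1) a0 a(2)]) (use indep gen in auto)
qed

end

section \<open>The trivial norm and the formal case\<close>

definition trivial_norm :: "'c::field \<Rightarrow> real" where
  "trivial_norm x = (if x = 0 then 0 else 1)"

lemma absval_trivial_norm: "absval trivial_norm"
  by (rule absval.intro) (auto simp: absolute_value_def trivial_norm_def)

lemma trivial_norm_le_1: "trivial_norm x \<le> 1"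
  by (simp add: trivial_norm_def)

lemma K_field_trivial_norm: "K_field (trivial_norm :: 'c::field \<Rightarrow> real) = UNIV"
proof -
  interpret absval "trivial_norm :: 'c \<Rightarrow> real" by (rule absval_trivial_norm)
  show ?thesis
    by (auto simp: K_field_iff germ_def intro: geom_mono[OF geom_const[of 1] trivial_norm_le_1])
qed

text \<open>The monic relation of a cyclic vector provides the operator \<open>L\<close>. The
  morphism is defined on coordinates, \<open>?lc d c\<close> going to \<open>G d c\<close>; it
  respects \<open>Sig\<close> because \<open>v\<close> solves \<open>L\<close>.\<close>

lemma formal_irreducible_iso_N_module:
  fixes M :: "('c::alg_closed_field fls, 'm) qdm"
  assumes q: "q \<noteq> 0" "\<And>k::nat. k \<ge> 1 \<Longrightarrow> q ^ k \<noteq> 1"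
    and qr: "\<And>n::nat. n \<ge> 1 \<Longrightarrow> qr n ^ n = q"
    and M: "qdiff_module UNIV q M" "qdm_irreducible UNIV M"
  obtains n0 \<mu>0 l0 where "n0 > 0" "coprime (int n0) \<mu>0" "l0 \<noteq> 0"
    "qdm_iso UNIV M (N_module UNIV n0 (qr n0) \<mu>0 l0)"
proof -
  let ?N = "trivial_norm :: 'c \<Rightarrow> real"
  interpret absval ?N by (rule absval_trivial_norm)
  interpret M: module "fls_subring UNIV" M using qdiff_moduleD(1)[OF M(1)] .
  obtain m where m: "m \<in> carrier M" "m \<noteq> \<zero>\<^bsub>M\<^esub>"
    using M(2) M.zero_closed unfolding qdm_irreducible_def by blast
  define e where "e k = (Sig M ^^ k) m" for k
  have e: "e k \<in> carrier M" for k
    by (induction k) (use m qdiff_moduleD(5)[OF M(1)] in \<open>auto simp: e_def\<close>)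
  have Sig_e: "Sig M (e k) = e (Suc k)" for k by (simp add: e_def)
  have e0: "e 0 \<noteq> \<zero>\<^bsub>M\<^esub>" using m by (simp add: e_def)
  interpret O: formal_orbit M q e by unfold_locales (use M q e Sig_e in auto)
  let ?lc = "lincomb M e"
  obtain d a where d: "d > 0" and ad: "a d = 1" and a0: "a 0 \<noteq> 0" and rel: "?lc (Suc d) a = \<zero>\<^bsub>M\<^esub>"
    and indep: "\<And>c k. ?lc d c = \<zero>\<^bsub>M\<^esub> \<Longrightarrow> k < d \<Longrightarrow> c k = 0"
    and gen: "\<And>x. x \<in> carrier M \<Longrightarrow> \<exists>c. x = ?lc d c"
    using O.cyclic_basis[OF M(2) e0] by metis
  note lc_rules = O.lc_add O.lc_smult O.lc_diff_smult[OF rel]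
  define L where "L = (\<Sum>i\<le>d. monom (a i) i)"
  have coeff_L: "coeff L i = (if i \<le> d then a i else 0)" for i
    by (simp add: L_def coeff_sum if_distrib sum.delta cong: if_cong)
  have deg_L: "degree L = d"
    by (rule antisym) (auto intro!: degree_le le_degree simp: coeff_L ad)
  have L0: "coeff L 0 \<noteq> 0" "coeff L d \<noteq> 0" using a0 ad by (auto simp: coeff_L)
  obtain s i j where s: "i < j" "coeff L i \<noteq> 0" "coeff L j \<noteq> 0"
    and slope: "real (j - i) * s = real_of_int (fls_subdegree (coeff L j) - fls_subdegree (coeff L i))"
    and low: "\<forall>k. coeff L k \<noteq> 0 \<longrightarrow>
      real_of_int (fls_subdegree (coeff L i)) - s * real i \<le> real_of_int (fls_subdegree (coeff L k)) - s * real k"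
    by (rule exists_slope[OF L0 less_imp_neq[OF d]]) (rule that, assumption+)
  \<comment> \<open>The slope is a difference of orders divided by \<open>j - i\<close>, so this
    ramification makes it an integer; the fraction need not be reduced.\<close>
  define n where "n = j - i"
  define \<mu> where "\<mu> = fls_subdegree (coeff L j) - fls_subdegree (coeff L i)"
  have n: "n \<ge> 1" using s by (simp add: n_def)
  have Nq: "?N q = 1" using q(1) by (simp add: trivial_norm_def)
  have standing: "geom (\<lambda>k. inverse (?N (qpoch q q k)))"
    by (rule geom_mono[OF geom_const[of 1]]) (simp add: trivial_norm_def)
  \<comment> \<open>The trivial norm is at most 1, so \<open>q_phi\<close> always converges.\<close>
  have adm: "admissible_slope ?N (qr n) \<mu> (ramify n L)"
    unfolding admissible_slope_def convergent_fps_iff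
    by (rule geom_mono[OF geom_const[of 1] trivial_norm_le_1])
  have LK: "coeff L k \<in> K_field ?N" for k by (simp add: K_field_trivial_norm)
  obtain l v where l: "l \<noteq> 0" and v: "fls_nth v 0 = 1"
    and sol: "(\<Sum>i\<le>degree L. fls_compose_power (coeff L i) n * Spow (qr n) \<mu> l (int i) v) = 0"
    by (rule slope_solution[OF absval_trivial_norm Nq q(2) standing LK s(2,3,1) slope low[rule_format] n qr[OF n] _ adm])
      (use slope in \<open>auto simp: n_def \<mu>_def\<close>)
  let ?N' = "N_module (K_field ?N) n (qr n) \<mu> l"
  have r0: "qr n \<noteq> 0" using qr[OF n] q(1) n by (metis power_0_left not_one_le_zero)
  have npos: "n > 0" using n by simp
  define G where "G k c = (\<Sum>i<k. fls_compose_power (c i) n * Spow (qr n) \<mu> l (int i) v)" for k c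
  have G_add: "G k (\<lambda>i. c i + c' i) = G k c + G k c'" for k c c'
    by (simp add: G_def distrib_right sum.distrib)
  have G_smult: "G k (\<lambda>i. f * c i) = fls_compose_power f n * G k c" for k f c
    by (simp add: G_def sum_distrib_left mult.assoc)
  have G_diff: "G k (\<lambda>i. c i - f * c' i) = G k c - fls_compose_power f n * G k c'" for k f c c'
    by (simp add: G_def sum_distrib_left left_diff_distrib sum_subtractf mult.assoc)
  have G_rel: "G (Suc d) a = 0"
  proof -
    have "G (Suc d) a = (\<Sum>i\<le>degree L. fls_compose_power (coeff L i) n * Spow (qr n) \<mu> l (int i) v)"
      unfolding G_def deg_L lessThan_Suc_atMost by (intro sum.cong) (auto simp: coeff_L)
    then show ?thesis using sol by simp
  qed
  have G_cong: "G d c = G d c'" if "?lc d c = ?lc d c'" for c c'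
  proof -
    have "?lc d (\<lambda>k. c k + (- 1) * c' k) = ?lc d (\<lambda>k. c' k + (- 1) * c' k)"
      unfolding lc_rules that ..
    also have "\<dots> = ?lc d (\<lambda>k. 0 * c' k)" by simp
    also have "\<dots> = \<zero>\<^bsub>M\<^esub>"
      unfolding lc_rules using O.smult_M(2)[OF O.lc_closed] by simp
    finally have "c k + (- 1) * c' k = 0" if "k < d" for k using indep that by blast
    then show ?thesis unfolding G_def by (intro sum.cong) auto
  qed
  \<comment> \<open>Coordinates below \<open>d\<close> are unique by \<open>indep\<close>, so the
    choice does not matter.\<close>
  define \<phi> where "\<phi> x = G d (SOME c. x = ?lc d c)" for x
  have \<phi>_lc: "\<phi> (?lc d c) = G d c" for c
    unfolding \<phi>_def by (rule G_cong) (rule someI[of "\<lambda>c'. ?lc d c = ?lc d c'" c, symmetric], rule refl)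
  have "\<phi> \<in> qdm_hom (K_field ?N) M ?N'"
    unfolding qdm_hom_def
  proof (intro CollectI conjI ballI)
    show "\<phi> \<in> carrier M \<rightarrow> carrier ?N'"
      unfolding N_module_simps(1)[OF npos] unfolding K_field_trivial_norm by simp
    show "\<phi> (x \<oplus>\<^bsub>M\<^esub> y) = \<phi> x \<oplus>\<^bsub>?N'\<^esub> \<phi> y" if x: "x \<in> carrier M" and y: "y \<in> carrier M" for x y
    proof -
      obtain c c' where c: "x = ?lc d c" "y = ?lc d c'" using gen[OF x] gen[OF y] by blast
      show ?thesis unfolding c lc_rules(1)[symmetric] \<phi>_lc G_add using npos by simp
    qed
    show "\<phi> (f \<odot>\<^bsub>M\<^esub> x) = f \<odot>\<^bsub>?N'\<^esub> \<phi> x" if x: "x \<in> carrier M" for f x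
    proof -
      obtain c where c: "x = ?lc d c" using gen[OF x] by blast
      show ?thesis unfolding c lc_rules(2)[symmetric] \<phi>_lc G_smult using npos by simp
    qed
    show "\<phi> (Sig M x) = Sig ?N' (\<phi> x)" if x: "x \<in> carrier M" for x
    proof -
      obtain c where c: "x = ?lc d c" using gen[OF x] by blast
      define c1 where "c1 k = (if k = 0 then 0 else sigma q (c (k - 1)))" for k
      \<comment> \<open>Reduction by the monic relation makes the coefficient of index
        \<open>d\<close> vanish and changes neither the element of \<open>M\<close> nor the value of
        \<open>G\<close>.\<close>
      define c2 where "c2 k = c1 k - c1 d * a k" for k
      have "Sig M x = ?lc (Suc d) c1" unfolding c c1_def by (rule O.Sig_lc)
      also have "\<dots> = ?lc (Suc d) c2" unfolding c2_def by (rule lc_rules(3)[symmetric])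
      also have "\<dots> = ?lc d c2"
        using ad by (intro O.lc_trailing) (auto simp: c2_def le_less_Suc_eq)
      finally have "\<phi> (Sig M x) = G d c2" by (simp add: \<phi>_lc)
      also have "\<dots> = G (Suc d) c2" using ad npos by (simp add: G_def c2_def)
      also have "\<dots> = G (Suc d) c1" unfolding c2_def G_diff G_rel by simp
      also have "\<dots> = (\<Sum>i<d. fls_compose_power (sigma q (c i)) n * Spow (qr n) \<mu> l (int (Suc i)) v)"
        unfolding G_def sum.lessThan_Suc_shift by (simp add: c1_def)
      also have "\<dots> = Spow (qr n) \<mu> l 1 (G d c)"
        unfolding G_def Spow_sum using r0 l sigma_compose_power[OF npos qr[OF n]]
        by (simp add: Spow_smult)
      finally show ?thesis using npos by (simp add: c \<phi>_lc)
    qed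
  qed
  moreover have "\<phi> (e 0) = v"
  proof -
    have "\<phi> (e 0) = G d (\<lambda>k. if k = 0 then 1 else 0)"
      unfolding O.lc_unit[OF d, symmetric] \<phi>_lc ..
    also have "\<dots> = (\<Sum>i<d. if i = 0 then v else 0)"
      unfolding G_def using npos by (intro sum.cong) auto
    also have "\<dots> = v" using d by simp
    finally show ?thesis .
  qed
  ultimately have \<phi>: "\<phi> \<in> qdm_hom UNIV M (N_module UNIV n (qr n) \<mu> l)" "fls_nth (\<phi> (e 0)) 0 = 1"
    using v by (simp_all add: K_field_trivial_norm)
  obtain n0 \<mu>0 l0 where "n0 > 0" "n0 \<le> n" "coprime (int n0) \<mu>0" "l0 \<noteq> 0"
    "qdm_iso UNIV M (N_module UNIV n0 (qr n0) \<mu>0 l0)"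
    by (rule irreducible_iso_N_module[where N = ?N, unfolded K_field_trivial_norm,
          OF absval_trivial_norm q qr n l M \<phi>(1) e[of 0] \<phi>(2)])
  then show ?thesis using that by blast
qed

section \<open>The modules of the list are almost admissible\<close>

context absval
begin

lemma analytic_two_term:
  assumes n: "n > 0" and ab: "a \<ge> 0" "b \<ge> 0"
  shows "analytic_operator N (two_term n a b \<Lambda>)"
  unfolding analytic_operator_def
proof (intro conjI allI)
  have "coeff (two_term n a b \<Lambda>) n \<noteq> 0" using n by (simp add: coeff_two_term)
  then show "two_term n a b \<Lambda> \<noteq> 0" by auto
  fix i
  have mono: "\<exists>x. convergent_fps N x \<and> monomial c k = fps_to_fls x" if k: "k \<ge> 0" for c k
  proof -
    have eq: "monomial c k = fps_to_fls (fls_regpart (monomial c k))"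
      by (rule fls_eqI) (use k in auto)
    have "germ (fps_to_fls (fls_regpart (monomial c k)))" unfolding eq[symmetric] by simp
    then show ?thesis using eq germ_fps_to_fls by blast
  qed
  show "\<exists>x. convergent_fps N x \<and> coeff (two_term n a b \<Lambda>) i = fps_to_fls x"
    using mono[OF ab(1), of 1] mono[OF ab(2), of "- \<Lambda>"] mono[of 0 0] n by (simp add: coeff_two_term)
qed

lemma slopes_two_term_eq:
  assumes n: "n > 0" and \<Lambda>: "\<Lambda> \<noteq> 0" and s: "s \<in> slopes (two_term n a b \<Lambda>)"
  shows "real n * s = of_int (a - b)"
proof -
  have "s = real_of_int (fls_subdegree (coeff (two_term n a b \<Lambda>) n) - fls_subdegree (coeff (two_term n a b \<Lambda>) 0)) / real n"
    by (rule slopes_two_term[OF n _ s]) (use n \<Lambda> in \<open>auto simp: coeff_two_term\<close>)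
  then show ?thesis using n \<Lambda> by (simp add: coeff_two_term)
qed

text \<open>The characteristic polynomial is \<open>\<rho> (T^n - l^n)\<close>, so the quotients of
  exponents are \<open>n\<close>-th roots of unity other than 1, to which
  \<open>geom_qpoch_root\<close> applies.\<close>

lemma admissible_two_term:
  assumes q: "N q = 1" "\<And>k::nat. k \<ge> 1 \<Longrightarrow> q ^ k \<noteq> 1"
    and standing: "geom (\<lambda>k. inverse (N (qpoch q q k)))"
    and n: "n > 0" and r: "r ^ n = q" "r \<noteq> 0" and l: "l \<noteq> 0"
    and \<Lambda>: "\<Lambda> = Spow_coeff r \<mu> l (int n)" and ab: "a - b = \<mu>"
  shows "admissible_slope N r \<mu> (ramify n (two_term n a b \<Lambda>))"
proof -
  let ?L = "two_term n a b \<Lambda>"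
  let ?T = "twist r \<mu> (ramify n ?L)"
  define \<rho> where "\<rho> = r powi (- \<mu> * tri (int n))"
  have \<rho>: "\<rho> \<noteq> 0" "\<Lambda> = l ^ n * \<rho>" using r by (auto simp: \<rho>_def \<Lambda> Spow_coeff_def)
  have \<Lambda>0: "\<Lambda> \<noteq> 0" using \<rho> l by simp
  have exp: "int n * a - \<mu> * int n = int n * b" using ab by (simp add: algebra_simps)
  have T: "coeff ?T i = (if i = n then monomial \<rho> (int n * b) else if i = 0 then monomial (- \<Lambda>) (int n * b) else 0)" for i
    using n r exp by (simp add: coeff_twist coeff_ramify coeff_two_term \<rho>_def)
  have "x_order ?T = int n * b"
    by (rule x_order_eqI[of _ n]) (use \<rho>(1) \<Lambda>0 n in \<open>auto simp: T split: if_splits\<close>)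
  then have "coeff (char_polynomial r \<mu> (ramify n ?L)) i = (if i = n then \<rho> else if i = 0 then - \<Lambda> else 0)" for i
    by (simp add: coeff_char_polynomial T)
  then have ch: "char_polynomial r \<mu> (ramify n ?L) = monom \<rho> n + monom (- \<Lambda>) 0"
    using n by (intro poly_eqI) auto
  have exps: "y ^ n = l ^ n" "y \<noteq> 0" if "y \<in> exponents r \<mu> (ramify n ?L)" for y
  proof -
    have y: "y \<noteq> 0" "poly (monom \<rho> n + monom (- \<Lambda>) 0) y = 0"
      using that unfolding exponents_def ch by auto
    then have "\<rho> * y ^ n = \<rho> * l ^ n" by (simp add: poly_monom \<rho>(2) mult.commute)
    then show "y ^ n = l ^ n" using \<rho>(1) by simp
    show "y \<noteq> 0" by (rule y(1))
  qed
  define Z where "Z = exponent_quotients r \<mu> (ramify n ?L)"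
  have Z: "z ^ n = 1" "z \<noteq> 1" if "z \<in> Z" for z
  proof -
    obtain x y where xy: "z = x / y" "x \<in> exponents r \<mu> (ramify n ?L)" "y \<in> exponents r \<mu> (ramify n ?L)"
      using \<open>z \<in> Z\<close> unfolding Z_def exponent_quotients_def by blast
    then show "z ^ n = 1" using exps[OF xy(2)] exps[OF xy(3)] l by (simp add: power_divide)
    show "z \<noteq> 1" using \<open>z \<in> Z\<close> unfolding Z_def exponent_quotients_def
      by (metis (mono_tags, lifting) DiffD2 mem_Collect_eq order_refl power_int_0_right)
  qed
  have ch0: "char_polynomial r \<mu> (ramify n ?L) \<noteq> 0"
  proof
    assume "char_polynomial r \<mu> (ramify n ?L) = 0"
    then have "coeff (monom \<rho> n + monom (- \<Lambda>) 0) n = 0" by (simp only: ch coeff_0)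
    then show False using n \<rho> by simp
  qed
  have "geom (\<lambda>k. \<Prod>z\<in>Z. inverse (N (qpoch z r k)))"
  proof (rule geom_prod)
    show "finite Z" unfolding Z_def using ch0 by (rule finite_exponent_quotients)
    fix z assume z: "z \<in> Z"
    have "geom (\<lambda>k. inverse (N (1 - z)) * inverse (\<Prod>j<k. N (1 - r ^ Suc j * z)))"
      using geom_qpoch_root[OF q standing n r(1) Z(1)[OF z]]
      by (rule geom_mult[OF geom_const]) (auto intro!: prod_nonneg)
    then have "geom (\<lambda>k. inverse (N (qpoch z r (Suc k))))"
      unfolding qpoch_Suc_left N_mult N_prod inverse_mult_distrib .
    then show "geom (\<lambda>k. inverse (N (qpoch z r k)))" by (rule geom_unshift)
  qed simp
  moreover have "(\<Prod>z\<in>Z. inverse (N (qpoch z r k))) = N (1 / (\<Prod>z\<in>Z. qpoch z r k))" for k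
    using prod_inversef[of "\<lambda>z. N (qpoch z r k)" Z] by (simp add: N_divide N_prod o_def inverse_eq_divide)
  ultimately show ?thesis
    unfolding admissible_slope_def convergent_fps_iff q_phi_def Z_def[symmetric] by simp
qed

lemma N_module_two_term:
  assumes q: "N q = 1" "\<And>k::nat. k \<ge> 1 \<Longrightarrow> q ^ k \<noteq> 1"
    and standing: "geom (\<lambda>k. inverse (N (qpoch q q k)))"
    and n: "n > 0" and r: "r ^ n = q" "r \<noteq> 0" and l: "l \<noteq> 0" and cop: "coprime (int n) \<mu>"
  obtains L where "analytic_operator N L" "\<forall>s\<in>slopes L. real n * s = of_int \<mu>"
    "admissible_slope N r \<mu> (ramify n L)"
    "qdm_iso K (N_module K n r \<mu> l) (operator_module K q L)"
proof
  \<comment> \<open>The choice of a common power of \<open>x\<close> that leaves both exponents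
    nonnegative.\<close>
  define a where "a = max \<mu> 0"
  define b where "b = a - \<mu>"
  have ab: "a - b = \<mu>" "a \<ge> 0" "b \<ge> 0" by (auto simp: a_def b_def)
  define \<Lambda> where "\<Lambda> = Spow_coeff r \<mu> l (int n)"
  have \<Lambda>0: "\<Lambda> \<noteq> 0" using r l by (simp add: \<Lambda>_def)
  show "analytic_operator N (two_term n a b \<Lambda>)" by (rule analytic_two_term[OF n ab(2,3)])
  show "\<forall>s\<in>slopes (two_term n a b \<Lambda>). real n * s = of_int \<mu>"
    using slopes_two_term_eq[OF n \<Lambda>0] unfolding ab(1)[symmetric] by blast
  show "admissible_slope N r \<mu> (ramify n (two_term n a b \<Lambda>))"
    by (rule admissible_two_term[OF q standing n r l \<Lambda>_def ab(1)])
  show "qdm_iso K (N_module K n r \<mu> l) (operator_module K q (two_term n a b \<Lambda>))"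
    by (rule N_module_iso_two_term[OF n r l cop \<Lambda>_def ab(1)])
qed

end

section \<open>Classification\<close>

text \<open>The predicate \<open>Q\<close> records the permitted ramifications: \<open>n = 1\<close>
  for admissible operators, no restriction for almost admissible ones.\<close>

lemma analytic_irreducible_iso_N_module:
  fixes N :: "'c::alg_closed_field \<Rightarrow> real" and qr :: "nat \<Rightarrow> 'c"
  assumes N: "absval N" and q: "N q = 1" "\<And>k::nat. k \<ge> 1 \<Longrightarrow> q ^ k \<noteq> 1"
    and standing: "geom (\<lambda>k. inverse (N (qpoch q q k)))"
    and qr: "\<And>n::nat. n \<ge> 1 \<Longrightarrow> qr n ^ n = q"
    and M: "qdiff_module (K_field N) q M" "qdm_irreducible (K_field N) M"
    and L: "analytic_operator N L" and iso: "qdm_iso (K_field N) M (operator_module (K_field N) q L)"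
    and adm: "\<And>s. s \<in> slopes L \<Longrightarrow>
      \<exists>n\<ge>1. Q n \<and> (\<exists>\<mu>::int. real n * s = of_int \<mu> \<and> admissible_slope N (qr n) \<mu> (ramify n L))"
  obtains n n0 \<mu>0 l0 where "Q n" "n0 > 0" "n0 \<le> n" "coprime (int n0) \<mu>0" "l0 \<noteq> 0"
    "qdm_iso (K_field N) M (N_module (K_field N) n0 (qr n0) \<mu>0 l0)"
proof -
  interpret absval N by fact
  have q0: "q \<noteq> 0" using q(1) by auto
  have L0: "L \<noteq> 0" using L by (simp add: analytic_operator_def)
  have LK: "coeff L i \<in> K_field N" for i
  proof -
    obtain a where "convergent_fps N a" "coeff L i = fps_to_fls a"
      using L unfolding analytic_operator_def by blast
    then show ?thesis by (simp add: K_field_iff germ_fps_to_fls)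
  qed
  obtain i0 j0 where ij0: "coeff L i0 \<noteq> 0" "coeff L j0 \<noteq> 0" "i0 \<noteq> j0"
    using operator_module_two_coeffs[OF L0 LK q0 iso M] by blast
  obtain s i j where s: "s \<in> slopes L" and ij: "i < j" "coeff L i \<noteq> 0" "coeff L j \<noteq> 0"
    and slope: "real (j - i) * s = real_of_int (fls_subdegree (coeff L j) - fls_subdegree (coeff L i))"
    and low: "\<forall>k. coeff L k \<noteq> 0 \<longrightarrow>
      real_of_int (fls_subdegree (coeff L i)) - s * real i \<le> real_of_int (fls_subdegree (coeff L k)) - s * real k"
    by (rule exists_slope[OF ij0]) (rule that, assumption+)
  obtain n \<mu> where n: "n \<ge> 1" "Q n" and \<mu>: "real n * s = of_int \<mu>"
    and ad: "admissible_slope N (qr n) \<mu> (ramify n L)"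
    using adm[OF s] by blast
  obtain l v where l: "l \<noteq> 0" and v: "v \<in> K_field N" "fls_nth v 0 = 1"
    and sol: "(\<Sum>i\<le>degree L. fls_compose_power (coeff L i) n * Spow (qr n) \<mu> l (int i) v) = 0"
    by (rule slope_solution[OF N q standing LK ij(2,3,1) slope low[rule_format] n(1) qr[OF n(1)] \<mu> ad])
  have npos: "n > 0" using n by simp
  have r0: "qr n \<noteq> 0" using qr[OF n(1)] q0 npos by (metis power_0_left less_irrefl)
  obtain \<phi> m' where \<phi>: "\<phi> \<in> qdm_hom (K_field N) (operator_module (K_field N) q L) (N_module (K_field N) n (qr n) \<mu> l)"
    and m': "m' \<in> carrier (operator_module (K_field N) q L)" "\<phi> m' = v"
    using operator_module_hom[OF npos qr[OF n(1)] r0 l LK v(1) sol] by blast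
  obtain h where h: "h \<in> qdm_hom (K_field N) M (operator_module (K_field N) q L)"
    and bij: "bij_betw h (carrier M) (carrier (operator_module (K_field N) q L))"
    using iso unfolding qdm_iso_def by blast
  have "m' \<in> h ` carrier M" unfolding bij_betw_imp_surj_on[OF bij] by (rule m'(1))
  then obtain m where m: "m' = h m" "m \<in> carrier M" by (rule imageE)
  have \<phi>m: "fls_nth (\<phi> (h m)) 0 = 1" unfolding m(1)[symmetric] m'(2) by (rule v(2))
  obtain n0 \<mu>0 l0 where N0: "n0 > 0" "n0 \<le> n" "coprime (int n0) \<mu>0" "l0 \<noteq> 0"
    "qdm_iso (K_field N) M (N_module (K_field N) n0 (qr n0) \<mu>0 l0)"
    by (rule irreducible_iso_N_module[OF N q0 q(2) qr n(1) l M qdm_hom_compose[OF h \<phi>] m(2) \<phi>m])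
  show ?thesis by (rule that[OF n(2) N0])
qed

lemma absval_base_field_norm:
  assumes "base_field_norm N"
  shows "absval N"
proof (rule absval.intro)
  have "absolute_value N" if N: "usual_complex_norm N"
  proof -
    obtain h :: "'a \<Rightarrow> complex" where h: "bij h" "\<And>x y. h (x + y) = h x + h y"
      "\<And>x y. h (x * y) = h x * h y" "\<And>x. N x = cmod (h x)"
      using N unfolding usual_complex_norm_def by blast
    have h0: "h 0 = 0" using h(2)[of 0 0] by simp
    have "h x = 0 \<longleftrightarrow> x = 0" for x using h0 bij_is_inj[OF h(1)] by (metis injD)
    then show ?thesis unfolding absolute_value_def
      by (auto simp: h(2,3,4) norm_mult norm_triangle_ineq)
  qed
  then show "absolute_value N"
    using assms unfolding base_field_norm_def ultrametric_norm_def by blast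
qed

lemma (in absval) M_modules_eq:
  "q' = q \<Longrightarrow> M_modules K q T = {N_module K 1 q' \<mu> l |\<mu> l. l \<in> T}"
  unfolding M_modules_def M_module_eq by simp

text \<open>The common frame of the three classifications: \<open>X\<close> is the set of permitted
  denominators, \<open>{1}\<close> in the admissible case and all positive integers in the other
  two.\<close>

lemma (in absval) N_modules_representatives:
  assumes q: "q \<noteq> 0" "\<And>k::nat. k \<ge> 1 \<Longrightarrow> q ^ k \<noteq> 1"
    and qr: "\<And>n::nat. n \<ge> 1 \<Longrightarrow> qr n ^ n = q"
    and T: "\<And>n::nat. n \<ge> 1 \<Longrightarrow> transversal (root_group n (qr n)) (T n)"
    and X: "X \<subseteq> {n. n > 0}" and S: "S = {N_module K n (qr n) \<mu> l |n \<mu> l. n \<in> X \<and> coprime (int n) \<mu> \<and> l \<in> T n}"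
    and C': "\<And>n \<mu> l. n \<in> X \<Longrightarrow> coprime (int n) \<mu> \<Longrightarrow> l \<noteq> 0 \<Longrightarrow> C' (N_module K n (qr n) \<mu> l)"
    and C: "\<And>M. C M \<Longrightarrow> qdm_irreducible K M \<Longrightarrow>
      \<exists>n\<in>X. \<exists>\<mu> l. coprime (int n) \<mu> \<and> l \<noteq> 0 \<and> qdm_iso K M (N_module K n (qr n) \<mu> l)"
  shows "irreducible_representatives K C C' S"
  unfolding irreducible_representatives_def
proof (intro conjI ballI allI impI)
  have qr0: "qr n \<noteq> 0" if "n > 0" for n using qr[of n] q(1) that by (cases "qr n = 0") (auto simp: power_0_left)
  have Tnz: "l \<noteq> 0" if "n > 0" "l \<in> T n" for n l
    using T[of n] that unfolding transversal_def by auto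
  {
    fix R assume "R \<in> S"
    then obtain n \<mu> l where R: "R = N_module K n (qr n) \<mu> l" "n \<in> X" "coprime (int n) \<mu>" "l \<in> T n"
      unfolding S by blast
    then have n: "n > 0" using X by auto
    show "C' R" unfolding R(1) by (rule C'[OF R(2,3) Tnz[OF n R(4)]])
    show "qdm_irreducible K R"
      unfolding R(1) using n qr[of n] qr0[OF n] Tnz[OF n R(4)] q R(3)
      by (intro irreducible_N_module[where q = q]) auto
  next
    fix R R' assume "R \<in> S" "R' \<in> S" and iso: "qdm_iso K R R'"
    then obtain n \<mu> l n' \<mu>' l' where R: "R = N_module K n (qr n) \<mu> l" "n \<in> X" "coprime (int n) \<mu>" "l \<in> T n"
      and R': "R' = N_module K n' (qr n') \<mu>' l'" "n' \<in> X" "coprime (int n') \<mu>'" "l' \<in> T n'"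
      unfolding S by blast
    have n: "n > 0" "n' > 0" using R R' X by auto
    have nn: "n \<ge> 1" "n' \<ge> 1" using n by auto
    note inv = N_module_iso_invariants[OF n qr0[OF n(1)] Tnz[OF n(1) R(4)] qr0[OF n(2)] Tnz[OF n(2) R'(4)]
      qr[OF nn(1)] qr[OF nn(2)] R(3) R'(3) iso[unfolded R(1) R'(1)]]
    have eq: "n = n'" "\<mu> = \<mu>'" by (rule inv(1), rule inv(2))
    then obtain z k where z: "z ^ n = 1" "l' = l * z * qr n powi k" using inv(3) by auto
    \<comment> \<open>Both \<open>l\<close> and \<open>l'\<close> represent the class of
      \<open>l'\<close> in the same transversal, hence they coincide.\<close>
    have "l' / l \<in> root_group n (qr n)"
      using z Tnz[OF n(1) R(4)] unfolding root_group_def by (intro CollectI exI[of _ z] exI[of _ k]) simp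
    moreover have "l' / l' \<in> root_group n (qr n)"
      using Tnz[OF n(2) R'(4)] unfolding root_group_def by (intro CollectI exI[of _ 1] exI[of _ 0]) simp
    moreover have "\<exists>!t. t \<in> T n \<and> l' / t \<in> root_group n (qr n)"
      using T[OF nn(1)] Tnz[OF n(2) R'(4)] unfolding transversal_def by blast
    ultimately have "l = l'" using R(4) R'(4) eq by blast
    then show "R = R'" unfolding R(1) R'(1) eq by (simp only:)
  next
    fix M assume M: "C M \<and> qdm_irreducible K M"
    from C[OF conjunct1[OF M] conjunct2[OF M]] obtain n \<mu> l where n: "n \<in> X" and cop: "coprime (int n) \<mu>" and l: "l \<noteq> 0"
      and iso: "qdm_iso K M (N_module K n (qr n) \<mu> l)"
      by blast
    have npos: "n > 0" "n \<ge> 1" using n X by auto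
    obtain t where t: "t \<in> T n" "l / t \<in> root_group n (qr n)"
      using T[OF npos(2)] l unfolding transversal_def by blast
    have t0: "t \<noteq> 0" using Tnz[OF npos(1) t(1)] .
    obtain z k where zk: "z ^ n = 1" "l / t = z * qr n powi k" using t(2) unfolding root_group_def by blast
    have z0: "z \<noteq> 0" using zk(1) npos by (cases "z = 0") (auto simp: power_0_left)
    define p where "p = qr n powi k"
    have p0: "p \<noteq> 0" using qr0[OF npos(1)] by (simp add: p_def)
    have "l = (z * p) * t" using zk(2) t0 unfolding p_def[symmetric] by (metis nonzero_eq_divide_eq)
    then have "t = l * inverse z * inverse p" using z0 p0 by (simp add: field_simps)
    then have "t = l * inverse z * qr n powi (- k)" by (simp add: p_def power_int_minus)
    moreover have "inverse z ^ n = 1" using zk(1) by (simp add: power_inverse)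
    ultimately have "\<exists>z k. z ^ n = 1 \<and> t = l * z * qr n powi k" by blast
    then have "qdm_iso K (N_module K n (qr n) \<mu> l) (N_module K n (qr n) \<mu> t)"
      by (rule iffD2[OF N_module_iso_iff[OF npos(1) qr[OF npos(2)] qr0[OF npos(1)] l t0 cop]])
    then have "qdm_iso K M (N_module K n (qr n) \<mu> t)" by (rule qdm_iso_trans[OF iso])
    moreover have "N_module K n (qr n) \<mu> t \<in> S"
      unfolding S using n cop t(1) by (intro CollectI exI[of _ n] exI[of _ \<mu>] exI[of _ t]) simp
    ultimately show "\<exists>R\<in>S. qdm_iso K M R" by (rule bexI)
  }
qed

text \<open>The last conjunct shows that for fixed \<open>n\<close> and \<mu> the isomorphism
  classes are the cosets of \<open>root_group n (qr n)\<close>, so that transversals of this group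
  are the right sets of parameters.\<close>

theorem proposition3p12:
  fixes N :: "'c::alg_closed_field \<Rightarrow> real"
    and q :: 'c and qr :: "nat \<Rightarrow> 'c" and T :: "nat \<Rightarrow> 'c set"
  assumes base: "base_field_norm N"
    and q_norm: "N q = 1"
    and q_not_root_of_unity: "\<And>n::nat. n \<ge> 1 \<Longrightarrow> q ^ n \<noteq> 1"
    and q_roots: "\<And>n::nat. n \<ge> 1 \<Longrightarrow> qr n ^ n = q"
    and standing: "convergent_fps N (Abs_fps (\<lambda>n. 1 / qpoch q q n))"
    and transversals: "\<And>n::nat. n \<ge> 1 \<Longrightarrow> transversal (root_group n (qr n)) (T n)"
  shows
    "irreducible_representatives (K_field N)
       (admissible_module N q :: ('c fls, 'm) qdm \<Rightarrow> bool) (admissible_module N q)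
       (M_modules (K_field N) q (T 1))
     \<and> irreducible_representatives (K_field N)
       (almost_admissible_module N q qr :: ('c fls, 'm) qdm \<Rightarrow> bool)
       (almost_admissible_module N q qr)
       (M_modules (K_field N) q (T 1) \<union> N_modules (K_field N) qr T)
     \<and> irreducible_representatives UNIV
       (qdiff_module UNIV q :: ('c fls, 'm) qdm \<Rightarrow> bool) (qdiff_module UNIV q)
       (M_modules UNIV q (T 1) \<union> N_modules UNIV qr T)
     \<and> (\<forall>F\<in>{K_field N, UNIV}. \<forall>n \<mu> l l'.
          n > 0 \<and> coprime (int n) \<mu> \<and> l \<noteq> 0 \<and> l' \<noteq> 0 \<longrightarrow>
          (qdm_iso F (N_module F n (qr n) \<mu> l) (N_module F n (qr n) \<mu> l') \<longleftrightarrow>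
           (\<exists>z k. z ^ n = 1 \<and> l' = l * z * qr n powi k)))"
proof -
  have absN: "absval N" using base by (rule absval_base_field_norm)
  interpret absval N by (rule absN)
  interpret triv: absval "trivial_norm :: 'c \<Rightarrow> real" by (rule absval_trivial_norm)
  note Ktriv = K_field_trivial_norm[where 'c = 'c]
  have q0: "q \<noteq> 0" using q_norm by auto
  note q_nru = q_not_root_of_unity
  have geo: "geom (\<lambda>k. inverse (N (qpoch q q k)))"
    using standing by (simp add: convergent_fps_iff N_inverse divide_inverse)
  have qr1: "qr 1 = q" using q_roots[of 1] by simp
  have qr0: "qr n \<noteq> 0" if "n > 0" for n
    using q_roots[of n] q0 that by (cases "qr n = 0") (auto simp: power_0_left)
  have qdm: "qdiff_module (K_field N') q (N_module (K_field N') n (qr n) \<mu> l)"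
    if "absval N'" "n > 0" "l \<noteq> 0" for N' n \<mu> l
    using that(2,3) q_roots[of n] qr0[OF that(2)] by (intro absval.qdiff_module_N_module[OF that(1)]) auto
  \<comment> \<open>Because \<open>qr 1 = q\<close>, the rank one modules are the members of
    \<open>N_modules\<close> with \<open>n = 1\<close>, and the union reduces to the latter.\<close>
  have MN: "M_modules F q (T 1) \<union> N_modules F qr T = N_modules F qr T"
    "N_modules F qr T = {N_module F n (qr n) \<mu> l |n \<mu> l. n \<in> {n. n > 0} \<and> coprime (int n) \<mu> \<and> l \<in> T n}"
    if F: "F = K_field N'" and N': "absval N'" for F N'
  proof -
    have "M_modules F q (T 1) \<subseteq> N_modules F qr T"
    proof
      fix R assume "R \<in> M_modules F q (T 1)"
      then obtain \<mu> l where "R = N_module F 1 (qr 1) \<mu> l" "l \<in> T 1"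
        unfolding F absval.M_modules_eq[OF N' qr1] by blast
      then show "R \<in> N_modules F qr T"
        unfolding N_modules_def by (intro CollectI exI[of _ 1] exI[of _ \<mu>] exI[of _ l]) simp
    qed
    then show "M_modules F q (T 1) \<union> N_modules F qr T = N_modules F qr T" by blast
    show "N_modules F qr T = {N_module F n (qr n) \<mu> l |n \<mu> l. n \<in> {n. n > 0} \<and> coprime (int n) \<mu> \<and> l \<in> T n}"
      unfolding N_modules_def by simp
  qed
  have 1: "irreducible_representatives (K_field N)
       (admissible_module N q :: ('c fls, 'm) qdm \<Rightarrow> bool) (admissible_module N q)
       (M_modules (K_field N) q (T 1))"
  proof (rule N_modules_representatives[OF q0 q_nru q_roots transversals, of "{1}"])
    show "M_modules (K_field N) q (T 1)
        = {N_module (K_field N) n (qr n) \<mu> l |n \<mu> l. n \<in> {1} \<and> coprime (int n) \<mu> \<and> l \<in> T n}"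
      unfolding M_modules_eq[OF qr1] by simp
    show "admissible_module N q (N_module (K_field N) n (qr n) \<mu> l)"
      if n: "n \<in> {1}" and cop: "coprime (int n) \<mu>" and l: "l \<noteq> 0" for n \<mu> l
    proof -
      have n1: "n = 1" using n by simp
      obtain L where L: "analytic_operator N L" "\<forall>s\<in>slopes L. real 1 * s = of_int \<mu>"
        "admissible_slope N q \<mu> (ramify 1 L)"
        "qdm_iso (K_field N) (N_module (K_field N) 1 q \<mu> l) (operator_module (K_field N) q L)"
        by (rule N_module_two_term[OF q_norm q_nru geo, of 1 q l \<mu>]) (use q0 l in auto)
      have "admissible_operator N q L"
        unfolding admissible_operator_def using L(2) L(3)[unfolded ramify_1] by (intro ballI exI[of _ \<mu>]) auto
      then show ?thesis
        unfolding admissible_module_def n1 qr1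
        using L(1,4) qdm[OF absN zero_less_one l, unfolded qr1] by blast
    qed
    show "\<exists>n\<in>{1}. \<exists>\<mu> l. coprime (int n) \<mu> \<and> l \<noteq> 0 \<and> qdm_iso (K_field N) M (N_module (K_field N) n (qr n) \<mu> l)"
      if C: "admissible_module N q M" and irr: "qdm_irreducible (K_field N) M" for M :: "('c fls, 'm) qdm"
    proof -
      obtain L where M: "qdiff_module (K_field N) q M" and L: "analytic_operator N L" "admissible_operator N q L"
        "qdm_iso (K_field N) M (operator_module (K_field N) q L)"
        using C unfolding admissible_module_def by blast
      have adm: "\<exists>n\<ge>1. n = 1 \<and> (\<exists>\<mu>::int. real n * s = of_int \<mu> \<and> admissible_slope N (qr n) \<mu> (ramify n L))"
        if s: "s \<in> slopes L" for s
      proof -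
        obtain \<mu> :: int where "s = of_int \<mu>" "admissible_slope N q \<mu> L"
          using L(2) s unfolding admissible_operator_def by blast
        then show ?thesis using qr1 by (intro exI[of _ 1]) (auto simp: ramify_1[simplified])
      qed
      obtain n n0 \<mu>0 l0 where n0: "n = 1" "n0 > 0" "n0 \<le> n" and N0: "coprime (int n0) \<mu>0" "l0 \<noteq> 0"
        "qdm_iso (K_field N) M (N_module (K_field N) n0 (qr n0) \<mu>0 l0)"
        by (rule analytic_irreducible_iso_N_module[where Q = "\<lambda>n. n = 1", OF absN q_norm q_nru geo q_roots M irr L(1,3) adm])
      have "n0 = 1" using n0 by simp
      then show ?thesis using N0 by (intro bexI[of _ n0] exI[of _ \<mu>0] exI[of _ l0] conjI) simp_all
    qed
  qed auto
  have 2: "irreducible_representatives (K_field N)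
       (almost_admissible_module N q qr :: ('c fls, 'm) qdm \<Rightarrow> bool)
       (almost_admissible_module N q qr)
       (M_modules (K_field N) q (T 1) \<union> N_modules (K_field N) qr T)"
    unfolding MN(1)[OF refl absN]
  proof (rule N_modules_representatives[OF q0 q_nru q_roots transversals _ MN(2)[OF refl absN]])
    show "almost_admissible_module N q qr (N_module (K_field N) n (qr n) \<mu> l)"
      if n: "n \<in> {n. n > 0}" and cop: "coprime (int n) \<mu>" and l: "l \<noteq> 0" for n \<mu> l
    proof -
      have npos: "n > 0" "n \<ge> 1" using n by auto
      obtain L where L: "analytic_operator N L" "\<forall>s\<in>slopes L. real n * s = of_int \<mu>"
        "admissible_slope N (qr n) \<mu> (ramify n L)"
        "qdm_iso (K_field N) (N_module (K_field N) n (qr n) \<mu> l) (operator_module (K_field N) q L)"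
        by (rule N_module_two_term[OF q_norm q_nru geo npos(1) q_roots[OF npos(2)] qr0[OF npos(1)] l cop])
      have "almost_admissible_operator N qr L"
        unfolding almost_admissible_operator_def using L(2,3) npos by blast
      then show ?thesis
        unfolding almost_admissible_module_def using L(1,4) qdm[OF absN npos(1) l] by blast
    qed
    show "\<exists>n\<in>{n. n > 0}. \<exists>\<mu> l. coprime (int n) \<mu> \<and> l \<noteq> 0 \<and> qdm_iso (K_field N) M (N_module (K_field N) n (qr n) \<mu> l)"
      if C: "almost_admissible_module N q qr M" and irr: "qdm_irreducible (K_field N) M" for M :: "('c fls, 'm) qdm"
    proof -
      obtain L where M: "qdiff_module (K_field N) q M" and L: "analytic_operator N L" "almost_admissible_operator N qr L"
        "qdm_iso (K_field N) M (operator_module (K_field N) q L)"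
        using C unfolding almost_admissible_module_def by blast
      have adm: "\<exists>n\<ge>1. True \<and> (\<exists>\<mu>::int. real n * s = of_int \<mu> \<and> admissible_slope N (qr n) \<mu> (ramify n L))"
        if "s \<in> slopes L" for s
        using L(2) that unfolding almost_admissible_operator_def by blast
      obtain n n0 \<mu>0 l0 where "n0 > 0" "coprime (int n0) \<mu>0" "l0 \<noteq> 0"
        "qdm_iso (K_field N) M (N_module (K_field N) n0 (qr n0) \<mu>0 l0)"
        by (rule analytic_irreducible_iso_N_module[where Q = "\<lambda>n. True", OF absN q_norm q_nru geo q_roots M irr L(1,3) adm])
      then show ?thesis by (intro bexI[of _ n0] exI[of _ \<mu>0] exI[of _ l0]) simp_all
    qed
  qed auto
  have 3: "irreducible_representatives UNIV
       (qdiff_module UNIV q :: ('c fls, 'm) qdm \<Rightarrow> bool) (qdiff_module UNIV q)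
       (M_modules UNIV q (T 1) \<union> N_modules UNIV qr T)"
    unfolding MN(1)[OF Ktriv[symmetric] absval_trivial_norm]
  proof (rule triv.N_modules_representatives[unfolded Ktriv, OF q0 q_nru q_roots transversals _ MN(2)[OF Ktriv[symmetric] absval_trivial_norm]])
    show "qdiff_module UNIV q (N_module UNIV n (qr n) \<mu> l)"
      if "n \<in> {n. n > 0}" "l \<noteq> 0" for n \<mu> l
      using qdm[OF absval_trivial_norm, of n l \<mu>] that unfolding Ktriv by simp
    show "\<exists>n\<in>{n. n > 0}. \<exists>\<mu> l. coprime (int n) \<mu> \<and> l \<noteq> 0 \<and> qdm_iso UNIV M (N_module UNIV n (qr n) \<mu> l)"
      if M: "qdiff_module UNIV q M" "qdm_irreducible UNIV M" for M :: "('c fls, 'm) qdm"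
    proof -
      obtain n \<mu> l where "n > 0" "coprime (int n) \<mu>" "l \<noteq> 0" "qdm_iso UNIV M (N_module UNIV n (qr n) \<mu> l)"
        by (rule formal_irreducible_iso_N_module[OF q0 q_nru q_roots M])
      then show ?thesis by (intro bexI[of _ n] exI[of _ \<mu>] exI[of _ l]) simp_all
    qed
  qed auto
  have 4: "qdm_iso F (N_module F n (qr n) \<mu> l) (N_module F n (qr n) \<mu> l') \<longleftrightarrow>
           (\<exists>z k. z ^ n = 1 \<and> l' = l * z * qr n powi k)"
    if F: "F = K_field N'" "absval N'" and n: "n > 0" and cop: "coprime (int n) \<mu>" and l: "l \<noteq> 0" "l' \<noteq> 0"
    for F N' n \<mu> l l'
  proof -
    have "n \<ge> 1" using n by simp
    then show ?thesis
      unfolding F(1) by (rule absval.N_module_iso_iff[OF F(2) n q_roots qr0[OF n] l cop])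
  qed
  show ?thesis
  proof (intro conjI 1 2 3 ballI allI impI)
    fix F :: "'c fls set" and n :: nat and \<mu> :: int and l l' :: 'c
    assume F: "F \<in> {K_field N, UNIV}" and "n > 0 \<and> coprime (int n) \<mu> \<and> l \<noteq> 0 \<and> l' \<noteq> 0"
    then have n: "n > 0" "coprime (int n) \<mu>" "l \<noteq> 0" "l' \<noteq> 0" by simp_all
    from F consider "F = K_field N" | "F = UNIV" by blast
    then show "qdm_iso F (N_module F n (qr n) \<mu> l) (N_module F n (qr n) \<mu> l') \<longleftrightarrow>
           (\<exists>z k. z ^ n = 1 \<and> l' = l * z * qr n powi k)"
    proof cases
      case 1
      then show ?thesis using absN n by (rule 4)
    next
      case 2
      then have "F = K_field trivial_norm" by (simp only: Ktriv)
      then show ?thesis using absval_trivial_norm n by (rule 4)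
    qed
  qed
qed

end
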